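(* Suppose $\mathcal A$ is an $L$-definable group and $H$ is an abstract subgroup of $\mathcal A$ (not assumed definable). Let $\alpha$ be the least Morley rank of an $L$-definable set containing $H$. Then there exist a finite-index subgroup $H'\le H$ and an irreducible $L$-definable subgroup $\mathcal C$ of $\mathcal A$ of Morley rank $\alpha$ containing $H'$.
   Context: Everything is in a model of a totally transcendental theory $T$ (with quantifier elimination and elimination of imaginaries) in a language $L$; definable means definable with parameters. Irreducible means of Morley degree $1$. *)

theory Defs
  imports "HOL-Algebra.Coset" "HOL-Library.Disjoint_Sets"
begin

text \<open>Ordinals of cardinality at most that of \<open>'a\<close>: well-orders on subsets of \<open>'a\<close> up to isomorphism.\<close>

quotient_type 'a ordinal = "'a rel" / partial: "\<lambda>r s :: 'a rel. (r, s) \<in> ordIso"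
proof (rule part_equivpI)
  have "Well_order ({} :: 'a rel)"
    by (auto simp: well_order_on_def linear_order_on_def partial_order_on_def preorder_on_def
        refl_on_def trans_def antisym_def total_on_def)
  then have "({} :: 'a rel, {} :: 'a rel) \<in> ordIso"
    by (rule ordIso_reflexive)
  then show "\<exists>r :: 'a rel. (r, r) \<in> ordIso" ..
  show "symp (\<lambda>r s :: 'a rel. (r, s) \<in> ordIso)"
    by (auto intro!: sympI ordIso_symmetric)
  show "transp (\<lambda>r s :: 'a rel. (r, s) \<in> ordIso)"
    by (auto intro!: transpI intro: ordIso_transitive)
qed

instantiation ordinal :: (type) wellorder
begin

lift_definition less_eq_ordinal :: "'a ordinal \<Rightarrow> 'a ordinal \<Rightarrow> bool" is
  "\<lambda>r s. (r, s) \<in> ordLeq"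
  by (meson ordIso_ordLeq_trans ordIso_symmetric ordLeq_ordIso_trans)

lift_definition less_ordinal :: "'a ordinal \<Rightarrow> 'a ordinal \<Rightarrow> bool" is
  "\<lambda>r s. (r, s) \<in> ordLess"
  by (meson ordIso_ordLess_trans ordIso_symmetric ordLess_ordIso_trans)

instance
proof
  fix x y z :: "'a ordinal"
  show "x < y \<longleftrightarrow> x \<le> y \<and> \<not> y \<le> x"
  proof transfer
    fix r s :: "'a rel"
    assume "ordIso2 r r" "ordIso2 s s"
    then have "Well_order r" "Well_order s"
      by (auto simp: ordIso_def)
    then show "ordLess2 r s \<longleftrightarrow> ordLeq3 r s \<and> \<not> ordLeq3 s r"
      using not_ordLeq_iff_ordLess ordLess_imp_ordLeq by blast
  qed
  show "x \<le> x"
    by transfer (rule ordIso_imp_ordLeq)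
  show "x \<le> y \<Longrightarrow> y \<le> z \<Longrightarrow> x \<le> z"
    by transfer (rule ordLeq_transitive)
  show "x \<le> y \<Longrightarrow> y \<le> x \<Longrightarrow> x = y"
    by transfer (simp only: ordIso_iff_ordLeq)
  show "x \<le> y \<or> y \<le> x"
  proof transfer
    fix r s :: "'a rel"
    assume "ordIso2 r r" "ordIso2 s s"
    then have "Well_order r" "Well_order s"
      by (auto simp: ordIso_def)
    then show "ordLeq3 r s \<or> ordLeq3 s r"
      by (rule ordLeq_total)
  qed
next
  fix P :: "'a ordinal \<Rightarrow> bool" and x
  assume step: "\<And>x. (\<And>y. y < x \<Longrightarrow> P y) \<Longrightarrow> P x"
  have ex: "(r, r) \<in> ordIso \<longrightarrow> P (abs_ordinal r)" for r
  proof (induction r rule: wf_induct_rule[OF wf_ordLess])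
    case (1 r)
    show ?case
    proof
      assume r: "(r, r) \<in> ordIso"
      show "P (abs_ordinal r)"
      proof (rule step)
        fix y assume y: "y < abs_ordinal r"
        obtain s where s: "(s, s) \<in> ordIso" "y = abs_ordinal s"
          using Quotient_abs_rep[OF Quotient_ordinal, of y] Quotient_rep_reflp[OF Quotient_ordinal, of y]
          by metis
        with y r have "(s, r) \<in> ordLess"
          by (simp add: less_ordinal.abs_eq)
        then show "P y" using 1 s by blast
      qed
    qed
  qed
  show "P x"
    using ex[of "rep_ordinal x"] Quotient_abs_rep[OF Quotient_ordinal, of x]
      Quotient_rep_reflp[OF Quotient_ordinal, of x] by simp
qed

end

text \<open>A symbol belongs to the language iff its arity is not \<open>None\<close>.\<close>

record ('f, 'r) lang =
  fun_arity :: "'f \<Rightarrow> nat option"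
  rel_arity :: "'r \<Rightarrow> nat option"

text \<open>Variables are de Bruijn indices: \<open>Var i\<close> denotes the \<open>i\<close>-th entry of the list of values,
  and \<open>All\<close> prepends the bound value to that list.\<close>

datatype 'f trm = Var nat | Fn 'f "'f trm list"

datatype ('f, 'r) fm =
    Fls
  | Eq "'f trm" "'f trm"
  | Rel 'r "'f trm list"
  | Imp "('f, 'r) fm" "('f, 'r) fm"
  | All "('f, 'r) fm"

fun is_trm :: "('f, 'r) lang \<Rightarrow> nat \<Rightarrow> 'f trm \<Rightarrow> bool" where
  "is_trm L k (Var i) \<longleftrightarrow> i < k"
| "is_trm L k (Fn f ts) \<longleftrightarrow> fun_arity L f = Some (length ts) \<and> (\<forall>t\<in>set ts. is_trm L k t)"

text \<open>\<open>is_fm L k \<phi>\<close>: \<open>\<phi>\<close> is an \<open>L\<close>-formula whose free variables are among the first \<open>k\<close>.\<close>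

fun is_fm :: "('f, 'r) lang \<Rightarrow> nat \<Rightarrow> ('f, 'r) fm \<Rightarrow> bool" where
  "is_fm L k Fls \<longleftrightarrow> True"
| "is_fm L k (Eq s t) \<longleftrightarrow> is_trm L k s \<and> is_trm L k t"
| "is_fm L k (Rel R ts) \<longleftrightarrow> rel_arity L R = Some (length ts) \<and> (\<forall>t\<in>set ts. is_trm L k t)"
| "is_fm L k (Imp \<phi> \<psi>) \<longleftrightarrow> is_fm L k \<phi> \<and> is_fm L k \<psi>"
| "is_fm L k (All \<phi>) \<longleftrightarrow> is_fm L (Suc k) \<phi>"

fun qfree :: "('f, 'r) fm \<Rightarrow> bool" where
  "qfree (Imp \<phi> \<psi>) \<longleftrightarrow> qfree \<phi> \<and> qfree \<psi>"
| "qfree (All \<phi>) \<longleftrightarrow> False"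
| "qfree _ \<longleftrightarrow> True"

record ('f, 'r, 'u) lstruct =
  univ :: "'u set"
  fun_int :: "'f \<Rightarrow> 'u list \<Rightarrow> 'u"
  rel_int :: "'r \<Rightarrow> 'u list \<Rightarrow> bool"

definition tuples :: "('f, 'r, 'u) lstruct \<Rightarrow> nat \<Rightarrow> 'u list set" where
  "tuples M n = {xs. length xs = n \<and> set xs \<subseteq> univ M}"

definition is_struct :: "('f, 'r) lang \<Rightarrow> ('f, 'r, 'u) lstruct \<Rightarrow> bool" where
  "is_struct L M \<longleftrightarrow> univ M \<noteq> {} \<and>
     (\<forall>f k. fun_arity L f = Some k \<longrightarrow> (\<forall>xs\<in>tuples M k. fun_int M f xs \<in> univ M))"

primrec eval :: "('f, 'r, 'u) lstruct \<Rightarrow> 'u list \<Rightarrow> 'f trm \<Rightarrow> 'u" where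
  "eval M xs (Var i) = xs ! i"
| "eval M xs (Fn f ts) = fun_int M f (map (eval M xs) ts)"

primrec sat :: "('f, 'r, 'u) lstruct \<Rightarrow> 'u list \<Rightarrow> ('f, 'r) fm \<Rightarrow> bool" where
  "sat M xs Fls \<longleftrightarrow> False"
| "sat M xs (Eq s t) \<longleftrightarrow> eval M xs s = eval M xs t"
| "sat M xs (Rel R ts) \<longleftrightarrow> rel_int M R (map (eval M xs) ts)"
| "sat M xs (Imp \<phi> \<psi>) \<longleftrightarrow> (sat M xs \<phi> \<longrightarrow> sat M xs \<psi>)"
| "sat M xs (All \<phi>) \<longleftrightarrow> (\<forall>a\<in>univ M. sat M (a # xs) \<phi>)"

definition is_theory :: "('f, 'r) lang \<Rightarrow> ('f, 'r) fm set \<Rightarrow> bool" where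
  "is_theory L T \<longleftrightarrow> (\<forall>\<phi>\<in>T. is_fm L 0 \<phi>)"

definition is_model :: "('f, 'r) lang \<Rightarrow> ('f, 'r) fm set \<Rightarrow> ('f, 'r, 'u) lstruct \<Rightarrow> bool" where
  "is_model L T M \<longleftrightarrow> is_struct L M \<and> (\<forall>\<phi>\<in>T. sat M [] \<phi>)"

definition elem_substruct ::
  "('f, 'r) lang \<Rightarrow> ('f, 'r, 'u) lstruct \<Rightarrow> ('f, 'r, 'u) lstruct \<Rightarrow> bool" where
  "elem_substruct L M N \<longleftrightarrow> is_struct L M \<and> is_struct L N \<and> univ M \<subseteq> univ N \<and>
     (\<forall>f k. fun_arity L f = Some k \<longrightarrow> (\<forall>xs\<in>tuples M k. fun_int M f xs = fun_int N f xs)) \<and>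
     (\<forall>R k. rel_arity L R = Some k \<longrightarrow> (\<forall>xs\<in>tuples M k. rel_int M R xs = rel_int N R xs)) \<and>
     (\<forall>k \<phi>. is_fm L k \<phi> \<longrightarrow> (\<forall>xs\<in>tuples M k. sat M xs \<phi> \<longleftrightarrow> sat N xs \<phi>))"

definition aleph0_saturated :: "('f, 'r) lang \<Rightarrow> ('f, 'r, 'u) lstruct \<Rightarrow> bool" where
  "aleph0_saturated L N \<longleftrightarrow> (\<forall>k. \<forall>ps\<in>tuples N k. \<forall>\<Phi>. (\<forall>\<phi>\<in>\<Phi>. is_fm L (Suc k) \<phi>) \<longrightarrow>
     (\<forall>\<Psi>\<subseteq>\<Phi>. finite \<Psi> \<longrightarrow> (\<exists>a\<in>univ N. \<forall>\<phi>\<in>\<Psi>. sat N (a # ps) \<phi>)) \<longrightarrow>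
     (\<exists>a\<in>univ N. \<forall>\<phi>\<in>\<Phi>. sat N (a # ps) \<phi>))"

text \<open>The subset of the \<open>n\<close>-th Cartesian power of \<open>M\<close> defined by \<open>\<phi>\<close> with parameters \<open>ps\<close>.\<close>

definition solutions ::
  "('f, 'r, 'u) lstruct \<Rightarrow> nat \<Rightarrow> ('f, 'r) fm \<Rightarrow> 'u list \<Rightarrow> 'u list set" where
  "solutions M n \<phi> ps = {xs\<in>tuples M n. sat M (xs @ ps) \<phi>}"

definition definable ::
  "('f, 'r) lang \<Rightarrow> ('f, 'r, 'u) lstruct \<Rightarrow> nat \<Rightarrow> 'u list set \<Rightarrow> bool" where
  "definable L M n X \<longleftrightarrow>
     (\<exists>m \<phi>. \<exists>ps\<in>tuples M m. is_fm L (n + m) \<phi> \<and> X = solutions M n \<phi> ps)"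

text \<open>\<open>X(N)\<close> for an \<open>M\<close>-definable set \<open>X\<close>. If \<open>M\<close> is an elementary substructure of \<open>N\<close>, all formulas
  over \<open>M\<close> defining \<open>X\<close> in \<open>M\<close> define the same set in \<open>N\<close>, so the union has at most one member.\<close>

definition extension :: "('f, 'r) lang \<Rightarrow> ('f, 'r, 'u) lstruct \<Rightarrow> ('f, 'r, 'u) lstruct \<Rightarrow> nat \<Rightarrow>
    'u list set \<Rightarrow> 'u list set" where
  "extension L M N n X = \<Union>{solutions N n \<phi> ps | \<phi> ps m.
     ps \<in> tuples M m \<and> is_fm L (n + m) \<phi> \<and> X = solutions M n \<phi> ps}"

text \<open>\<open>morley_ge L N n X \<alpha>\<close>: the definable set \<open>X\<close> in \<open>N\<close> has Morley rank at least \<open>\<alpha>\<close>, the rank being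
  computed in \<open>N\<close>. This is the Morley rank when \<open>N\<close> is \<open>\<aleph>\<^sub>0\<close>-saturated. The ordinals below an
  ordinal-valued rank are ranks of definable subsets, so \<open>'u list set ordinal\<close> contains every
  possible ordinal value together with its successor.\<close>

inductive morley_ge :: "('f, 'r) lang \<Rightarrow> ('f, 'r, 'u) lstruct \<Rightarrow> nat \<Rightarrow>
    'u list set \<Rightarrow> 'u list set ordinal \<Rightarrow> bool"
  for L :: "('f, 'r) lang" and N :: "('f, 'r, 'u) lstruct" and n :: nat where
  zero: "\<lbrakk>definable L N n X; X \<noteq> {}; \<forall>\<beta>. \<alpha> \<le> \<beta>\<rbrakk> \<Longrightarrow> morley_ge L N n X \<alpha>"
| succ: "\<lbrakk>definable L N n X; \<beta> < \<alpha>; \<forall>\<gamma><\<alpha>. \<gamma> \<le> \<beta>;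
    \<forall>i::nat. definable L N n (Y i) \<and> Y i \<subseteq> X \<and> morley_ge L N n (Y i) \<beta>;
    disjoint_family Y\<rbrakk> \<Longrightarrow> morley_ge L N n X \<alpha>"
| limit: "\<lbrakk>definable L N n X; \<exists>\<beta>. \<beta> < \<alpha>; \<forall>\<beta><\<alpha>. \<exists>\<gamma>. \<beta> < \<gamma> \<and> \<gamma> < \<alpha>;
    \<forall>\<beta><\<alpha>. morley_ge L N n X \<beta>\<rbrakk> \<Longrightarrow> morley_ge L N n X \<alpha>"

definition has_morley_rank :: "('f, 'r) lang \<Rightarrow> ('f, 'r, 'u) lstruct \<Rightarrow> nat \<Rightarrow>
    'u list set \<Rightarrow> 'u list set ordinal \<Rightarrow> bool" where
  "has_morley_rank L N n X \<alpha> \<longleftrightarrow> morley_ge L N n X \<alpha> \<and> (\<forall>\<beta>>\<alpha>. \<not> morley_ge L N n X \<beta>)"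

definition splits_into :: "('f, 'r) lang \<Rightarrow> ('f, 'r, 'u) lstruct \<Rightarrow> nat \<Rightarrow>
    'u list set \<Rightarrow> 'u list set ordinal \<Rightarrow> nat \<Rightarrow> bool" where
  "splits_into L N n X \<alpha> d \<longleftrightarrow> (\<exists>Y. disjoint_family_on Y {..<d} \<and>
     (\<forall>i<d. definable L N n (Y i) \<and> Y i \<subseteq> X \<and> has_morley_rank L N n (Y i) \<alpha>))"

definition has_morley_degree :: "('f, 'r) lang \<Rightarrow> ('f, 'r, 'u) lstruct \<Rightarrow> nat \<Rightarrow>
    'u list set \<Rightarrow> nat \<Rightarrow> bool" where
  "has_morley_degree L N n X d \<longleftrightarrow> (\<exists>\<alpha>. has_morley_rank L N n X \<alpha> \<and>
     splits_into L N n X \<alpha> d \<and> (\<forall>k. splits_into L N n X \<alpha> k \<longrightarrow> k \<le> d))"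

definition irreducible_in :: "('f, 'r) lang \<Rightarrow> ('f, 'r, 'u) lstruct \<Rightarrow> nat \<Rightarrow>
    'u list set \<Rightarrow> bool" where
  "irreducible_in L N n X \<longleftrightarrow> has_morley_degree L N n X 1"

text \<open>In the next three definitions the models of \<open>T\<close> range over structures whose elements have
  type \<open>'u\<close>. Morley rank is \<open>< \<infinity>\<close> iff it fails to be at least some ordinal.\<close>

definition totally_transcendental ::
  "('f, 'r) lang \<Rightarrow> ('f, 'r) fm set \<Rightarrow> 'u itself \<Rightarrow> bool" where
  "totally_transcendental L T (_ :: 'u itself) \<longleftrightarrow>
     (\<forall>(N :: ('f, 'r, 'u) lstruct) n X. is_model L T N \<and> aleph0_saturated L N \<and> definable L N n X \<longrightarrow>
        (\<exists>\<alpha>. \<not> morley_ge L N n X \<alpha>))"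

definition quantifier_elimination ::
  "('f, 'r) lang \<Rightarrow> ('f, 'r) fm set \<Rightarrow> 'u itself \<Rightarrow> bool" where
  "quantifier_elimination L T (_ :: 'u itself) \<longleftrightarrow>
     (\<forall>k \<phi>. is_fm L k \<phi> \<longrightarrow> (\<exists>\<psi>. is_fm L k \<psi> \<and> qfree \<psi> \<and>
        (\<forall>N :: ('f, 'r, 'u) lstruct. is_model L T N \<longrightarrow>
           (\<forall>xs\<in>tuples N k. sat N xs \<phi> \<longleftrightarrow> sat N xs \<psi>))))"

text \<open>Every class of a \<open>\<emptyset>\<close>-definable equivalence relation has a canonical parameter: it is
  \<open>\<psi>(N, b)\<close> for some formula \<open>\<psi>\<close> and exactly one tuple \<open>b\<close>.\<close>

definition elimination_of_imaginaries ::
  "('f, 'r) lang \<Rightarrow> ('f, 'r) fm set \<Rightarrow> 'u itself \<Rightarrow> bool" where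
  "elimination_of_imaginaries L T (_ :: 'u itself) \<longleftrightarrow>
     (\<forall>(N :: ('f, 'r, 'u) lstruct) n \<theta>. is_model L T N \<and> is_fm L (n + n) \<theta> \<and>
        equiv (tuples N n) {(x, y). x \<in> tuples N n \<and> y \<in> tuples N n \<and> sat N (x @ y) \<theta>} \<longrightarrow>
        (\<forall>a\<in>tuples N n. \<exists>m \<psi>. is_fm L (n + m) \<psi> \<and>
           (\<exists>!b. b \<in> tuples N m \<and> solutions N n \<psi> b = solutions N n \<theta> a)))"

definition definable_group ::
  "('f, 'r) lang \<Rightarrow> ('f, 'r, 'u) lstruct \<Rightarrow> nat \<Rightarrow> 'u list monoid \<Rightarrow> bool" where
  "definable_group L M n G \<longleftrightarrow> group G \<and> definable L M n (carrier G) \<and>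
     definable L M (n + n + n) {x @ y @ (x \<otimes>\<^bsub>G\<^esub> y) | x y. x \<in> carrier G \<and> y \<in> carrier G}"

end

theory Submission
  imports Defs "HOL-Library.Ramsey"
begin

text \<open>
  The subgroup \<open>\<C>\<close> comes from the stabilizer of a generic type, in three steps. Sets definable with
  parameters from \<open>M\<close> are identified with their extensions to \<open>N\<close>, so that everything happens in
  \<open>N\<close>; a set is \<^emph>\<open>big\<close> if its rank is at least \<open>\<alpha>\<close>, and small otherwise.

  \<^emph>\<open>A subgroup of rank \<open>\<alpha>\<close>.\<close> Choose a set \<open>X \<supseteq> H\<close> of rank \<open>\<alpha>\<close>, definable over \<open>M\<close>, that agrees up to
  small sets with \<open>X \<inter> X'\<close> for every \<open>X' \<supseteq> H\<close> definable over \<open>M\<close>. Then the translates \<open>hX\<close>, for \<open>h\<close>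
  in \<open>H\<close>, are contained in \<open>X\<close> up to small sets. Let \<open>Y \<subseteq> X\<close> be big and irreducible over \<open>M\<close>. Since only
  finitely many essentially disjoint translates of \<open>Y\<close> fit into \<open>X\<close>, the elements \<open>h\<close> of \<open>H\<close> such
  that \<open>hY\<close> agrees with \<open>Y\<close> up to a small set form a subgroup of finite index (\<open>stab_finite_index\<close>).
  They all lie in the stabilizer of \<open>Y\<close>, a subgroup that is definable (\<open>stab_definable\<close>) and of rank
  \<open>\<alpha>\<close>, being covered by finitely many right translates of \<open>Y\<close> (\<open>stab_hull_rank\<close>).

  \<^emph>\<open>Its connected component.\<close> Consider the subgroups of this stabilizer that are definable over \<open>M\<close>
  and contain a subgroup of finite index of \<open>H\<close>. They are big, and if \<open>C' \<subset> C\<close> are two of them then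
  \<open>C - C'\<close> contains a coset of \<open>C'\<close> and is big as well; as the rank is only \<open>\<alpha>\<close>, there is a minimal
  one, \<open>C\<close>. By minimality and the first step, \<open>C\<close> stabilizes every big irreducible subset of itself.

  \<^emph>\<open>Irreducibility.\<close> If \<open>Y\<close> and \<open>Y'\<close> are big irreducible subsets of \<open>C\<close>, then both are invariant under \<open>C\<close>
  up to small sets, and a big part of \<open>Y'\<close> consists of inverses of elements of \<open>Y\<close>; otherwise, choosing
  generic elements \<open>w\<close> of \<open>Y\<close> and \<open>x\<close> of \<open>Y'\<close> in turns would produce the order property for a formula
  about \<open>w\<inverse>x\<close> (\<open>inverse_meets\<close>). Hence \<open>Y\<close> and \<open>Y'\<close> cannot be disjoint, and \<open>C\<close> does not split
  over \<open>M\<close>. A splitting defined over \<open>N\<close> is reduced to one over \<open>M\<close>: a definable subset of \<open>C\<close> is big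
  iff finitely many two-sided translates of it cover \<open>C\<close> (\<open>two_sided_cover\<close>, \<open>big_if_covers\<close>), and
  such a covering is a first-order property of the parameters.

  Total transcendence is used in two forms. Finiteness of the Morley degree is \<open>morley_ge_successor\<close>:
  if a big set can be split off again and again, then the rank exceeds \<open>\<alpha>\<close>. Stability is
  \<open>no_order_property\<close>, which acts through two combinatorial principles: alternating choices
  end with a finite cover (\<open>finite_cover_if_no_order\<close>), and generic types are definable
  (\<open>erdos_makkai\<close>).
\<close>

section \<open>Renaming variables\<close>

primrec rename_trm :: "(nat \<Rightarrow> nat) \<Rightarrow> 'f trm \<Rightarrow> 'f trm" where
  "rename_trm f (Var i) = Var (f i)"
| "rename_trm f (Fn g ts) = Fn g (map (rename_trm f) ts)"

primrec rename :: "('f, 'r) fm \<Rightarrow> (nat \<Rightarrow> nat) \<Rightarrow> ('f, 'r) fm" where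
  "rename Fls f = Fls"
| "rename (Eq s t) f = Eq (rename_trm f s) (rename_trm f t)"
| "rename (Rel R ts) f = Rel R (map (rename_trm f) ts)"
| "rename (Imp \<phi> \<psi>) f = Imp (rename \<phi> f) (rename \<psi> f)"
| "rename (All \<phi>) f = All (rename \<phi> (case_nat 0 (\<lambda>i. Suc (f i))))"

lemma is_trm_rename: "is_trm L k t \<Longrightarrow> (\<And>i. i < k \<Longrightarrow> f i < m) \<Longrightarrow> is_trm L m (rename_trm f t)"
  by (induction t) auto

lemma is_fm_rename: "is_fm L k \<phi> \<Longrightarrow> (\<And>i. i < k \<Longrightarrow> f i < m) \<Longrightarrow> is_fm L m (rename \<phi> f)"
proof (induction \<phi> arbitrary: k m f)
  case (All \<phi>)
  show ?case
    using All.prems by (auto intro!: All.IH split: nat.split)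
qed (auto simp: is_trm_rename)

lemma eval_rename:
  "is_trm L k t \<Longrightarrow> (\<And>i. i < k \<Longrightarrow> xs ! i = ys ! f i) \<Longrightarrow> eval M ys (rename_trm f t) = eval M xs t"
  by (induction t) (auto simp: comp_def cong: map_cong)

lemma sat_rename:
  "is_fm L k \<phi> \<Longrightarrow> (\<And>i. i < k \<Longrightarrow> xs ! i = ys ! f i) \<Longrightarrow> sat M ys (rename \<phi> f) \<longleftrightarrow> sat M xs \<phi>"
proof (induction \<phi> arbitrary: k xs ys f)
  case (All \<phi>)
  have "sat M (a # ys) (rename \<phi> (case_nat 0 (\<lambda>i. Suc (f i)))) \<longleftrightarrow> sat M (a # xs) \<phi>" for a
    using All.prems by (intro All.IH[where k = "Suc k"]) (auto split: nat.split)
  then show ?case by simp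
next
  case (Rel R ts)
  then have "map (eval M ys) (map (rename_trm f) ts) = map (eval M xs) ts"
    by (auto simp: eval_rename)
  then show ?case by (simp only: sat.simps rename.simps)
next
  case (Eq s t)
  then show ?case using eval_rename[of L k _ xs ys f M] by simp
next
  case (Imp \<phi> \<psi>)
  have "sat M ys (rename \<phi> f) \<longleftrightarrow> sat M xs \<phi>" "sat M ys (rename \<psi> f) \<longleftrightarrow> sat M xs \<psi>"
    using Imp.prems by (auto intro!: Imp.IH[where k = k])
  then show ?case by simp
qed simp

section \<open>Definable predicates\<close>

text \<open>In a list of slots \<open>Inl i\<close> stands for the \<open>i\<close>-th variable and \<open>Inr c\<close> for the parameter \<open>c\<close>.\<close>

definition fill :: "(nat \<Rightarrow> 'u) \<Rightarrow> (nat + 'u) list \<Rightarrow> 'u list" where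
  "fill e ss = map (case_sum e id) ss"

lemma fill_simps [simp]: "length (fill e ss) = length ss" "fill e (ss @ ts) = fill e ss @ fill e ts"
  "fill e (map Inl is) = map e is" "fill e (map Inr cs) = cs" "fill e [] = []"
  "fill e (Inl i # ss) = e i # fill e ss" "fill e (Inr c # ss) = c # fill e ss"
  by (auto simp: fill_def comp_def)

locale structured =
  fixes L :: "('f, 'r) lang" and N :: "('f, 'r, 'u) lstruct"
  assumes struct: "is_struct L N"
begin

text \<open>Definability over \<open>B\<close> of a predicate on assignments \<open>e\<close> of values to variables \<open>0, 1, \<dots>\<close>. In this
  form closure under the logical operations becomes a collection of introduction rules for ordinary
  HOL formulas, and a set is proved to be definable by applying them to its description.\<close>

definition dpred :: "'u set \<Rightarrow> ((nat \<Rightarrow> 'u) \<Rightarrow> bool) \<Rightarrow> bool" where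
  "dpred B P \<longleftrightarrow> (\<exists>\<phi> ss. is_fm L (length ss) \<phi> \<and> Inr -` set ss \<subseteq> B \<inter> univ N \<and>
     (\<forall>e. range e \<subseteq> univ N \<longrightarrow> (P e \<longleftrightarrow> sat N (fill e ss) \<phi>)))"

definition dterm :: "'u set \<Rightarrow> ((nat \<Rightarrow> 'u) \<Rightarrow> 'u list) \<Rightarrow> bool" where
  "dterm B t \<longleftrightarrow> (\<exists>ss. Inr -` set ss \<subseteq> B \<inter> univ N \<and> (\<forall>e. t e = fill e ss))"

text \<open>For \<open>B = univ N\<close> these are the definable sets in \<open>N\<close>. If \<open>M\<close> is an elementary substructure of \<open>N\<close>,
  then for \<open>B = univ M\<close> they are the extensions to \<open>N\<close> of the definable sets in \<open>M\<close>.\<close>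

definition dset :: "'u set \<Rightarrow> nat \<Rightarrow> 'u list set \<Rightarrow> bool" where
  "dset B k Q \<longleftrightarrow> Q \<subseteq> tuples N k \<and> dpred B (\<lambda>e. map e [0..<k] \<in> Q)"

lemma univ_nonempty: "univ N \<noteq> {}"
  using struct by (simp add: is_struct_def)

lemma map_env_tuples: "range e \<subseteq> univ N \<Longrightarrow> map e is \<in> tuples N (length is)"
  by (auto simp: tuples_def)

text \<open>Two formulas can be combined once their variables refer to the same list of slots; one such list is
  the concatenation of the lists of both.\<close>

lemma reslot:
  assumes "is_fm L (length ss) \<phi>" "set ss \<subseteq> set ts"
  obtains \<psi> where "is_fm L (length ts) \<psi>" "\<And>K e. sat K (fill e ts) \<psi> \<longleftrightarrow> sat K (fill e ss) \<phi>"
proof -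
  have "\<forall>i<length ss. \<exists>j<length ts. ts ! j = ss ! i"
    using assms(2) by (metis in_set_conv_nth nth_mem subsetD)
  then obtain f where f: "\<And>i. i < length ss \<Longrightarrow> f i < length ts \<and> ts ! f i = ss ! i"
    by metis
  show thesis
  proof
    show "is_fm L (length ts) (rename \<phi> f)"
      using assms(1) f by (auto intro: is_fm_rename)
    show "sat K (fill e ts) (rename \<phi> f) \<longleftrightarrow> sat K (fill e ss) \<phi>" for K e
      using f by (intro sat_rename[OF assms(1)]) (auto simp: fill_def)
  qed
qed

lemma dpred_cong:
  "(\<And>e. range e \<subseteq> univ N \<Longrightarrow> P e \<longleftrightarrow> Q e) \<Longrightarrow> dpred B P \<longleftrightarrow> dpred B Q"
  unfolding dpred_def by (metis (no_types, lifting))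

lemma dpred_eqI:
  "dpred B P \<Longrightarrow> (\<And>e. range e \<subseteq> univ N \<Longrightarrow> P e \<longleftrightarrow> Q e) \<Longrightarrow> dpred B Q"
  using dpred_cong[of P Q B] by simp

lemma dpred_mono: "dpred B P \<Longrightarrow> B \<subseteq> B' \<Longrightarrow> dpred B' P"
  unfolding dpred_def by blast

lemma dpred_const: "dpred B (\<lambda>e. c)"
  unfolding dpred_def
  by (rule exI[of _ "if c then Imp Fls Fls else Fls"], rule exI[of _ "[]"]) auto

lemma dpred_imp:
  assumes "dpred B P" "dpred B Q" shows "dpred B (\<lambda>e. P e \<longrightarrow> Q e)"
proof -
  obtain \<phi> ss where 1: "is_fm L (length ss) \<phi>" "Inr -` set ss \<subseteq> B \<inter> univ N"
    "\<And>e. range e \<subseteq> univ N \<Longrightarrow> P e \<longleftrightarrow> sat N (fill e ss) \<phi>"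
    using assms(1) unfolding dpred_def by blast
  obtain \<psi> ts where 2: "is_fm L (length ts) \<psi>" "Inr -` set ts \<subseteq> B \<inter> univ N"
    "\<And>e. range e \<subseteq> univ N \<Longrightarrow> Q e \<longleftrightarrow> sat N (fill e ts) \<psi>"
    using assms(2) unfolding dpred_def by blast
  obtain \<phi>' where 3: "is_fm L (length (ss @ ts)) \<phi>'"
    "\<And>K e. sat K (fill e (ss @ ts)) \<phi>' \<longleftrightarrow> sat K (fill e ss) \<phi>"
    by (rule reslot[OF 1(1), of "ss @ ts"]) auto
  obtain \<psi>' where 4: "is_fm L (length (ss @ ts)) \<psi>'"
    "\<And>K e. sat K (fill e (ss @ ts)) \<psi>' \<longleftrightarrow> sat K (fill e ts) \<psi>"
    by (rule reslot[OF 2(1), of "ss @ ts"]) auto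
  have "is_fm L (length (ss @ ts)) (Imp \<phi>' \<psi>') \<and> Inr -` set (ss @ ts) \<subseteq> B \<inter> univ N \<and>
     (\<forall>e. range e \<subseteq> univ N \<longrightarrow> ((P e \<longrightarrow> Q e) \<longleftrightarrow> sat N (fill e (ss @ ts)) (Imp \<phi>' \<psi>')))"
    using 1(2,3) 2(2,3) 3 4 by (simp add: vimage_Un)
  then show ?thesis unfolding dpred_def by blast
qed

lemma dpred_not: "dpred B P \<Longrightarrow> dpred B (\<lambda>e. \<not> P e)"
  using dpred_imp[of B P "\<lambda>e. False"] dpred_const[of B False] by simp

lemma dpred_conj: "dpred B P \<Longrightarrow> dpred B Q \<Longrightarrow> dpred B (\<lambda>e. P e \<and> Q e)"
  using dpred_not[OF dpred_imp[OF _ dpred_not], of B P Q] by simp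

lemma dpred_disj: "dpred B P \<Longrightarrow> dpred B Q \<Longrightarrow> dpred B (\<lambda>e. P e \<or> Q e)"
  using dpred_imp[OF dpred_not, of B P Q] by (simp add: imp_conv_disj)

lemma dpred_subst:
  assumes "dpred B P" "\<And>i. \<sigma> i \<in> range Inl \<union> Inr ` (B \<inter> univ N)"
  shows "dpred B (\<lambda>e. P (\<lambda>i. case_sum e id (\<sigma> i)))"
proof -
  obtain \<phi> ss where 1: "is_fm L (length ss) \<phi>" "Inr -` set ss \<subseteq> B \<inter> univ N"
    "\<And>e. range e \<subseteq> univ N \<Longrightarrow> P e \<longleftrightarrow> sat N (fill e ss) \<phi>"
    using assms(1) unfolding dpred_def by blast
  let ?ts = "map (case_sum \<sigma> Inr) ss"
  have fill: "fill e ?ts = fill (\<lambda>i. case_sum e id (\<sigma> i)) ss" for e :: "nat \<Rightarrow> 'u"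
    by (auto simp: fill_def split: sum.split)
  have env: "range (\<lambda>i. case_sum e id (\<sigma> i)) \<subseteq> univ N" if "range e \<subseteq> univ N" for e
  proof -
    have "case_sum e id (\<sigma> i) \<in> univ N" for i
      using assms(2)[of i] that by auto
    then show ?thesis by auto
  qed
  have par: "Inr -` set ?ts \<subseteq> B \<inter> univ N"
  proof
    fix c assume "c \<in> Inr -` set ?ts"
    then obtain s where s: "s \<in> set ss" "Inr c = case_sum \<sigma> Inr s" by auto
    show "c \<in> B \<inter> univ N"
    proof (cases s)
      case (Inl i)
      then show ?thesis using s(2) assms(2)[of i] by auto
    next
      case (Inr d)
      then show ?thesis using s 1(2) by auto
    qed
  qed
  have "is_fm L (length ?ts) \<phi> \<and> Inr -` set ?ts \<subseteq> B \<inter> univ N \<and>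
     (\<forall>e. range e \<subseteq> univ N \<longrightarrow> (P (\<lambda>i. case_sum e id (\<sigma> i)) \<longleftrightarrow> sat N (fill e ?ts) \<phi>))"
    using 1(1,3) fill env par by simp
  then show ?thesis unfolding dpred_def by blast
qed

text \<open>De Bruijn shifting: the quantified element becomes variable \<open>0\<close>, and the other variables move up.\<close>

lemma dpred_all_elem:
  assumes "dpred B P" shows "dpred B (\<lambda>e. \<forall>a\<in>univ N. P (case_nat a e))"
proof -
  obtain \<phi> ss where 1: "is_fm L (length ss) \<phi>" "Inr -` set ss \<subseteq> B \<inter> univ N"
    "\<And>e. range e \<subseteq> univ N \<Longrightarrow> P e \<longleftrightarrow> sat N (fill e ss) \<phi>"
    using assms(1) unfolding dpred_def by blast
  define ts where "ts = map (case_sum (\<lambda>i. Inl (i - 1)) Inr) ss"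
  \<comment> \<open>Variable \<open>0\<close> is bound by the quantifier and gets its own slot; in \<open>ts\<close> it becomes a dummy.\<close>
  let ?us = "Inl 0 # map (case_sum (\<lambda>i. Inl (Suc i)) Inr) ts"
  have "set ss \<subseteq> set ?us"
  proof
    fix s assume s: "s \<in> set ss"
    show "s \<in> set ?us"
    proof (cases s)
      case (Inl i)
      then show ?thesis using s by (cases i) (force simp: ts_def image_image)+
    next
      case (Inr c)
      then show ?thesis using s by (force simp: ts_def image_image)
    qed
  qed
  then obtain \<psi> where \<psi>: "is_fm L (length ?us) \<psi>"
    "\<And>K e. sat K (fill e ?us) \<psi> \<longleftrightarrow> sat K (fill e ss) \<phi>"
    by (rule reslot[OF 1(1)]) blast
  have fill: "fill (case_nat a e) ?us = a # fill e ts" for a and e :: "nat \<Rightarrow> 'u"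
    by (auto simp: fill_def split: sum.split)
  have "Inr -` set ts \<subseteq> B \<inter> univ N"
  proof
    fix c assume "c \<in> Inr -` set ts"
    then obtain s where "s \<in> set ss" "Inr c = case_sum (\<lambda>i. Inl (i - 1)) Inr s"
      unfolding ts_def vimage_def set_map by blast
    moreover have "c \<in> B \<inter> univ N" if "Inr c \<in> set ss" for c using that 1(2) by auto
    ultimately show "c \<in> B \<inter> univ N" by (simp split: sum.splits)
  qed
  moreover have "P (case_nat a e) \<longleftrightarrow> sat N (a # fill e ts) \<psi>"
    if "range e \<subseteq> univ N" "a \<in> univ N" for a e
  proof -
    have "range (case_nat a e) \<subseteq> univ N" using that by (auto simp: image_subset_iff split: nat.split)
    then have "P (case_nat a e) \<longleftrightarrow> sat N (fill (case_nat a e) ss) \<phi>" by (rule 1(3))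
    then show ?thesis using \<psi>(2)[of N "case_nat a e"] fill by simp
  qed
  ultimately have "is_fm L (length ts) (All \<psi>) \<and> Inr -` set ts \<subseteq> B \<inter> univ N \<and>
     (\<forall>e. range e \<subseteq> univ N \<longrightarrow> ((\<forall>a\<in>univ N. P (case_nat a e)) \<longleftrightarrow> sat N (fill e ts) (All \<psi>)))"
    using \<psi>(1) by simp
  then show ?thesis unfolding dpred_def by blast
qed

lemma tuples_Suc: "tuples K (Suc k) = {a # t | a t. a \<in> univ K \<and> t \<in> tuples K k}"
  by (auto simp: tuples_def length_Suc_conv)

lemma tuples_0 [simp]: "tuples K 0 = {[]}"
  by (auto simp: tuples_def)

text \<open>The bound tuple takes the first \<open>j\<close> variables. As \<open>P\<close> receives the assignment and the tuple as separate
  arguments, any bounded quantification in HOL matches the conclusion by higher-order unification.\<close>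

lemma dpred_all:
  "dpred B (\<lambda>e. P (\<lambda>i. e (i + j)) (map e [0..<j])) \<Longrightarrow> dpred B (\<lambda>e. \<forall>x\<in>tuples N j. P e x)"
proof (induction j arbitrary: P)
  case 0
  then show ?case by simp
next
  case (Suc j)
  let ?P = "\<lambda>e t. P (\<lambda>i. e (Suc i)) (e 0 # t)"
  let ?\<sigma> = "\<lambda>i. Inl (if i = 0 then j else if i \<le> j then i - 1 else i) :: nat + 'u"
  have eq: "map (\<lambda>i. case_sum e id (?\<sigma> i)) [0..<Suc j] = e j # map e [0..<j]" for e :: "nat \<Rightarrow> 'u"
    by (subst upt_conv_Cons) (auto simp: map_Suc_upt[symmetric] simp del: upt_Suc)
  have "dpred B (\<lambda>e. P (\<lambda>i. case_sum e id (?\<sigma> (i + Suc j)))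
     (map (\<lambda>i. case_sum e id (?\<sigma> i)) [0..<Suc j]))"
    by (rule dpred_subst[OF Suc.prems]) auto
  then have "dpred B (\<lambda>e. ?P (\<lambda>i. e (i + j)) (map e [0..<j]))"
    unfolding eq by (simp add: add.commute)
  then have "dpred B (\<lambda>e. \<forall>a\<in>univ N. \<forall>x\<in>tuples N j. ?P (case_nat a e) x)"
    by (intro dpred_all_elem Suc.IH)
  then show ?case
    by (rule back_subst[where P = "dpred B"]) (auto simp: tuples_Suc fun_eq_iff)
qed

lemma dpred_ex:
  assumes "dpred B (\<lambda>e. P (\<lambda>i. e (i + j)) (map e [0..<j]))"
  shows "dpred B (\<lambda>e. \<exists>x\<in>tuples N j. P e x)"
proof -
  have "dpred B (\<lambda>e. \<not> (\<forall>x\<in>tuples N j. \<not> P e x))"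
    using assms by (intro dpred_not dpred_all)
  then show ?thesis by simp
qed

lemma dpred_fin_ex:
  "finite I \<Longrightarrow> (\<And>i. i \<in> I \<Longrightarrow> dpred B (P i)) \<Longrightarrow> dpred B (\<lambda>e. \<exists>i\<in>I. P i e)"
  by (induction rule: finite_induct) (auto intro: dpred_const dpred_disj)

lemma dpred_fin_all:
  "finite I \<Longrightarrow> (\<And>i. i \<in> I \<Longrightarrow> dpred B (P i)) \<Longrightarrow> dpred B (\<lambda>e. \<forall>i\<in>I. P i e)"
  by (induction rule: finite_induct) (auto intro: dpred_const dpred_conj)

lemma dterm_map: "dterm B (\<lambda>e. map (\<lambda>i. e (f i)) is)"
  unfolding dterm_def by (rule exI[of _ "map (\<lambda>i. Inl (f i)) is"]) (auto simp: fill_def)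

lemma dterm_const: "c \<in> tuples N k \<Longrightarrow> set c \<subseteq> B \<Longrightarrow> dterm B (\<lambda>e. c)"
  unfolding dterm_def by (rule exI[of _ "map Inr c"]) (auto simp: tuples_def)

lemma dterm_append:
  assumes "dterm B t" "dterm B u" shows "dterm B (\<lambda>e. t e @ u e)"
proof -
  obtain ss ts where "Inr -` set ss \<subseteq> B \<inter> univ N" "\<And>e. t e = fill e ss"
    "Inr -` set ts \<subseteq> B \<inter> univ N" "\<And>e. u e = fill e ts"
    using assms unfolding dterm_def by blast
  then show ?thesis
    unfolding dterm_def by (intro exI[of _ "ss @ ts"]) auto
qed

text \<open>If the length of \<open>t e\<close>, which does not depend on \<open>e\<close>, differs from \<open>k\<close>, then the predicate is
  constantly false.\<close>

lemma dpred_mem: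
  assumes "dset B k Q" "dterm B t" shows "dpred B (\<lambda>e. t e \<in> Q)"
proof -
  obtain ss where ss: "Inr -` set ss \<subseteq> B \<inter> univ N" "\<And>e. t e = fill e ss"
    using assms(2) unfolding dterm_def by blast
  show ?thesis
  proof (cases "length ss = k")
    case False
    then have "t e \<notin> Q" for e
      using assms(1) ss(2) by (auto simp: dset_def tuples_def)
    then show ?thesis by (simp add: dpred_const)
  next
    case True
    let ?\<sigma> = "\<lambda>i. if i < k then ss ! i else Inl 0"
    have "dpred B (\<lambda>e. map (\<lambda>i. case_sum e id (?\<sigma> i)) [0..<k] \<in> Q)"
    proof (rule dpred_subst)
      show "dpred B (\<lambda>e. map e [0..<k] \<in> Q)" using assms(1) by (simp add: dset_def)
      show "?\<sigma> i \<in> range Inl \<union> Inr ` (B \<inter> univ N)" for i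
      proof (cases "?\<sigma> i")
        case (Inr c)
        then have "Inr c \<in> set ss" using True by (auto split: if_splits) (metis nth_mem)
        then show ?thesis using ss(1) Inr by auto
      qed auto
    qed
    moreover have "map (\<lambda>i. case_sum e id (?\<sigma> i)) [0..<k] = t e" for e
      using True ss(2) by (auto simp: fill_def intro!: nth_equalityI)
    ultimately show ?thesis by simp
  qed
qed

lemma dterm_take: "dterm B t \<Longrightarrow> dterm B (\<lambda>e. take i (t e))"
proof -
  assume "dterm B t"
  then obtain ss where "Inr -` set ss \<subseteq> B \<inter> univ N" "\<And>e. t e = fill e ss"
    unfolding dterm_def by blast
  then show ?thesis
    unfolding dterm_def
    by (intro exI[of _ "take i ss"]) (auto simp: fill_def take_map dest!: in_set_takeD)
qed

lemma dterm_drop: "dterm B t \<Longrightarrow> dterm B (\<lambda>e. drop i (t e))"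
proof -
  assume "dterm B t"
  then obtain ss where "Inr -` set ss \<subseteq> B \<inter> univ N" "\<And>e. t e = fill e ss"
    unfolding dterm_def by blast
  then show ?thesis
    unfolding dterm_def
    by (intro exI[of _ "drop i ss"]) (auto simp: fill_def drop_map dest!: in_set_dropD)
qed

lemma dpred_eq:
  assumes "dterm B t" "dterm B u" shows "dpred B (\<lambda>e. t e = u e)"
proof -
  obtain ss ts where ss: "Inr -` set ss \<subseteq> B \<inter> univ N" "\<And>e. t e = fill e ss"
    and ts: "Inr -` set ts \<subseteq> B \<inter> univ N" "\<And>e. u e = fill e ts"
    using assms unfolding dterm_def by blast
  show ?thesis
  proof (cases "length ss = length ts")
    case False
    then have "t e \<noteq> u e" for e using ss(2) ts(2) by (metis fill_simps(1))
    then show ?thesis by (simp add: dpred_const)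
  next
    case True
    have "dpred B (\<lambda>e. case_sum e id (ss ! i) = case_sum e id (ts ! i))" if "i < length ss" for i
    proof -
      have mem: "ss ! i \<in> set ss" "ts ! i \<in> set ts" using that True by auto
      have par: "Inr -` set [ss ! i, ts ! i] \<subseteq> B \<inter> univ N"
        using ss(1) ts(1) mem by auto
      have "is_fm L (length [ss ! i, ts ! i]) (Eq (Var 0) (Var 1))" by simp
      moreover have "(case_sum e id (ss ! i) = case_sum e id (ts ! i)) \<longleftrightarrow>
          sat N (fill e [ss ! i, ts ! i]) (Eq (Var 0) (Var 1))" for e
        by (simp add: fill_def)
      ultimately show ?thesis unfolding dpred_def using par by blast
    qed
    then have "dpred B (\<lambda>e. \<forall>i\<in>{..<length ss}. case_sum e id (ss ! i) = case_sum e id (ts ! i))"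
      by (intro dpred_fin_all) auto
    then show ?thesis
      by (rule dpred_eqI) (auto simp: ss(2) ts(2) fill_def list_eq_iff_nth_eq True)
  qed
qed

lemma dsetI: "Q \<subseteq> tuples N k \<Longrightarrow> dpred B (\<lambda>e. map e [0..<k] \<in> Q) \<Longrightarrow> dset B k Q"
  by (simp add: dset_def)

lemma dset_Collect:
  assumes "dpred B (\<lambda>e. P (map e [0..<k]))" shows "dset B k {x\<in>tuples N k. P x}"
proof (rule dsetI)
  have "P (map e [0..<k]) \<longleftrightarrow> map e [0..<k] \<in> {x\<in>tuples N k. P x}" if "range e \<subseteq> univ N" for e
    using map_env_tuples[OF that, of "[0..<k]"] by auto
  then show "dpred B (\<lambda>e. map e [0..<k] \<in> {x\<in>tuples N k. P x})"
    by (rule dpred_eqI[OF assms])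
qed auto

lemma append_mem_product:
  assumes "v \<in> tuples N a" "w \<in> tuples N b"
  shows "v @ w \<in> {x @ y | x y. x \<in> tuples N a \<and> y \<in> tuples N b \<and> P x y} \<longleftrightarrow> P v w"
proof -
  have "x = v \<and> y = w" if "v @ w = x @ y" "x \<in> tuples N a" for x y
    using that assms(1) append_eq_append_conv[of v x w y] by (simp add: tuples_def)
  then show ?thesis using assms by blast
qed

lemma dset_Collect2:
  assumes "dpred B (\<lambda>e. P (map e [0..<a]) (map e [a..<a + b]))"
  shows "dset B (a + b) {x @ y | x y. x \<in> tuples N a \<and> y \<in> tuples N b \<and> P x y}"
proof (rule dsetI)
  show "{x @ y | x y. x \<in> tuples N a \<and> y \<in> tuples N b \<and> P x y} \<subseteq> tuples N (a + b)"
    by (auto simp: tuples_def)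
  have "P (map e [0..<a]) (map e [a..<a + b]) \<longleftrightarrow>
    map e [0..<a + b] \<in> {x @ y | x y. x \<in> tuples N a \<and> y \<in> tuples N b \<and> P x y}"
    if "range e \<subseteq> univ N" for e
  proof -
    have "map e [0..<a] \<in> tuples N a" "map e [a..<a + b] \<in> tuples N b"
      using map_env_tuples[OF that, of "[0..<a]"] map_env_tuples[OF that, of "[a..<a + b]"] by auto
    moreover have "map e [0..<a + b] = map e [0..<a] @ map e [a..<a + b]"
      using upt_add_eq_append[of 0 a b] by simp
    ultimately show ?thesis by (simp only: append_mem_product)
  qed
  then show "dpred B (\<lambda>e. map e [0..<a + b] \<in> {x @ y | x y. x \<in> tuples N a \<and> y \<in> tuples N b \<and> P x y})"
    by (rule dpred_eqI[OF assms])
qed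

lemma dset_tuples: "dset B k (tuples N k)"
  using dset_Collect[of B "\<lambda>x. True" k] by (simp add: dpred_const)

lemma dset_empty: "dset B k {}"
  by (simp add: dset_def dpred_const)

lemma dset_mono: "dset B k Q \<Longrightarrow> B \<subseteq> B' \<Longrightarrow> dset B' k Q"
  by (auto simp: dset_def intro: dpred_mono)

lemma dset_subset: "dset B k Q \<Longrightarrow> Q \<subseteq> tuples N k"
  by (simp add: dset_def)

lemma dset_Int: "dset B k P \<Longrightarrow> dset B k Q \<Longrightarrow> dset B k (P \<inter> Q)"
  and dset_Un: "dset B k P \<Longrightarrow> dset B k Q \<Longrightarrow> dset B k (P \<union> Q)"
  and dset_Diff: "dset B k P \<Longrightarrow> dset B k Q \<Longrightarrow> dset B k (P - Q)"
  by (auto simp: dset_def intro: dpred_conj dpred_disj dpred_not)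

lemma dset_UN: "finite I \<Longrightarrow> (\<And>i. i \<in> I \<Longrightarrow> dset B k (F i)) \<Longrightarrow> dset B k (\<Union>i\<in>I. F i)"
  by (induction rule: finite_induct) (auto intro: dset_empty dset_Un)

text \<open>A formula for \<open>Q\<close> may mention variables beyond the first \<open>k\<close>. Membership does not depend on them, so
  they can be replaced by any parameter, for which \<open>ps\<close> has to be nonempty.\<close>

lemma dset_solutions:
  assumes "dset B k Q" "B \<inter> univ N \<subseteq> set ps" "ps \<noteq> []" "set ps \<subseteq> univ N"
  obtains \<phi> where "is_fm L (k + length ps) \<phi>" "Q = solutions N k \<phi> ps"
proof -
  obtain \<phi> ss where 1: "is_fm L (length ss) \<phi>" "Inr -` set ss \<subseteq> B \<inter> univ N"
    "\<And>e. range e \<subseteq> univ N \<Longrightarrow> map e [0..<k] \<in> Q \<longleftrightarrow> sat N (fill e ss) \<phi>"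
    using assms(1) unfolding dset_def dpred_def by blast
  have p: "hd ps \<in> univ N" using assms(3,4) by (cases ps) auto
  let ?h = "\<lambda>i. if i < k then Inl i else Inr (hd ps)"
  let ?ss = "map (case_sum ?h Inr) ss" and ?ts = "map Inl [0..<k] @ map Inr ps"
  have "set ?ss \<subseteq> set ?ts"
  proof
    fix u assume "u \<in> set ?ss"
    then obtain s where s: "s \<in> set ss" "u = case_sum ?h Inr s" by auto
    show "u \<in> set ?ts"
    proof (cases s)
      case (Inr c)
      then have "c \<in> set ps" using s 1(2) assms(2) by blast
      then show ?thesis using Inr s(2) by simp
    qed (use s assms(3) in auto)
  qed
  moreover have "is_fm L (length ?ss) \<phi>" using 1(1) by simp
  ultimately obtain \<psi> where \<psi>: "is_fm L (length ?ts) \<psi>"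
    "\<And>K e. sat K (fill e ?ts) \<psi> \<longleftrightarrow> sat K (fill e ?ss) \<phi>"
    using reslot[of ?ss \<phi> ?ts] by blast
  have *: "x \<in> Q \<longleftrightarrow> sat N (x @ ps) \<psi>" if x: "x \<in> tuples N k" for x
  proof -
    let ?e = "\<lambda>i. if i < k then x ! i else hd ps"
    have e: "range ?e \<subseteq> univ N"
      using x p by (auto simp: tuples_def)
    have m: "map ?e [0..<k] = x"
      using x by (auto simp: tuples_def intro!: nth_equalityI)
    have "fill ?e ?ss = fill ?e ss"
      by (auto simp: fill_def split: sum.split)
    then have "sat N (fill ?e ?ts) \<psi> \<longleftrightarrow> x \<in> Q"
      using \<psi>(2)[of N ?e] 1(3)[OF e] m by simp
    then show ?thesis using m by simp
  qed
  show thesis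
  proof
    show "is_fm L (k + length ps) \<psi>" using \<psi>(1) by simp
    show "Q = solutions N k \<psi> ps"
      using * dset_subset[OF assms(1)] by (auto simp: solutions_def)
  qed
qed

lemma solutions_dset:
  assumes "is_fm L (k + m) \<phi>" "ps \<in> tuples N m" "set ps \<subseteq> B"
  shows "dset B k (solutions N k \<phi> ps)"
proof -
  have "dpred B (\<lambda>e. sat N (map e [0..<k] @ ps) \<phi>)"
    unfolding dpred_def using assms
    by (intro exI[of _ \<phi>] exI[of _ "map Inl [0..<k] @ map Inr ps"]) (auto simp: tuples_def)
  then show ?thesis unfolding solutions_def by (rule dset_Collect)
qed

lemma dset_finite_params:
  assumes "dset B k Q"
  obtains B' where "finite B'" "B' \<subseteq> B \<inter> univ N" "dset B' k Q"
proof -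
  obtain \<phi> ss where 1: "is_fm L (length ss) \<phi>" "Inr -` set ss \<subseteq> B \<inter> univ N"
    "\<And>e. range e \<subseteq> univ N \<Longrightarrow> map e [0..<k] \<in> Q \<longleftrightarrow> sat N (fill e ss) \<phi>"
    using assms(1) unfolding dset_def dpred_def by blast
  show thesis
  proof
    show "finite (Inr -` set ss)" by (simp add: finite_vimageI)
    show "Inr -` set ss \<subseteq> B \<inter> univ N" by fact
    show "dset (Inr -` set ss) k Q"
      using 1 assms unfolding dset_def dpred_def by blast
  qed
qed

lemma definable_iff_dset: "definable L N k Q \<longleftrightarrow> dset (univ N) k Q"
proof
  assume "definable L N k Q"
  then show "dset (univ N) k Q"
    unfolding definable_def by (auto intro: solutions_dset simp: tuples_def)
next
  assume Q: "dset (univ N) k Q"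
  obtain B where B: "finite B" "B \<subseteq> univ N \<inter> univ N" "dset B k Q"
    using dset_finite_params[OF Q] by blast
  obtain c where c: "c \<in> univ N" using univ_nonempty by blast
  obtain qs where qs: "set qs = B" using finite_list[OF B(1)] by blast
  obtain \<phi> where "is_fm L (k + length (c # qs)) \<phi>" "Q = solutions N k \<phi> (c # qs)"
    using dset_solutions[OF B(3), of "c # qs"] qs B(2) c by auto
  then show "definable L N k Q"
    unfolding definable_def using qs B(2) c
    by (intro exI[of _ "length (c # qs)"] exI[of _ \<phi>] bexI[of _ "c # qs"]) (auto simp: tuples_def)
qed

lemma dset_fiber:
  assumes "dset B (a + b) Q" "y \<in> tuples N b" "set y \<subseteq> B"
  shows "dset B a {x \<in> tuples N a. x @ y \<in> Q}"
  using assms by (intro dset_Collect dpred_mem dterm_append dterm_map dterm_const)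

lemma dset_fiber':
  assumes "dset B (a + b) Q" "x \<in> tuples N a" "set x \<subseteq> B"
  shows "dset B b {y \<in> tuples N b. x @ y \<in> Q}"
  using assms by (intro dset_Collect dpred_mem dterm_append dterm_map dterm_const)

lemma dset_proj:
  assumes "dset B (a + b) Q" shows "dset B a {x \<in> tuples N a. \<exists>y\<in>tuples N b. x @ y \<in> Q}"
  using assms by (intro dset_Collect dpred_ex dpred_mem dterm_append dterm_map)

end

section \<open>Saturation\<close>

context structured
begin

text \<open>Saturation is a statement about types in one variable. For tuples, realize the projections to the
  first coordinate by one element, and continue in the fibres over it.\<close>

lemma saturated_decreasing:
  fixes W :: "nat \<Rightarrow> 'u list set"
  assumes sat: "aleph0_saturated L N" and B: "finite B" "B \<subseteq> univ N"
    and W: "\<And>k. dset B j (W k)" "\<And>k. W k \<noteq> {}" "\<And>k. W (Suc k) \<subseteq> W k"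
  shows "\<exists>x. \<forall>k. x \<in> W k"
  using B W
proof (induction j arbitrary: B W)
  case 0
  then have "W k = {[]}" for k using dset_subset[of B 0 "W k"] by force
  then show ?case by auto
next
  case (Suc j)
  define V where "V k = {x \<in> tuples N 1. \<exists>y\<in>tuples N j. x @ y \<in> W k}" for k
  have V: "dset B 1 (V k)" for k
    unfolding V_def using Suc.prems(3)[of k] by (intro dset_proj) simp
  obtain c where c: "c \<in> univ N" using univ_nonempty by blast
  obtain qs where qs: "set qs = B" using finite_list[OF Suc.prems(1)] by blast
  let ?ps = "c # qs"
  have ps: "?ps \<in> tuples N (length ?ps)" using qs c Suc.prems(2) by (auto simp: tuples_def)
  have "\<exists>\<phi>. is_fm L (1 + length ?ps) \<phi> \<and> V k = solutions N 1 \<phi> ?ps" for k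
    by (rule dset_solutions[OF V[of k], of ?ps]) (use qs c Suc.prems(2) in auto)
  then obtain \<phi> where \<phi>: "\<And>k. is_fm L (1 + length ?ps) (\<phi> k)" "\<And>k. V k = solutions N 1 (\<phi> k) ?ps"
    by metis
  have V_iff: "sat N (a # ?ps) (\<phi> k) \<longleftrightarrow> [a] \<in> V k" if "a \<in> univ N" for a k
    using that \<phi>(2)[of k] by (simp add: solutions_def tuples_def)
  have dec: "W k \<subseteq> W i" if "i \<le> k" for i k
    using Suc.prems(5) that by (rule lift_Suc_antimono_le)
  then have decV: "V k \<subseteq> V i" if "i \<le> k" for i k
    using that unfolding V_def by blast
  have Vne: "\<exists>a\<in>univ N. [a] \<in> V k" for k
  proof -
    obtain x where x: "x \<in> W k" "x \<in> tuples N (Suc j)"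
      using Suc.prems(4)[of k] dset_subset[OF Suc.prems(3)[of k]] by blast
    then obtain a t where "x = a # t" "a \<in> univ N" "t \<in> tuples N j" by (auto simp: tuples_Suc)
    then show ?thesis using x unfolding V_def by (intro bexI[of _ a]) (auto simp: tuples_def)
  qed
  have "\<exists>a\<in>univ N. \<forall>\<theta>\<in>\<Psi>. sat N (a # ?ps) \<theta>" if \<Psi>: "\<Psi> \<subseteq> range \<phi>" "finite \<Psi>" for \<Psi>
  proof -
    obtain K where K: "finite K" "\<Psi> = \<phi> ` K" using finite_subset_image[OF \<Psi>(2,1)] by blast
    obtain a where a: "a \<in> univ N" "[a] \<in> V (Max (insert 0 K))" using Vne by blast
    have "[a] \<in> V k" if "k \<in> K" for k
      using decV[of k "Max (insert 0 K)"] a(2) K(1) that by auto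
    then show ?thesis using K(2) a(1) V_iff by (intro bexI[of _ a]) auto
  qed
  then have "\<exists>a\<in>univ N. \<forall>\<theta>\<in>range \<phi>. sat N (a # ?ps) \<theta>"
    using sat[unfolded aleph0_saturated_def, rule_format, OF ps, of "range \<phi>"] \<phi>(1) by auto
  then obtain a where a: "a \<in> univ N" "\<And>k. [a] \<in> V k" using V_iff by auto
  have a1: "[a] \<in> tuples N 1" using a(1) by (simp add: tuples_def)
  have "\<exists>t. \<forall>k. t \<in> {t \<in> tuples N j. [a] @ t \<in> W k}"
  proof (rule Suc.IH)
    show "dset (insert a B) j {t \<in> tuples N j. [a] @ t \<in> W k}" for k
      using dset_mono[OF Suc.prems(3)[of k], of "insert a B"] a1
      by (intro dset_fiber'[of _ 1]) auto
    show "{t \<in> tuples N j. [a] @ t \<in> W k} \<noteq> {}" for k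
      using a(2)[of k] by (auto simp: V_def)
    show "{t \<in> tuples N j. [a] @ t \<in> W (Suc k)} \<subseteq> {t \<in> tuples N j. [a] @ t \<in> W k}" for k
      using Suc.prems(5) by auto
  qed (use Suc.prems(1,2) a(1) in auto)
  then show ?case by auto
qed

end

section \<open>Elementary substructures\<close>

locale elementary_pair = structured L N for L :: "('f, 'r) lang" and N :: "('f, 'r, 'u) lstruct" +
  fixes M :: "('f, 'r, 'u) lstruct"
  assumes elem: "elem_substruct L M N"
begin

lemma univ_M: "univ M \<subseteq> univ N" "univ M \<noteq> {}"
  and sat_M: "is_fm L k \<phi> \<Longrightarrow> xs \<in> tuples M k \<Longrightarrow> sat M xs \<phi> \<longleftrightarrow> sat N xs \<phi>"
  using elem by (auto simp: elem_substruct_def is_struct_def)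

lemma tuples_M: "tuples M k \<subseteq> tuples N k"
  using univ_M(1) by (auto simp: tuples_def)

lemma dset_M_solutions:
  assumes "dset (univ M) k Q"
  obtains m \<phi> ps where "ps \<in> tuples M m" "is_fm L (k + m) \<phi>" "Q = solutions N k \<phi> ps"
proof -
  obtain B where B: "finite B" "B \<subseteq> univ M \<inter> univ N" "dset B k Q"
    using dset_finite_params[OF assms] by blast
  obtain c where c: "c \<in> univ M" using univ_M(2) by blast
  obtain qs where qs: "set qs = B" using finite_list[OF B(1)] by blast
  obtain \<phi> where "is_fm L (k + length (c # qs)) \<phi>" "Q = solutions N k \<phi> (c # qs)"
    by (rule dset_solutions[OF B(3), of "c # qs"]) (use qs B(2) c univ_M(1) in auto)
  then show thesis
    using that[of "c # qs" "length (c # qs)" \<phi>] qs B(2) c by (auto simp: tuples_def)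
qed

lemma solutions_M:
  assumes "ps \<in> tuples M m" "is_fm L (k + m) \<phi>"
  shows "solutions M k \<phi> ps = solutions N k \<phi> ps \<inter> tuples M k"
proof -
  have "sat M (x @ ps) \<phi> \<longleftrightarrow> sat N (x @ ps) \<phi>" if "x \<in> tuples M k" for x
    using that assms by (intro sat_M[of "k + m"]) (auto simp: tuples_def)
  then show ?thesis using tuples_M[of k] by (auto simp: solutions_def)
qed

text \<open>The Tarski--Vaught test, one coordinate at a time.\<close>

lemma dset_M_point:
  "dset (univ M) k Q \<Longrightarrow> Q \<noteq> {} \<Longrightarrow> \<exists>x\<in>tuples M k. x \<in> Q"
proof (induction k arbitrary: Q)
  case 0
  then show ?case using dset_subset[OF 0(1)] by auto
next
  case (Suc k)
  define V where "V = {x \<in> tuples N 1. \<exists>y\<in>tuples N k. x @ y \<in> Q}"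
  have "dset (univ M) 1 V"
    unfolding V_def using Suc.prems(1) by (intro dset_proj) simp
  then obtain m \<phi> ps where \<phi>: "ps \<in> tuples M m" "is_fm L (1 + m) \<phi>" "V = solutions N 1 \<phi> ps"
    by (rule dset_M_solutions)
  let ?\<psi> = "All (Imp \<phi> Fls)"
  have all: "is_fm L m ?\<psi>" using \<phi>(2) by simp
  obtain b y where "b # y \<in> Q" "b \<in> univ N" "y \<in> tuples N k"
    using Suc.prems(2) dset_subset[OF Suc.prems(1)] by (force simp: tuples_Suc)
  then have "[b] \<in> V" by (auto simp: V_def tuples_def)
  then have "\<not> sat N ps ?\<psi>"
    using \<phi>(3) \<open>b \<in> univ N\<close> by (auto simp: solutions_def)
  then have "\<not> sat M ps ?\<psi>"
    using sat_M[OF all \<phi>(1)] by simp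
  then obtain a where a: "a \<in> univ M" "sat M (a # ps) \<phi>" by auto
  have "sat N (a # ps) \<phi>"
    using sat_M[of "1 + m" \<phi> "a # ps"] a \<phi>(1,2) by (auto simp: tuples_def)
  then have "[a] \<in> V"
    using \<phi>(3) a(1) univ_M(1) by (auto simp: solutions_def tuples_def)
  then have "{y \<in> tuples N k. [a] @ y \<in> Q} \<noteq> {}" by (auto simp: V_def)
  moreover have "dset (univ M) k {y \<in> tuples N k. [a] @ y \<in> Q}"
    using Suc.prems(1) a(1) univ_M(1) by (intro dset_fiber'[of _ 1]) (auto simp: tuples_def)
  ultimately obtain y where "y \<in> tuples M k" "a # y \<in> Q"
    using Suc.IH by fastforce
  then show ?case
    using a(1) by (intro bexI[of _ "a # y"]) (auto simp: tuples_def)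
qed

lemma dset_M_subset:
  assumes "dset (univ M) k P" "dset (univ M) k Q" "P \<inter> tuples M k \<subseteq> Q"
  shows "P \<subseteq> Q"
  using dset_M_point[OF dset_Diff[OF assms(1,2)]] assms(3) by blast

text \<open>Only finitely many values of the assignment matter, so a counterexample in \<open>N\<close> is a point of a
  nonempty set definable over \<open>M\<close>.\<close>

lemma dpred_M_all:
  assumes P: "dpred (univ M) P" and M: "\<And>e. range e \<subseteq> univ M \<Longrightarrow> P e"
    and e: "range e \<subseteq> univ N"
  shows "P e"
proof (rule ccontr)
  assume no: "\<not> P e"
  obtain \<phi> ss where 1: "is_fm L (length ss) \<phi>" "Inr -` set ss \<subseteq> univ M \<inter> univ N"
    "\<And>e. range e \<subseteq> univ N \<Longrightarrow> P e \<longleftrightarrow> sat N (fill e ss) \<phi>"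
    using P unfolding dpred_def by blast
  have "finite (Inl -` set ss)" by (simp add: finite_vimageI)
  then obtain K where K: "\<And>i. Inl i \<in> set ss \<Longrightarrow> i < K"
    by (metis finite_nat_set_iff_bounded vimageI)
  obtain c where c: "c \<in> univ M" using univ_M by blast
  let ?env = "\<lambda>xs i. if i < K then xs ! i else c"
  let ?\<sigma> = "\<lambda>i. if i < K then Inl i else Inr c"
  have "dpred (univ M) (\<lambda>e. \<not> P (\<lambda>i. case_sum e id (?\<sigma> i)))"
    using c univ_M(1) by (intro dpred_not dpred_subst[OF P]) auto
  moreover have "(\<lambda>i. case_sum e id (?\<sigma> i)) = ?env (map e [0..<K])" for e
    by auto
  ultimately have "dset (univ M) K {xs \<in> tuples N K. \<not> P (?env xs)}"
    by (intro dset_Collect) simp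
  moreover have "\<not> P (?env (map e [0..<K]))"
  proof -
    have "range (?env (map e [0..<K])) \<subseteq> univ N" using e c univ_M(1) by auto
    moreover have "fill (?env (map e [0..<K])) ss = fill e ss"
      using K by (auto simp: fill_def split: sum.split)
    ultimately show ?thesis using 1(3)[of "?env (map e [0..<K])"] 1(3)[OF e] no by simp
  qed
  then have "map e [0..<K] \<in> {xs \<in> tuples N K. \<not> P (?env xs)}"
    using map_env_tuples[OF e, of "[0..<K]"] by auto
  ultimately obtain xs where xs: "xs \<in> tuples M K" "\<not> P (?env xs)"
    using dset_M_point by blast
  have "range (?env xs) \<subseteq> univ M" using xs(1) c by (auto simp: tuples_def)
  then show False using M xs(2) by blast
qed

text \<open>Transfer from \<open>M\<close> to \<open>N\<close> of universal statements about \<open>n\<close>-tuples; the \<open>i\<close>-th tuple occupies the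
  variables \<open>i * n, \<dots>, i * n + n - 1\<close>.\<close>

lemma blocks_M_all:
  assumes P: "dpred (univ M) (\<lambda>e. P (\<lambda>i. map e [i * n..<i * n + n]))"
    and M: "\<And>v. (\<And>i. v i \<in> tuples M n) \<Longrightarrow> P v"
    and v: "\<And>i. v i \<in> tuples N n"
  shows "P v"
proof -
  obtain c where c: "c \<in> univ N" using univ_nonempty by blast
  let ?e = "\<lambda>k. if n = 0 then c else v (k div n) ! (k mod n)"
  have "?e k \<in> univ N" for k
  proof (cases "n = 0")
    case False
    then have "k mod n < length (v (k div n))" using v[of "k div n"] by (simp add: tuples_def)
    then have "v (k div n) ! (k mod n) \<in> set (v (k div n))" by (rule nth_mem)
    then show ?thesis using v[of "k div n"] False by (auto simp: tuples_def)
  qed (use c in simp)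
  then have "range ?e \<subseteq> univ N" by blast
  then have "P (\<lambda>i. map ?e [i * n..<i * n + n])"
  proof (rule dpred_M_all[OF P, rotated])
    fix e :: "nat \<Rightarrow> 'u" assume "range e \<subseteq> univ M"
    then show "P (\<lambda>i. map e [i * n..<i * n + n])"
      by (intro M) (auto simp: tuples_def)
  qed
  moreover have "map ?e [i * n..<i * n + n] = v i" for i
    using v[of i] by (auto simp: tuples_def list_eq_iff_nth_eq)
  ultimately show ?thesis by simp
qed

text \<open>By the Tarski--Vaught test, formulas over \<open>M\<close> that define the same set in \<open>M\<close> do so in \<open>N\<close>.\<close>

lemma definable_M:
  assumes "dset (univ M) k Q"
  shows "definable L M k (Q \<inter> tuples M k)" "extension L M N k (Q \<inter> tuples M k) = Q"
proof -
  obtain m \<phi> ps where \<phi>: "ps \<in> tuples M m" "is_fm L (k + m) \<phi>" "Q = solutions N k \<phi> ps"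
    using dset_M_solutions[OF assms] by blast
  have Q: "Q \<inter> tuples M k = solutions M k \<phi> ps"
    using solutions_M[OF \<phi>(1,2)] \<phi>(3) by simp
  then show "definable L M k (Q \<inter> tuples M k)"
    using \<phi> unfolding definable_def by blast
  have "solutions N k \<psi> qs = Q"
    if "qs \<in> tuples M m'" "is_fm L (k + m') \<psi>" "Q \<inter> tuples M k = solutions M k \<psi> qs" for \<psi> qs m'
  proof -
    have "dset (univ M) k (solutions N k \<psi> qs)"
      using that(1,2) univ_M(1) by (intro solutions_dset[of _ m']) (auto simp: tuples_def)
    moreover have "Q \<inter> tuples M k = solutions N k \<psi> qs \<inter> tuples M k"
      using solutions_M[OF that(1,2)] that(3) by simp
    ultimately show ?thesis
      using dset_M_subset[OF assms] dset_M_subset[OF _ assms] by blast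
  qed
  then show "extension L M N k (Q \<inter> tuples M k) = Q"
    using \<phi>(1,2) Q \<phi>(3) unfolding extension_def by blast
qed

lemma definable_extension:
  assumes "definable L M k X"
  shows "dset (univ M) k (extension L M N k X)" "X = extension L M N k X \<inter> tuples M k"
proof -
  obtain m \<phi> ps where \<phi>: "ps \<in> tuples M m" "is_fm L (k + m) \<phi>" "X = solutions M k \<phi> ps"
    using assms unfolding definable_def by blast
  have Q: "dset (univ M) k (solutions N k \<phi> ps)"
    using \<phi>(1,2) univ_M(1) by (intro solutions_dset[of _ m]) (auto simp: tuples_def)
  moreover have X: "X = solutions N k \<phi> ps \<inter> tuples M k"
    using solutions_M[OF \<phi>(1,2)] \<phi>(3) by simp
  moreover have "extension L M N k X = solutions N k \<phi> ps"
    using definable_M(2)[OF Q] X by simp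
  ultimately show "dset (univ M) k (extension L M N k X)" "X = extension L M N k X \<inter> tuples M k"
    by auto
qed

end

section \<open>Morley rank\<close>

context structured
begin

lemma morley_ge_definable: "morley_ge L N n X \<alpha> \<Longrightarrow> definable L N n X"
  by (cases rule: morley_ge.cases)

lemma morley_ge_nonempty: "morley_ge L N n X \<alpha> \<Longrightarrow> X \<noteq> {}"
  by (induction rule: morley_ge.induct) blast+

lemma morley_ge_mono:
  "morley_ge L N n X \<alpha> \<Longrightarrow> X \<subseteq> X' \<Longrightarrow> definable L N n X' \<Longrightarrow> morley_ge L N n X' \<alpha>"
proof (induction rule: morley_ge.induct)
  case (zero X \<alpha>)
  then show ?case by (intro morley_ge.zero) auto
next
  case (succ X \<beta> \<alpha> Y)
  then show ?case by (intro morley_ge.succ[of L N n X' \<beta> \<alpha> Y]) blast+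
next
  case (limit X \<alpha>)
  then show ?case by (intro morley_ge.limit) blast+
qed

lemma morley_ge_antimono: "morley_ge L N n X \<alpha> \<Longrightarrow> \<beta> \<le> \<alpha> \<Longrightarrow> morley_ge L N n X \<beta>"
proof (induction arbitrary: \<beta> rule: morley_ge.induct)
  case (zero X \<alpha>)
  then have "\<beta> = \<alpha>" by (simp add: order_antisym)
  then show ?case using zero by (auto intro: morley_ge.zero)
next
  case (succ X \<delta> \<alpha> Y)
  show ?case
  proof (cases "\<beta> = \<alpha>")
    case True
    then show ?thesis
      unfolding True using succ(1-5) by (intro morley_ge.succ[of L N n X \<delta> \<alpha> Y]) blast+
  next
    case False
    then have "\<beta> \<le> \<delta>" using succ by auto
    then have "morley_ge L N n (Y 0) \<beta>" "Y 0 \<subseteq> X" using succ by auto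
    then show ?thesis using succ(1) by (rule morley_ge_mono)
  qed
next
  case (limit X \<alpha>)
  then show ?case
    by (cases "\<beta> = \<alpha>") (auto intro: morley_ge.limit)
qed

text \<open>Infinitely many members of an infinite disjoint family keep their rank on the same side of the
  union.\<close>

lemma morley_ge_Un:
  assumes "morley_ge L N n Z \<delta>" "definable L N n X1" "definable L N n X2" "Z \<subseteq> X1 \<union> X2"
  shows "morley_ge L N n X1 \<delta> \<or> morley_ge L N n X2 \<delta>"
  using assms
proof (induction arbitrary: X1 X2 rule: morley_ge.induct)
  case (zero X \<alpha>)
  then have "X1 \<noteq> {} \<or> X2 \<noteq> {}" by auto
  then show ?case using zero by (auto intro: morley_ge.zero)
next
  case (succ X \<beta> \<alpha> Y)
  have dY: "definable L N n (Y i \<inter> X1)" "definable L N n (Y i \<inter> X2)" for i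
    using succ.prems(1,2) succ(5) by (auto simp: definable_iff_dset intro: dset_Int)
  have "morley_ge L N n (Y i \<inter> X1) \<beta> \<or> morley_ge L N n (Y i \<inter> X2) \<beta>" for i
  proof -
    have "Y i \<subseteq> (Y i \<inter> X1) \<union> (Y i \<inter> X2)" using succ(5) succ.prems(3) by blast
    then show ?thesis using succ(5) dY[of i] by blast
  qed
  then have "{i. morley_ge L N n (Y i \<inter> X1) \<beta>} \<union> {i. morley_ge L N n (Y i \<inter> X2) \<beta>} = UNIV"
    by auto
  then have inf: "infinite {i. morley_ge L N n (Y i \<inter> X1) \<beta>} \<or> infinite {i. morley_ge L N n (Y i \<inter> X2) \<beta>}"
    using finite_UnI infinite_UNIV_nat by metis
  have *: "morley_ge L N n X' \<alpha>" if I: "infinite {i. morley_ge L N n (Y i \<inter> X') \<beta>}"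
    and X': "definable L N n X'" and d: "\<And>i. definable L N n (Y i \<inter> X')" for X'
  proof -
    obtain r :: "nat \<Rightarrow> nat" where r: "strict_mono r" "\<And>k. r k \<in> {i. morley_ge L N n (Y i \<inter> X') \<beta>}"
      using infinite_enumerate[OF I] by blast
    have "disjoint_family (\<lambda>k. Y (r k) \<inter> X')"
      unfolding disjoint_family_on_def
    proof (intro ballI impI)
      fix k l :: nat assume "k \<noteq> l"
      then have "r k \<noteq> r l" using r(1) by (simp add: strict_mono_eq)
      then show "(Y (r k) \<inter> X') \<inter> (Y (r l) \<inter> X') = {}"
        using succ(4) unfolding disjoint_family_on_def by blast
    qed
    then show ?thesis
      using succ(2,3) X' d r(2) by (intro morley_ge.succ[of L N n X' \<beta> \<alpha> "\<lambda>k. Y (r k) \<inter> X'"]) auto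
  qed
  show ?case using inf *[of X1] *[of X2] succ.prems dY by blast
next
  case (limit X \<alpha>)
  have *: "morley_ge L N n X1 \<beta> \<or> morley_ge L N n X2 \<beta>" if "\<beta> < \<alpha>" for \<beta>
    using limit that by blast
  show ?case
  proof (rule ccontr)
    assume no: "\<not> ?case"
    then obtain \<beta>1 where 1: "\<beta>1 < \<alpha>" "\<not> morley_ge L N n X1 \<beta>1"
      using limit(2,3) limit.prems(1) by (meson morley_ge.limit)
    obtain \<beta>2 where 2: "\<beta>2 < \<alpha>" "\<not> morley_ge L N n X2 \<beta>2"
      using no limit(2,3) limit.prems(2) by (meson morley_ge.limit)
    then show False
      using *[of "max \<beta>1 \<beta>2"] 1 2 morley_ge_antimono
      by (metis max.cobounded1 max.cobounded2 max_less_iff_conj)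
  qed
qed

lemma morley_ge_image:
  assumes "morley_ge L N n X \<delta>" "X \<subseteq> G" "inj_on f G"
    and f: "\<And>Z. Z \<subseteq> G \<Longrightarrow> definable L N n Z \<Longrightarrow> definable L N n (f ` Z)"
  shows "morley_ge L N n (f ` X) \<delta>"
  using assms(1,2)
proof (induction rule: morley_ge.induct)
  case (zero X \<alpha>)
  then show ?case by (intro morley_ge.zero f) auto
next
  case (succ X \<beta> \<alpha> Y)
  have "f ` Y i \<inter> f ` Y j = {}" if "i \<noteq> j" for i j
  proof -
    have "Y i \<inter> Y j = {}" using succ(4) that by (auto simp: disjoint_family_on_def)
    moreover have "Y i \<subseteq> G" "Y j \<subseteq> G" using succ(5,6) by auto
    ultimately show ?thesis
      using inj_on_image_Int[OF assms(3), of "Y i" "Y j"] by simp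
  qed
  then have "disjoint_family (\<lambda>i. f ` Y i)" by (auto simp: disjoint_family_on_def)
  moreover have "definable L N n (f ` Y i) \<and> f ` Y i \<subseteq> f ` X \<and> morley_ge L N n (f ` Y i) \<beta>" for i
    using succ(5,6) by (auto intro!: f)
  ultimately show ?case
    using succ(1,2,3,6) by (intro morley_ge.succ[of L N n "f ` X" \<beta> \<alpha> "\<lambda>i. f ` Y i"] f) auto
next
  case (limit X \<alpha>)
  then show ?case by (intro morley_ge.limit f) auto
qed

text \<open>This replaces arguments by minimal rank and degree: if from every set with the property \<open>P\<close> a piece
  of rank \<open>\<ge> \<beta>\<close> can be split off so that \<open>P\<close> survives on the rest, then iteration yields an infinite
  disjoint family of such pieces. The contrapositive finds sets on which \<open>P\<close> is
  minimal.\<close>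

lemma morley_ge_successor:
  assumes "P D"
    and split: "\<And>D. P D \<Longrightarrow> definable L N n D \<and>
      (\<exists>D0 D1. D0 \<subseteq> D \<and> D1 \<subseteq> D \<and> D0 \<inter> D1 = {} \<and> morley_ge L N n D0 \<beta> \<and> P D1)"
    and \<gamma>: "\<beta> < \<gamma>" "\<forall>\<delta><\<gamma>. \<delta> \<le> \<beta>"
  shows "morley_ge L N n D \<gamma>"
proof -
  obtain D0 D1 where s: "\<And>D. P D \<Longrightarrow> D0 D \<subseteq> D \<and> D1 D \<subseteq> D \<and> D0 D \<inter> D1 D = {} \<and>
      morley_ge L N n (D0 D) \<beta> \<and> P (D1 D)"
    using split by metis
  define E where "E i = (D1 ^^ i) D" for i
  have PE: "P (E i)" for i
    by (induction i) (auto simp: E_def assms(1) s)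
  have "E (Suc i) \<subseteq> E i" for i
    using s[OF PE[of i]] by (simp add: E_def)
  then have dec: "E j \<subseteq> E i" if "i \<le> j" for i j
    using that by (rule lift_Suc_antimono_le)
  have disj: "D0 (E i) \<inter> D0 (E j) = {}" if "i < j" for i j
    using s[OF PE[of i]] s[OF PE[of j]] dec[of "Suc i" j] that by (auto simp: E_def)
  have "disjoint_family (\<lambda>i. D0 (E i))"
    unfolding disjoint_family_on_def using disj by (metis Int_commute linorder_neqE_nat)
  moreover have "definable L N n (D0 (E i)) \<and> D0 (E i) \<subseteq> D \<and> morley_ge L N n (D0 (E i)) \<beta>" for i
    using s[OF PE[of i]] dec[of 0 i] morley_ge_definable by (auto simp: E_def)
  ultimately show ?thesis
    using split[OF assms(1)] \<gamma> by (intro morley_ge.succ[of L N n D \<beta> \<gamma> "\<lambda>i. D0 (E i)"]) auto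
qed

text \<open>The least \<open>\<delta>\<close> that is not attained cannot be a limit ordinal.\<close>

lemma morley_rank_exists:
  assumes "definable L N n X" "X \<noteq> {}" "\<not> morley_ge L N n X \<delta>"
  shows "\<exists>\<beta>. has_morley_rank L N n X \<beta>"
proof -
  define \<mu> where "\<mu> = (LEAST \<delta>. \<not> morley_ge L N n X \<delta>)"
  have \<mu>: "\<not> morley_ge L N n X \<mu>" "\<And>\<beta>. \<beta> < \<mu> \<Longrightarrow> morley_ge L N n X \<beta>"
    unfolding \<mu>_def using LeastI[of "\<lambda>\<delta>. \<not> morley_ge L N n X \<delta>", OF assms(3)]
    by (blast dest: not_less_Least)+
  have "\<not> (\<forall>\<beta>. \<mu> \<le> \<beta>)" using \<mu>(1) morley_ge.zero[OF assms(1,2)] by blast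
  then obtain \<beta>0 where "\<beta>0 < \<mu>" by (auto simp: not_le)
  then obtain \<beta> where \<beta>: "\<beta> < \<mu>" "\<forall>\<gamma><\<mu>. \<gamma> \<le> \<beta>"
    using \<mu> morley_ge.limit[OF assms(1), of \<mu>] by (meson not_le)
  have "\<not> morley_ge L N n X \<gamma>" if "\<beta> < \<gamma>" for \<gamma>
  proof
    assume "morley_ge L N n X \<gamma>"
    moreover have "\<mu> \<le> \<gamma>" using \<beta>(2) that by (meson not_le)
    ultimately show False using morley_ge_antimono \<mu>(1) by blast
  qed
  then show ?thesis
    using \<mu>(2) \<beta>(1) unfolding has_morley_rank_def by blast
qed

section \<open>The order property\<close>

text \<open>\<open>X\<close> carries a binary tree of depth \<open>k\<close> of instances of \<open>R\<close> with consistent branches: Shelah's local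
  rank of \<open>X\<close> with respect to \<open>R\<close> is at least \<open>k\<close>.\<close>

primrec tree :: "nat \<Rightarrow> nat \<Rightarrow> 'u list set \<Rightarrow> nat \<Rightarrow> 'u list set \<Rightarrow> bool" where
  "tree n m R 0 X \<longleftrightarrow> X \<noteq> {}"
| "tree n m R (Suc k) X \<longleftrightarrow>
    (\<exists>b\<in>tuples N m. tree n m R k {x\<in>X. x @ b \<in> R} \<and> tree n m R k {x\<in>X. x @ b \<notin> R})"

lemma tree_mono: "tree n m R k X \<Longrightarrow> X \<subseteq> X' \<Longrightarrow> tree n m R k X'"
proof (induction k arbitrary: X X')
  case (Suc k)
  then obtain b where "b \<in> tuples N m" "tree n m R k {x\<in>X. x @ b \<in> R}" "tree n m R k {x\<in>X. x @ b \<notin> R}"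
    by auto
  moreover have "tree n m R k {x\<in>X'. x @ b \<in> R}"
    by (rule Suc.IH[OF \<open>tree n m R k {x\<in>X. x @ b \<in> R}\<close>]) (use Suc.prems(2) in blast)
  moreover have "tree n m R k {x\<in>X'. x @ b \<notin> R}"
    by (rule Suc.IH[OF \<open>tree n m R k {x\<in>X. x @ b \<notin> R}\<close>]) (use Suc.prems(2) in blast)
  ultimately show ?case by auto
qed auto

lemma tree_Suc_imp: "tree n m R (Suc k) X \<Longrightarrow> tree n m R k X"
  unfolding tree.simps by (elim bexE conjE) (erule tree_mono, blast)

text \<open>For the induction the family \<open>F\<close> has to be arbitrary, since each level of the tree adds its instance
  of \<open>R\<close> to the parameters.\<close>

lemma dset_tree:
  "dset B (n + j) F \<Longrightarrow> dset B (n + m) R \<Longrightarrow>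
    dset B j {p \<in> tuples N j. tree n m R k {x \<in> tuples N n. x @ p \<in> F}}"
proof (induction k arbitrary: j F)
  case 0
  have "dset B j {p \<in> tuples N j. \<exists>x\<in>tuples N n. x @ p \<in> F}"
    by (intro dset_Collect dpred_ex dpred_mem[OF 0(1)] dterm_append dterm_map)
  then show ?case
    by (rule back_subst[where P = "dset B j"]) auto
next
  case (Suc k)
  define F1 where "F1 = {x @ q | x q. x \<in> tuples N n \<and> q \<in> tuples N (j + m) \<and> x @ take j q \<in> F \<and> x @ drop j q \<in> R}"
  define F2 where "F2 = {x @ q | x q. x \<in> tuples N n \<and> q \<in> tuples N (j + m) \<and> x @ take j q \<in> F \<and> x @ drop j q \<notin> R}"
  let ?T = "\<lambda>F. {p \<in> tuples N (j + m). tree n m R k {x \<in> tuples N n. x @ p \<in> F}}"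
  have "dset B (n + (j + m)) F1"
    unfolding F1_def by (intro dset_Collect2 dpred_conj dpred_mem[OF Suc.prems(1)] dpred_mem[OF Suc.prems(2)]
        dterm_append dterm_take dterm_drop dterm_map)
  then have T: "dset B (j + m) (?T F1)" using Suc.prems(2) by (rule Suc.IH)
  have "dset B (n + (j + m)) F2"
    unfolding F2_def by (intro dset_Collect2 dpred_conj dpred_not dpred_mem[OF Suc.prems(1)] dpred_mem[OF Suc.prems(2)]
        dterm_append dterm_take dterm_drop dterm_map)
  then have T': "dset B (j + m) (?T F2)" using Suc.prems(2) by (rule Suc.IH)
  have fib: "{x \<in> tuples N n. x @ (p @ b) \<in> F1} = {x \<in> {x \<in> tuples N n. x @ p \<in> F}. x @ b \<in> R}"
    "{x \<in> tuples N n. x @ (p @ b) \<in> F2} = {x \<in> {x \<in> tuples N n. x @ p \<in> F}. x @ b \<notin> R}"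
    if "p \<in> tuples N j" "b \<in> tuples N m" for p b
  proof -
    have pb: "p @ b \<in> tuples N (j + m)" "take j (p @ b) = p" "drop j (p @ b) = b"
      using that by (auto simp: tuples_def)
    show "{x \<in> tuples N n. x @ (p @ b) \<in> F1} = {x \<in> {x \<in> tuples N n. x @ p \<in> F}. x @ b \<in> R}"
      "{x \<in> tuples N n. x @ (p @ b) \<in> F2} = {x \<in> {x \<in> tuples N n. x @ p \<in> F}. x @ b \<notin> R}"
      using append_mem_product[OF _ pb(1), of _ n] pb(2,3)
      by (simp_all add: F1_def F2_def cong: conj_cong)
  qed
  have "dset B j {p \<in> tuples N j. \<exists>b\<in>tuples N m. p @ b \<in> ?T F1 \<and> p @ b \<in> ?T F2}"
    by (intro dset_Collect dpred_ex dpred_conj dpred_mem[OF T] dpred_mem[OF T'] dterm_append dterm_map)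
  moreover have "(\<exists>b\<in>tuples N m. p @ b \<in> ?T F1 \<and> p @ b \<in> ?T F2) \<longleftrightarrow>
      tree n m R (Suc k) {x \<in> tuples N n. x @ p \<in> F}" if p: "p \<in> tuples N j" for p
  proof -
    have "p @ b \<in> tuples N (j + m)" if "b \<in> tuples N m" for b
      using p that by (auto simp: tuples_def)
    then show ?thesis
      using fib[OF p] by simp
  qed
  ultimately show ?case by (simp cong: conj_cong)
qed

text \<open>Bisect the order.\<close>

lemma tree_of_order:
  fixes a b :: "nat \<Rightarrow> 'u list"
  assumes "\<And>i j. a i @ b j \<in> R \<longleftrightarrow> i \<le> j" "\<And>j. b j \<in> tuples N m"
  shows "a ` {s..<s + 2 ^ k} \<subseteq> X \<Longrightarrow> tree n m R k X"
proof (induction k arbitrary: s X)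
  case 0
  then show ?case by auto
next
  case (Suc k)
  let ?j = "s + 2 ^ k - 1"
  have "tree n m R k {x\<in>X. x @ b ?j \<in> R}"
    using Suc.prems assms(1) by (intro Suc.IH[of s]) (auto simp: image_subset_iff)
  moreover have "tree n m R k {x\<in>X. x @ b ?j \<notin> R}"
  proof (intro Suc.IH[of "s + 2 ^ k"] subsetI)
    fix x assume "x \<in> a ` {s + 2 ^ k..<s + 2 ^ k + 2 ^ k}"
    then obtain i where i: "x = a i" "s + 2 ^ k \<le> i" "i < s + 2 ^ Suc k" by auto
    moreover have "\<not> i \<le> ?j" using i(2) by (metis Suc_pred' add_gr_0 not_less_eq_eq zero_less_numeral zero_less_power)
    ultimately show "x \<in> {x\<in>X. x @ b ?j \<notin> R}"
      using Suc.prems assms(1) by (auto simp: image_subset_iff)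
  qed
  ultimately show ?case using assms(2) by auto
qed

text \<open>An order yields trees of every finite depth. By saturation a set with trees of every depth splits into
  two sets with the same property; so all these sets have rank \<open>\<infinity>\<close>, as a set of minimal rank among them
  would contain infinitely many disjoint ones.\<close>

lemma no_order_property:
  assumes sat: "aleph0_saturated L N"
    and ranked: "\<And>X. definable L N n X \<Longrightarrow> \<exists>\<alpha>. \<not> morley_ge L N n X \<alpha>"
    and R: "dset (univ N) (n + m) R"
    and ab: "\<And>i::nat. a i \<in> tuples N n" "\<And>j::nat. b j \<in> tuples N m"
  shows "\<not> (\<forall>i j. a i @ b j \<in> R \<longleftrightarrow> i \<le> j)"
proof
  assume ord: "\<forall>i j. a i @ b j \<in> R \<longleftrightarrow> i \<le> j"
  define P where "P X \<longleftrightarrow> definable L N n X \<and> (\<forall>k. tree n m R k X)" for X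
  have P0: "P (tuples N n)"
    unfolding P_def using ord ab
    by (auto simp: definable_iff_dset dset_tuples intro!: tree_of_order[of a b R m 0])
  have split: "\<exists>D0 D1. D0 \<subseteq> D \<and> D1 \<subseteq> D \<and> D0 \<inter> D1 = {} \<and> P D0 \<and> P D1" if "P D" for D
  proof -
    have D: "dset (univ N) n D" "\<And>k. tree n m R k D"
      using that by (auto simp: P_def definable_iff_dset)
    obtain B1 where B1: "finite B1" "B1 \<subseteq> univ N \<inter> univ N" "dset B1 n D"
      using dset_finite_params[OF D(1)] by blast
    obtain B2 where B2: "finite B2" "B2 \<subseteq> univ N \<inter> univ N" "dset B2 (n + m) R"
      using dset_finite_params[OF R] by blast
    let ?B = "B1 \<union> B2"
    have DB: "dset ?B n D" and RB: "dset ?B (n + m) R"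
      using B1 B2 by (auto elim: dset_mono)
    define F1 where "F1 = {x @ b | x b. x \<in> tuples N n \<and> b \<in> tuples N m \<and> x \<in> D \<and> x @ b \<in> R}"
    define F2 where "F2 = {x @ b | x b. x \<in> tuples N n \<and> b \<in> tuples N m \<and> x \<in> D \<and> x @ b \<notin> R}"
    have F: "dset ?B (n + m) F1"
      unfolding F1_def by (intro dset_Collect2 dpred_conj dpred_mem[OF DB] dpred_mem[OF RB] dterm_append dterm_map)
    have F': "dset ?B (n + m) F2"
      unfolding F2_def by (intro dset_Collect2 dpred_conj dpred_not dpred_mem[OF DB] dpred_mem[OF RB] dterm_append dterm_map)
    let ?W = "\<lambda>F k. {b \<in> tuples N m. tree n m R k {x \<in> tuples N n. x @ b \<in> F}}"
    have fib: "{x \<in> tuples N n. x @ b \<in> F1} = {x\<in>D. x @ b \<in> R}"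
      "{x \<in> tuples N n. x @ b \<in> F2} = {x\<in>D. x @ b \<notin> R}" if "b \<in> tuples N m" for b
      using append_mem_product[OF _ that, of _ n] dset_subset[OF D(1)] by (auto simp: F1_def F2_def cong: conj_cong)
    have "\<exists>b. \<forall>k. b \<in> ?W F1 k \<inter> ?W F2 k"
    proof (rule saturated_decreasing[OF sat])
      show "dset ?B m (?W F1 k \<inter> ?W F2 k)" for k
        by (intro dset_Int dset_tree F F' RB)
      show "?W F1 k \<inter> ?W F2 k \<noteq> {}" for k
      proof -
        obtain b where "b \<in> tuples N m" "tree n m R k {x\<in>D. x @ b \<in> R}" "tree n m R k {x\<in>D. x @ b \<notin> R}"
          using D(2)[of "Suc k"] by auto
        then have "b \<in> ?W F1 k \<inter> ?W F2 k" by (simp add: fib)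
        then show ?thesis by blast
      qed
      show "?W F1 (Suc k) \<inter> ?W F2 (Suc k) \<subseteq> ?W F1 k \<inter> ?W F2 k" for k
        using tree_Suc_imp by blast
    qed (use B1 B2 in auto)
    then obtain b where b': "\<And>k. b \<in> ?W F1 k \<inter> ?W F2 k" by blast
    then have bm: "b \<in> tuples N m" by blast
    have b: "b \<in> tuples N m" "\<And>k. tree n m R k {x\<in>D. x @ b \<in> R}"
      "\<And>k. tree n m R k {x\<in>D. x @ b \<notin> R}"
      using b' bm by (auto simp: fib[OF bm])
    have dR: "dset (univ N) n {x\<in>tuples N n. x @ b \<in> R}"
      using R b(1) by (intro dset_fiber) (auto simp: tuples_def)
    have "{x\<in>D. x @ b \<in> R} = D \<inter> {x\<in>tuples N n. x @ b \<in> R}"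
      "{x\<in>D. x @ b \<notin> R} = D - {x\<in>tuples N n. x @ b \<in> R}"
      using dset_subset[OF D(1)] by auto
    then have "P {x\<in>D. x @ b \<in> R}" "P {x\<in>D. x @ b \<notin> R}"
      unfolding P_def definable_iff_dset using b(2,3) D(1) dR by (auto intro: dset_Int dset_Diff)
    then show ?thesis
      by (intro exI[of _ "{x\<in>D. x @ b \<in> R}"] exI[of _ "{x\<in>D. x @ b \<notin> R}"]) auto
  qed
  define \<mu> where "\<mu> = (LEAST \<delta>. \<exists>X. P X \<and> \<not> morley_ge L N n X \<delta>)"
  have "\<exists>\<delta> X. P X \<and> \<not> morley_ge L N n X \<delta>"
    using P0 ranked unfolding P_def by blast
  then have "\<exists>X. P X \<and> \<not> morley_ge L N n X \<mu>"
    unfolding \<mu>_def by (rule LeastI_ex)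
  then obtain X where X: "P X" "\<not> morley_ge L N n X \<mu>" by blast
  have below: "morley_ge L N n Y \<delta>" if "P Y" "\<delta> < \<mu>" for Y \<delta>
    using not_less_Least[OF that(2)[unfolded \<mu>_def]] that(1) by blast
  have dX: "definable L N n X" "X \<noteq> {}"
    using X(1) unfolding P_def by (auto dest: spec[of _ 0])
  have "\<not> (\<forall>\<beta>. \<mu> \<le> \<beta>)" using X(2) morley_ge.zero[OF dX] by blast
  then obtain \<delta>0 where "\<delta>0 < \<mu>" by (auto simp: not_le)
  then obtain \<beta> where \<beta>: "\<beta> < \<mu>" "\<forall>\<delta><\<mu>. \<delta> \<le> \<beta>"
    using X below morley_ge.limit[OF dX(1), of \<mu>] by (meson not_le)
  have "morley_ge L N n X \<mu>"
  proof (rule morley_ge_successor[of P X n \<beta> \<mu>])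
    show "definable L N n D \<and> (\<exists>D0 D1. D0 \<subseteq> D \<and> D1 \<subseteq> D \<and> D0 \<inter> D1 = {} \<and>
      morley_ge L N n D0 \<beta> \<and> P D1)" if "P D" for D
      using split[OF that] below \<beta>(1) that unfolding P_def by metis
  qed (use X \<beta> in auto)
  then show False using X(2) by simp
qed

end

section \<open>Combinatorics of relations without the order property\<close>

lemma history_choice:
  assumes "\<And>S. finite S \<Longrightarrow> \<exists>x. Q S x"
  shows "\<exists>f :: nat \<Rightarrow> 'a. \<forall>i. Q (f ` {..<i}) (f i)"
proof -
  obtain c where c: "\<And>S. finite S \<Longrightarrow> Q S (c S)" using assms by metis
  define S where "S = rec_nat {} (\<lambda>_ S. insert (c S) S)"
  have "S i = (\<lambda>i. c (S i)) ` {..<i}" for i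
    by (induction i) (auto simp: S_def lessThan_Suc)
  moreover have "finite (S i)" for i by (induction i) (auto simp: S_def)
  ultimately show ?thesis
    using c by (intro exI[of _ "\<lambda>i. c (S i)"]) metis
qed

text \<open>Otherwise choose in turns \<open>w\<^sub>i\<close> unrelated to all earlier \<open>x\<^sub>j\<close>, and \<open>x\<^sub>i\<close> related to all \<open>w\<^sub>j\<close> chosen
  so far; this is an order.\<close>

lemma finite_cover_if_no_order:
  assumes "\<And>F. finite F \<Longrightarrow> F \<subseteq> P \<Longrightarrow> \<exists>x\<in>Q. \<forall>w\<in>F. R w x"
    and no_order: "\<And>w x. (\<And>i. w i \<in> P) \<Longrightarrow> (\<And>i. x i \<in> Q) \<Longrightarrow> \<not> (\<forall>i j. R (w i) (x j) \<longleftrightarrow> i \<le> (j::nat))"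
  shows "\<exists>F. finite F \<and> F \<subseteq> Q \<and> (\<forall>w\<in>P. \<exists>x\<in>F. R w x)"
proof (rule ccontr)
  assume no: "\<not> ?thesis"
  let ?good = "\<lambda>S wx. S \<subseteq> P \<times> Q \<longrightarrow> wx \<in> P \<times> Q \<and> (\<forall>(w, x)\<in>S. \<not> R (fst wx) x \<and> R w (snd wx)) \<and>
    R (fst wx) (snd wx)"
  have "\<exists>wx. ?good S wx" if "finite S" for S
  proof (cases "S \<subseteq> P \<times> Q")
    case True
    then have "finite (snd ` S)" "snd ` S \<subseteq> Q" using that by auto
    then obtain w where w: "w \<in> P" "\<forall>x\<in>snd ` S. \<not> R w x"
      using no by meson
    have "finite (insert w (fst ` S))" "insert w (fst ` S) \<subseteq> P" using that True w(1) by auto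
    then obtain x where "x \<in> Q" "\<forall>w\<in>insert w (fst ` S). R w x"
      using assms(1) by meson
    then have "(w, x) \<in> P \<times> Q \<and> (\<forall>(w', x')\<in>S. \<not> R w x' \<and> R w' x) \<and> R w x"
      using w by (auto simp: image_iff Ball_def)
    then show ?thesis by (intro exI[of _ "(w, x)"]) simp
  qed auto
  from history_choice[of ?good, OF this]
  obtain f :: "nat \<Rightarrow> _ \<times> _" where f: "\<And>i. ?good (f ` {..<i}) (f i)" by blast
  have mem: "f i \<in> P \<times> Q" for i
  proof (induction i rule: less_induct)
    case (less i)
    then have "f ` {..<i} \<subseteq> P \<times> Q" by blast
    then show ?case using f[of i] by blast
  qed
  have f': "(\<forall>(w, x)\<in>f ` {..<i}. \<not> R (fst (f i)) x \<and> R w (snd (f i))) \<and> R (fst (f i)) (snd (f i))" for i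
  proof -
    have "f ` {..<i} \<subseteq> P \<times> Q" using mem by blast
    then show ?thesis using f[of i] by blast
  qed
  then have f'': "R (fst (f i)) (snd (f i))"
    "j < i \<Longrightarrow> \<not> R (fst (f i)) (snd (f j)) \<and> R (fst (f j)) (snd (f i))" for i j
    by (auto simp: split_beta)
  have "R (fst (f i)) (snd (f j)) \<longleftrightarrow> i \<le> j" for i j
    by (cases i j rule: linorder_cases) (simp_all add: f'')
  then show False
    using no_order[of "fst \<circ> f" "snd \<circ> f"] mem by (auto simp: mem_Times_iff)
qed

text \<open>Think of \<open>B\<close> as the set of parameters \<open>b\<close> for which \<open>R(x, b)\<close> belongs to a type, of \<open>C\<close> as the set of
  those for which its negation does, and of \<open>U\<close> as the points available to realize finite parts of the
  type. Membership in \<open>B\<close> then only depends, monotonically, on finitely many instances \<open>R(a, x)\<close>: the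
  type is definable.

  Otherwise there are triples \<open>(a\<^sub>i, b\<^sub>i, c\<^sub>i)\<close> such that \<open>a\<^sub>i\<close> realizes the type over all \<open>b\<^sub>j, c\<^sub>j\<close> with
  \<open>j \<le> i\<close> and no \<open>a\<^sub>j\<close> with \<open>j < i\<close> separates \<open>b\<^sub>i\<close> from \<open>c\<^sub>i\<close>. By Ramsey's theorem \<open>R(a\<^sub>j, b\<^sub>i)\<close> may be
  assumed to be always true or always false for \<open>j < i\<close>. If false, the \<open>a\<^sub>i\<close> and \<open>b\<^sub>i\<close> form an order; if
  true, the \<open>a\<^sub>i\<close> and \<open>c\<^sub>i\<close> do.\<close>

lemma erdos_makkai:
  assumes choose: "\<And>S T. finite S \<Longrightarrow> S \<subseteq> B \<Longrightarrow> finite T \<Longrightarrow> T \<subseteq> C \<Longrightarrow>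
      \<exists>a\<in>U. (\<forall>b\<in>S. R a b) \<and> (\<forall>c\<in>T. \<not> R a c)"
    and no_order: "\<And>b a. (\<And>i. b i \<in> B) \<Longrightarrow> (\<And>i. a i \<in> U) \<Longrightarrow> \<not> (\<forall>i j. R (a j) (b i) \<longleftrightarrow> i \<le> (j::nat))"
    and no_coorder: "\<And>c a. (\<And>i. c i \<in> C) \<Longrightarrow> (\<And>i. a i \<in> U) \<Longrightarrow> \<not> (\<forall>i j. \<not> R (a j) (c i) \<longleftrightarrow> i \<le> (j::nat))"
  shows "\<exists>F. finite F \<and> F \<subseteq> U \<and> (\<forall>b\<in>B. \<forall>c\<in>C. \<exists>a\<in>F. R a b \<and> \<not> R a c)"
proof (rule ccontr)
  assume no: "\<not> ?thesis"
  let ?good = "\<lambda>S (a, b, c). S \<subseteq> U \<times> B \<times> C \<longrightarrow> a \<in> U \<and> b \<in> B \<and> c \<in> C \<and> R a b \<and> \<not> R a c \<and>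
    (\<forall>(a', b', c')\<in>S. R a b' \<and> \<not> R a c' \<and> (R a' b \<longrightarrow> R a' c))"
  have "\<exists>x. ?good S x" if S: "finite S" for S
  proof (cases "S \<subseteq> U \<times> B \<times> C")
    case True
    have "finite (fst ` S)" "fst ` S \<subseteq> U" using S True by auto
    then obtain b c where bc: "b \<in> B" "c \<in> C" "\<forall>a\<in>fst ` S. R a b \<longrightarrow> R a c"
      using no by meson
    let ?B = "insert b ((\<lambda>(_, b, _). b) ` S)" and ?C = "insert c ((\<lambda>(_, _, c). c) ` S)"
    have "finite ?B" "?B \<subseteq> B" "finite ?C" "?C \<subseteq> C" using S True bc(1,2) by auto
    then obtain a where a: "a \<in> U" "\<forall>b\<in>?B. R a b" "\<forall>c\<in>?C. \<not> R a c"
      using choose by meson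
    have "\<forall>(a', b', c')\<in>S. R a b' \<and> \<not> R a c' \<and> (R a' b \<longrightarrow> R a' c)"
    proof (clarify, intro conjI)
      fix a' b' c' assume S': "(a', b', c') \<in> S"
      have "b' \<in> ?B" "c' \<in> ?C" "a' \<in> fst ` S" using S' by force+
      then show "R a b'" "\<not> R a c'" "R a' b \<longrightarrow> R a' c" using a(2,3) bc(3) by blast+
    qed
    then show ?thesis
      using a bc by (intro exI[of _ "(a, b, c)"]) simp
  qed auto
  from history_choice[of ?good, OF this]
  obtain f :: "nat \<Rightarrow> _ \<times> _ \<times> _" where f: "\<And>i. ?good (f ` {..<i}) (f i)" by blast
  define a b c where "a i = fst (f i)" and "b i = fst (snd (f i))" and "c i = snd (snd (f i))" for i
  have fi: "f i = (a i, b i, c i)" for i by (simp add: a_def b_def c_def)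
  have mem: "f i \<in> U \<times> B \<times> C" for i
  proof (induction i rule: less_induct)
    case (less i)
    then have "f ` {..<i} \<subseteq> U \<times> B \<times> C" by blast
    then show ?case using f[of i] fi[of i] by simp
  qed
  then have sub: "f ` {..<i} \<subseteq> U \<times> B \<times> C" for i by blast
  have f': "R (a i) (b i)" "\<not> R (a i) (c i)"
    "j < i \<Longrightarrow> R (a i) (b j) \<and> \<not> R (a i) (c j) \<and> (R (a j) (b i) \<longrightarrow> R (a j) (c i))" for i j
  proof -
    have good: "R (a i) (b i) \<and> \<not> R (a i) (c i) \<and>
        (\<forall>(a', b', c')\<in>f ` {..<i}. R (a i) b' \<and> \<not> R (a i) c' \<and> (R a' (b i) \<longrightarrow> R a' (c i)))"
      using f[of i] sub[of i] fi[of i] by simp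
    then show "R (a i) (b i)" "\<not> R (a i) (c i)" by simp_all
    show "j < i \<Longrightarrow> R (a i) (b j) \<and> \<not> R (a i) (c j) \<and> (R (a j) (b i) \<longrightarrow> R (a j) (c i))"
    proof -
      assume "j < i"
      then have "(a j, b j, c j) \<in> f ` {..<i}" using fi[of j] by (metis imageI lessThan_iff)
      then show ?thesis using good by blast
    qed
  qed
  have mem': "a i \<in> U" "b i \<in> B" "c i \<in> C" for i
    using mem[of i] fi[of i] by auto
  let ?col = "\<lambda>X. if \<exists>i j. j < i \<and> X = {i, j} \<and> R (a j) (b i) then 1 else 0 :: nat"
  have "\<forall>x\<in>UNIV :: nat set. \<forall>y\<in>UNIV. x \<noteq> y \<longrightarrow> ?col {x, y} < 2" by simp
  from Ramsey2[OF infinite_UNIV_nat this]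
  obtain Y t where Y: "infinite Y" "\<forall>x\<in>Y. \<forall>y\<in>Y. x \<noteq> y \<longrightarrow> ?col {x, y} = t" by auto
  obtain r :: "nat \<Rightarrow> nat" where r: "strict_mono r" "\<And>k. r k \<in> Y"
    using infinite_enumerate[OF Y(1)] by blast
  have col: "R (a (r j)) (b (r i)) \<longleftrightarrow> t = 1" if "j < i" for i j
  proof -
    have "r j < r i" using r(1) that by (simp add: strict_mono_less)
    then have "?col {r i, r j} = t" using Y(2) r(2) by (metis less_irrefl)
    moreover have "(\<exists>i' j'. j' < i' \<and> {r i, r j} = {i', j'} \<and> R (a j') (b i')) \<longleftrightarrow> R (a (r j)) (b (r i))"
      using \<open>r j < r i\<close> by (auto simp: doubleton_eq_iff)
    ultimately show ?thesis by (auto split: if_splits)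
  qed
  show False
  proof (cases "t = 1")
    case True
    have "\<not> R (a (r j)) (c (r i)) \<longleftrightarrow> i \<le> j" for i j
    proof (cases i j rule: linorder_cases)
      case less
      then show ?thesis using f'(3)[of "r i" "r j"] r(1) by (simp add: strict_mono_less)
    next
      case equal
      then show ?thesis using f'(2)[of "r i"] by simp
    next
      case greater
      then show ?thesis using f'(3)[of "r j" "r i"] col[OF greater] r(1) True by (simp add: strict_mono_less)
    qed
    then show False using no_coorder[of "c \<circ> r" "a \<circ> r"] mem' by simp
  next
    case False
    have "R (a (r j)) (b (r i)) \<longleftrightarrow> i \<le> j" for i j
    proof (cases i j rule: linorder_cases)
      case less
      then show ?thesis using f'(3)[of "r i" "r j"] r(1) by (simp add: strict_mono_less)
    next
      case equal
      then show ?thesis using f'(1)[of "r i"] by simp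
    next
      case greater
      then show ?thesis using col[OF greater] False by simp
    qed
    then show False using no_order[of "b \<circ> r" "a \<circ> r"] mem' by simp
  qed
qed

section \<open>The group in the larger model\<close>

locale definable_group_pair = elementary_pair L N M
  for L :: "('f, 'r) lang" and N M :: "('f, 'r, 'u) lstruct" +
  fixes n :: nat and A :: "'u list monoid"
  assumes definable_group: "definable_group L M n A"
begin

definition G :: "'u list set" where
  "G = extension L M N n (carrier A)"

definition graph :: "'u list set" where
  "graph = extension L M N (n + n + n)
     {x @ y @ (x \<otimes>\<^bsub>A\<^esub> y) | x y. x \<in> carrier A \<and> y \<in> carrier A}"

text \<open>The group on the extension of the carrier. The group axioms are first-order statements about the graph
  of the multiplication, so they transfer from \<open>M\<close>.\<close>

definition GN :: "'u list monoid" where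
  "GN = \<lparr>carrier = G, mult = \<lambda>x y. THE z. x @ y @ z \<in> graph, one = \<one>\<^bsub>A\<^esub>\<rparr>"

abbreviation mul (infixl "\<cdot>" 70) where "x \<cdot> y \<equiv> x \<otimes>\<^bsub>GN\<^esub> y"

sublocale A: group A
  using definable_group by (simp add: definable_group_def)

lemma dset_G: "dset (univ M) n G" and G_M: "G \<inter> tuples M n = carrier A"
  and dset_graph: "dset (univ M) (n + n + n) graph"
  and graph_M: "graph \<inter> tuples M (n + n + n) =
    {x @ y @ (x \<otimes>\<^bsub>A\<^esub> y) | x y. x \<in> carrier A \<and> y \<in> carrier A}"
  using definable_group definable_extension
  by (auto simp: definable_group_def G_def graph_def)

lemma G_tuples: "x \<in> G \<Longrightarrow> x \<in> tuples N n"
  using dset_subset[OF dset_G] by blast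

lemma A_tuples: "x \<in> carrier A \<Longrightarrow> x \<in> tuples M n" and A_G: "x \<in> carrier A \<Longrightarrow> x \<in> G"
  using G_M by blast+

lemma graph_M_iff:
  assumes "x \<in> tuples M n" "y \<in> tuples M n" "z \<in> tuples M n"
  shows "x @ y @ z \<in> graph \<longleftrightarrow> x \<in> carrier A \<and> y \<in> carrier A \<and> z = x \<otimes>\<^bsub>A\<^esub> y"
proof -
  have "x @ y @ z \<in> tuples M (n + n + n)" using assms by (auto simp: tuples_def)
  then have "x @ y @ z \<in> graph \<longleftrightarrow> x @ y @ z \<in> {x @ y @ (x \<otimes>\<^bsub>A\<^esub> y) | x y. x \<in> carrier A \<and> y \<in> carrier A}"
    using graph_M by blast
  also have "\<dots> \<longleftrightarrow> x \<in> carrier A \<and> y \<in> carrier A \<and> z = x \<otimes>\<^bsub>A\<^esub> y"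
  proof -
    have "x = x' \<and> y = y' \<and> z = x' \<otimes>\<^bsub>A\<^esub> y'"
      if "x @ y @ z = x' @ y' @ (x' \<otimes>\<^bsub>A\<^esub> y')" "x' \<in> carrier A" "y' \<in> carrier A" for x' y'
      using that assms A_tuples[of x'] A_tuples[of y'] by (auto simp: tuples_def)
    then show ?thesis by blast
  qed
  finally show ?thesis .
qed

lemmas def_intros = dpred_imp dpred_conj dpred_disj dpred_not dpred_ex dpred_all dpred_const
  dpred_mem[OF dset_G] dpred_mem[OF dset_graph] dpred_eq
  dterm_append dterm_map

lemma graph_G:
  assumes "x \<in> tuples N n" "y \<in> tuples N n" "z \<in> tuples N n" "x @ y @ z \<in> graph"
  shows "x \<in> G" "y \<in> G" "z \<in> G"
proof -
  let ?P = "\<lambda>v :: nat \<Rightarrow> 'u list. v 0 @ v 1 @ v 2 \<in> graph \<longrightarrow> v 0 \<in> G \<and> v 1 \<in> G \<and> v 2 \<in> G"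
  have "?P ((\<lambda>_. x)(1 := y, 2 := z))"
  proof (rule blocks_M_all[where P = ?P and n = n])
    show "dpred (univ M) (\<lambda>e. ?P (\<lambda>i. map e [i * n..<i * n + n]))"
      by (intro def_intros)
    show "?P v" if "\<And>i. v i \<in> tuples M n" for v
      using that graph_M_iff A_G A.m_closed by simp
  qed (use assms in auto)
  then show "x \<in> G" "y \<in> G" "z \<in> G" using assms(4) by auto
qed

lemma graph_total: "x \<in> G \<Longrightarrow> y \<in> G \<Longrightarrow> \<exists>z\<in>tuples N n. x @ y @ z \<in> graph"
proof -
  assume xy: "x \<in> G" "y \<in> G"
  let ?P = "\<lambda>v :: nat \<Rightarrow> 'u list. v 0 \<in> G \<and> v 1 \<in> G \<longrightarrow> (\<exists>z\<in>tuples N n. v 0 @ v 1 @ z \<in> graph)"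
  have "?P ((\<lambda>_. x)(1 := y))"
  proof (rule blocks_M_all[where P = ?P and n = n])
    show "dpred (univ M) (\<lambda>e. ?P (\<lambda>i. map e [i * n..<i * n + n]))"
      by (intro def_intros)
    show "?P v" if v: "\<And>i. v i \<in> tuples M n" for v
    proof
      assume "v 0 \<in> G \<and> v 1 \<in> G"
      then have "v 0 \<in> carrier A" "v 1 \<in> carrier A" using v G_M by blast+
      moreover from this have "v 0 \<otimes>\<^bsub>A\<^esub> v 1 \<in> tuples M n" using A_tuples by blast
      ultimately show "\<exists>z\<in>tuples N n. v 0 @ v 1 @ z \<in> graph"
        using graph_M_iff v tuples_M by blast
    qed
  qed (use xy G_tuples in auto)
  then show ?thesis using xy by simp
qed

lemma graph_unique:
  assumes "x \<in> tuples N n" "y \<in> tuples N n" "z \<in> tuples N n" "z' \<in> tuples N n"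
    "x @ y @ z \<in> graph" "x @ y @ z' \<in> graph"
  shows "z = z'"
proof -
  let ?P = "\<lambda>v :: nat \<Rightarrow> 'u list. v 0 @ v 1 @ v 2 \<in> graph \<and> v 0 @ v 1 @ v 3 \<in> graph \<longrightarrow> v 2 = v 3"
  have "?P ((\<lambda>_. x)(1 := y, 2 := z, 3 := z'))"
  proof (rule blocks_M_all[where P = ?P and n = n])
    show "dpred (univ M) (\<lambda>e. ?P (\<lambda>i. map e [i * n..<i * n + n]))"
      by (intro def_intros)
    show "?P v" if "\<And>i. v i \<in> tuples M n" for v
      using that graph_M_iff by simp
  qed (use assms in auto)
  then show ?thesis using assms(5,6) by simp
qed

lemma mul_eq:
  assumes "x \<in> G" "y \<in> G" "z \<in> tuples N n"
  shows "x @ y @ z \<in> graph \<longleftrightarrow> z = x \<cdot> y"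
proof -
  obtain w where w: "w \<in> tuples N n" "x @ y @ w \<in> graph" using graph_total assms by blast
  have un: "u = w" if "x @ y @ u \<in> graph" for u
  proof -
    have "x @ y @ u \<in> tuples N (n + n + n)" using that dset_subset[OF dset_graph] by blast
    then have "u \<in> tuples N n" using assms(1,2) G_tuples[of x] G_tuples[of y] by (auto simp: tuples_def)
    then show ?thesis using graph_unique w that assms(1,2) G_tuples by blast
  qed
  have "(THE u. x @ y @ u \<in> graph) = w" using w(2) un by (rule the_equality)
  then have "x \<cdot> y = w" by (simp add: GN_def)
  then show ?thesis using w un by blast
qed

lemma graph_iff:
  assumes "x \<in> tuples N n" "y \<in> tuples N n" "z \<in> tuples N n"
  shows "x @ y @ z \<in> graph \<longleftrightarrow> x \<in> G \<and> y \<in> G \<and> z = x \<cdot> y"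
  using graph_G[OF assms] mul_eq assms(3) by blast

lemma mul_closed: "x \<in> G \<Longrightarrow> y \<in> G \<Longrightarrow> x \<cdot> y \<in> G"
  using graph_total[of x y] graph_G(3) graph_iff G_tuples by metis

lemma mul_A: "x \<in> carrier A \<Longrightarrow> y \<in> carrier A \<Longrightarrow> x \<cdot> y = x \<otimes>\<^bsub>A\<^esub> y"
proof -
  assume xy: "x \<in> carrier A" "y \<in> carrier A"
  then have z: "x \<otimes>\<^bsub>A\<^esub> y \<in> tuples M n" using A_tuples A.m_closed by simp
  then have "x @ y @ x \<otimes>\<^bsub>A\<^esub> y \<in> graph" using graph_M_iff xy A_tuples by simp
  moreover have "x \<otimes>\<^bsub>A\<^esub> y \<in> tuples N n" using z tuples_M by blast
  ultimately show ?thesis using mul_eq[OF A_G[OF xy(1)] A_G[OF xy(2)]] by simp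
qed

lemma mul_assoc: "x \<in> G \<Longrightarrow> y \<in> G \<Longrightarrow> z \<in> G \<Longrightarrow> x \<cdot> y \<cdot> z = x \<cdot> (y \<cdot> z)"
proof -
  assume xyz: "x \<in> G" "y \<in> G" "z \<in> G"
  let ?P = "\<lambda>v :: nat \<Rightarrow> 'u list. v 0 @ v 1 @ v 3 \<in> graph \<and> v 3 @ v 2 @ v 4 \<in> graph \<and> v 1 @ v 2 @ v 5 \<in> graph
    \<longrightarrow> v 0 @ v 5 @ v 4 \<in> graph"
  let ?v = "(\<lambda>_ :: nat. x)(1 := y, 2 := z, 3 := x \<cdot> y, 4 := x \<cdot> y \<cdot> z, 5 := y \<cdot> z)"
  have "?P ?v"
  proof (rule blocks_M_all[where P = ?P and n = n])
    show "dpred (univ M) (\<lambda>e. ?P (\<lambda>i. map e [i * n..<i * n + n]))"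
      by (intro def_intros)
    show "?P v" if "\<And>i. v i \<in> tuples M n" for v
    proof (intro impI, elim conjE)
      assume "v 0 @ v 1 @ v 3 \<in> graph" "v 3 @ v 2 @ v 4 \<in> graph" "v 1 @ v 2 @ v 5 \<in> graph"
      then have "v 0 \<in> carrier A" "v 1 \<in> carrier A" "v 2 \<in> carrier A" "v 3 = v 0 \<otimes>\<^bsub>A\<^esub> v 1"
        "v 4 = v 3 \<otimes>\<^bsub>A\<^esub> v 2" "v 5 = v 1 \<otimes>\<^bsub>A\<^esub> v 2"
        using that graph_M_iff by blast+
      then show "v 0 @ v 5 @ v 4 \<in> graph"
        using graph_M_iff[of "v 0" "v 5" "v 4"] that A.m_assoc A.m_closed by metis
    qed
  qed (use xyz G_tuples mul_closed in auto)
  then have "x @ y \<cdot> z @ x \<cdot> y \<cdot> z \<in> graph"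
    using xyz mul_closed mul_eq G_tuples by simp
  then show ?thesis
    using xyz mul_closed mul_eq[of x "y \<cdot> z" "x \<cdot> y \<cdot> z"] G_tuples by simp
qed

lemma GN_simps [simp]: "carrier GN = G" "\<one>\<^bsub>GN\<^esub> = \<one>\<^bsub>A\<^esub>"
  by (simp_all add: GN_def)

lemma def_one: "dterm (univ M) (\<lambda>e. \<one>\<^bsub>A\<^esub>)" "\<one>\<^bsub>A\<^esub> \<in> tuples N n"
  using A_tuples[OF A.one_closed] tuples_M[of n]
  by (auto intro!: dterm_const[of _ n] simp: tuples_def[of M])

lemma one_mul: "x \<in> G \<Longrightarrow> \<one>\<^bsub>A\<^esub> \<cdot> x = x"
proof -
  assume x: "x \<in> G"
  let ?P = "\<lambda>v :: nat \<Rightarrow> 'u list. v 0 \<in> G \<longrightarrow> \<one>\<^bsub>A\<^esub> @ v 0 @ v 0 \<in> graph"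
  have "?P (\<lambda>_. x)"
  proof (rule blocks_M_all[where P = ?P and n = n])
    show "dpred (univ M) (\<lambda>e. ?P (\<lambda>i. map e [i * n..<i * n + n]))"
      by (intro def_intros def_one)
    show "?P v" if v: "\<And>i. v i \<in> tuples M n" for v
    proof
      assume "v 0 \<in> G"
      then have "v 0 \<in> carrier A" using v G_M by blast
      then show "\<one>\<^bsub>A\<^esub> @ v 0 @ v 0 \<in> graph"
        using graph_M_iff[of "\<one>\<^bsub>A\<^esub>" "v 0" "v 0"] A_tuples A.one_closed by simp
    qed
  qed (use x G_tuples in auto)
  then show ?thesis using x mul_eq[of "\<one>\<^bsub>A\<^esub>" x x] A_G[OF A.one_closed] G_tuples by simp
qed

lemma inv_ex: "x \<in> G \<Longrightarrow> \<exists>y\<in>G. y \<cdot> x = \<one>\<^bsub>A\<^esub>"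
proof -
  assume x: "x \<in> G"
  let ?P = "\<lambda>v :: nat \<Rightarrow> 'u list. v 0 \<in> G \<longrightarrow> (\<exists>y\<in>tuples N n. y @ v 0 @ \<one>\<^bsub>A\<^esub> \<in> graph)"
  have "?P (\<lambda>_. x)"
  proof (rule blocks_M_all[where P = ?P and n = n])
    show "dpred (univ M) (\<lambda>e. ?P (\<lambda>i. map e [i * n..<i * n + n]))"
      by (intro def_intros def_one)
    show "?P v" if v: "\<And>i. v i \<in> tuples M n" for v
    proof
      assume "v 0 \<in> G"
      then have v0: "v 0 \<in> carrier A" using v G_M by blast
      then have "inv\<^bsub>A\<^esub> (v 0) @ v 0 @ \<one>\<^bsub>A\<^esub> \<in> graph"
        using graph_M_iff[of "inv\<^bsub>A\<^esub> (v 0)" "v 0" "\<one>\<^bsub>A\<^esub>"] A_tuples A.one_closed by simp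
      then show "\<exists>y\<in>tuples N n. y @ v 0 @ \<one>\<^bsub>A\<^esub> \<in> graph"
        using v0 A_tuples A.inv_closed tuples_M by blast
    qed
  qed (use x G_tuples in auto)
  then obtain y where "y \<in> tuples N n" "y @ x @ \<one>\<^bsub>A\<^esub> \<in> graph" using x by blast
  then show ?thesis using graph_iff[of y x "\<one>\<^bsub>A\<^esub>"] x G_tuples def_one(2) by auto
qed

sublocale GN: group GN
  using mul_closed mul_assoc one_mul inv_ex A_G[OF A.one_closed]
  by (intro groupI) auto

lemma inv_A: "x \<in> carrier A \<Longrightarrow> inv\<^bsub>GN\<^esub> x = inv\<^bsub>A\<^esub> x"
  using GN.inv_equality[of "inv\<^bsub>A\<^esub> x" x] mul_A[of "inv\<^bsub>A\<^esub> x" x] A_G A.inv_closed by simp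

lemma subgroup_A_iff: "subgroup K A \<longleftrightarrow> subgroup K GN \<and> K \<subseteq> carrier A"
proof
  assume K: "subgroup K A"
  then have "K \<subseteq> carrier A" by (rule subgroup.subset)
  moreover have "subgroup K GN"
  proof (rule GN.subgroupI)
    show "K \<subseteq> carrier GN" using \<open>K \<subseteq> carrier A\<close> A_G by auto
    show "K \<noteq> {}" using subgroup.one_closed[OF K] by blast
    show "inv\<^bsub>GN\<^esub> x \<in> K" if "x \<in> K" for x
      using subgroup.m_inv_closed[OF K that] inv_A that \<open>K \<subseteq> carrier A\<close> by auto
    show "x \<cdot> y \<in> K" if "x \<in> K" "y \<in> K" for x y
      using subgroup.m_closed[OF K that] mul_A that \<open>K \<subseteq> carrier A\<close> by (metis subsetD)
  qed
  ultimately show "subgroup K GN \<and> K \<subseteq> carrier A" by simp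
next
  assume "subgroup K GN \<and> K \<subseteq> carrier A"
  then have K: "subgroup K GN" "K \<subseteq> carrier A" by auto
  show "subgroup K A"
  proof (rule A.subgroupI)
    show "K \<noteq> {}" using subgroup.one_closed[OF K(1)] by blast
    show "inv\<^bsub>A\<^esub> x \<in> K" if "x \<in> K" for x
      using subgroup.m_inv_closed[OF K(1) that] inv_A that K(2) by auto
    show "x \<otimes>\<^bsub>A\<^esub> y \<in> K" if "x \<in> K" "y \<in> K" for x y
      using subgroup.m_closed[OF K(1) that] mul_A that K(2) by (metis subsetD)
  qed (use K in simp)
qed

lemma def_left:
  assumes "univ M \<subseteq> B" "g \<in> G" "set g \<subseteq> B" "dset B n Y"
  shows "dset B n {y \<in> G. g \<cdot> y \<in> Y}"
proof -
  have "dset B n {y \<in> tuples N n. \<exists>z\<in>tuples N n. g @ y @ z \<in> graph \<and> z \<in> Y}"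
    using assms G_tuples[of g]
    by (intro dset_Collect dpred_ex dpred_conj dpred_mem[OF dset_mono[OF dset_graph]]
        dpred_mem[OF assms(4)] dterm_append dterm_map dterm_const) auto
  moreover have "{y \<in> tuples N n. \<exists>z\<in>tuples N n. g @ y @ z \<in> graph \<and> z \<in> Y} = {y \<in> G. g \<cdot> y \<in> Y}"
    using graph_iff G_tuples assms(2) mul_closed by (auto cong: conj_cong)
  ultimately show ?thesis by simp
qed

lemma def_right:
  assumes "univ M \<subseteq> B" "g \<in> G" "set g \<subseteq> B" "dset B n Y"
  shows "dset B n {y \<in> G. y \<cdot> g \<in> Y}"
proof -
  have "dset B n {y \<in> tuples N n. \<exists>z\<in>tuples N n. y @ g @ z \<in> graph \<and> z \<in> Y}"
    using assms G_tuples[of g]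
    by (intro dset_Collect dpred_ex dpred_conj dpred_mem[OF dset_mono[OF dset_graph]]
        dpred_mem[OF assms(4)] dterm_append dterm_map dterm_const) auto
  moreover have "{y \<in> tuples N n. \<exists>z\<in>tuples N n. y @ g @ z \<in> graph \<and> z \<in> Y} = {y \<in> G. y \<cdot> g \<in> Y}"
    using graph_iff G_tuples assms(2) mul_closed by (auto cong: conj_cong)
  ultimately show ?thesis by simp
qed

lemma def_inv:
  assumes "univ M \<subseteq> B" "dset B n Y"
  shows "dset B n {y \<in> G. inv\<^bsub>GN\<^esub> y \<in> Y}"
proof -
  have "dset B n {y \<in> tuples N n. \<exists>z\<in>tuples N n. z @ y @ \<one>\<^bsub>A\<^esub> \<in> graph \<and> z \<in> Y}"
    using A_tuples[OF A.one_closed] assms(1) def_one(2)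
    by (intro dset_Collect dpred_ex dpred_conj dpred_mem[OF dset_mono[OF dset_graph]]
        dpred_mem[OF assms(2)] dterm_append dterm_map dterm_const) (auto simp: tuples_def)
  moreover have "z @ y @ \<one>\<^bsub>A\<^esub> \<in> graph \<longleftrightarrow> y \<in> G \<and> z = inv\<^bsub>GN\<^esub> y"
    if "z \<in> tuples N n" "y \<in> tuples N n" for y z
    using graph_iff[OF that def_one(2)] GN.inv_equality[of z y] GN.l_inv[of y] GN.inv_closed[of y]
    by auto
  then have "{y \<in> tuples N n. \<exists>z\<in>tuples N n. z @ y @ \<one>\<^bsub>A\<^esub> \<in> graph \<and> z \<in> Y} = {y \<in> G. inv\<^bsub>GN\<^esub> y \<in> Y}"
    using G_tuples GN.inv_closed by (auto cong: conj_cong)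
  ultimately show ?thesis by simp
qed

lemma def_mul_rel:
  assumes "univ M \<subseteq> B" "dset B n Y"
  shows "dset B (n + n) {x @ y | x y. x \<in> tuples N n \<and> y \<in> tuples N n \<and> x \<in> G \<and> y \<in> G \<and> x \<cdot> y \<in> Y}"
proof -
  have "dset B (n + n) {x @ y | x y. x \<in> tuples N n \<and> y \<in> tuples N n \<and>
      (\<exists>z\<in>tuples N n. x @ y @ z \<in> graph \<and> z \<in> Y)}"
    using assms
    by (intro dset_Collect2 dpred_ex dpred_conj dpred_mem[OF dset_mono[OF dset_graph]]
        dpred_mem[OF assms(2)] dterm_append dterm_map) auto
  moreover have "(\<exists>z\<in>tuples N n. x @ y @ z \<in> graph \<and> z \<in> Y) \<longleftrightarrow> x \<in> G \<and> y \<in> G \<and> x \<cdot> y \<in> Y"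
    if "x \<in> tuples N n" "y \<in> tuples N n" for x y
    using graph_iff[OF that] G_tuples mul_closed by (auto cong: conj_cong)
  ultimately show ?thesis by (simp cong: conj_cong)
qed

end

section \<open>Rank and translates\<close>

lemma take_drop_concat:
  "(\<And>x. x \<in> set xs \<Longrightarrow> length x = n) \<Longrightarrow> i < length xs \<Longrightarrow> take n (drop (i * n) (concat xs)) = xs ! i"
proof (induction xs arbitrary: i)
  case (Cons x xs)
  then show ?case by (cases i) auto
qed simp

text \<open>As \<open>\<gamma>\<close> is the successor of \<open>\<alpha>\<close>, rank at most \<open>\<alpha>\<close> is expressed by \<open>\<not> morley_ge L N n X \<gamma>\<close>.\<close>

locale tt_group_pair = definable_group_pair L N M n A
  for L :: "('f, 'r) lang" and N M :: "('f, 'r, 'u) lstruct" and n :: nat and A :: "'u list monoid" +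
  fixes \<alpha> \<gamma> :: "'u list set ordinal"
  assumes saturated: "aleph0_saturated L N"
    and ranked: "\<And>X. definable L N n X \<Longrightarrow> \<exists>\<delta>. \<not> morley_ge L N n X \<delta>"
    and successor: "\<alpha> < \<gamma>" "\<forall>\<delta><\<gamma>. \<delta> \<le> \<alpha>"
begin

abbreviation rank_ge :: "'u list set \<Rightarrow> 'u list set ordinal \<Rightarrow> bool" where
  "rank_ge X \<delta> \<equiv> morley_ge L N n X \<delta>"

abbreviation big :: "'u list set \<Rightarrow> bool" where
  "big X \<equiv> rank_ge X \<alpha>"

abbreviation Mdef :: "'u list set \<Rightarrow> bool" where
  "Mdef X \<equiv> dset (univ M) n X"

abbreviation Ndef :: "'u list set \<Rightarrow> bool" where
  "Ndef X \<equiv> dset (univ N) n X"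

abbreviation GM :: "'u list set" where
  "GM \<equiv> carrier A"

lemma Mdef_Ndef: "Mdef X \<Longrightarrow> Ndef X"
  using univ_M(1) by (rule dset_mono[rotated])

lemma set_M: "g \<in> GM \<Longrightarrow> set g \<subseteq> univ M" and set_N: "g \<in> G \<Longrightarrow> set g \<subseteq> univ N"
  using A_tuples[of g] G_tuples[of g] by (auto simp: tuples_def)

lemma Mdef_left: "g \<in> GM \<Longrightarrow> Mdef Y \<Longrightarrow> Mdef {y \<in> G. g \<cdot> y \<in> Y}"
  and Mdef_right: "g \<in> GM \<Longrightarrow> Mdef Y \<Longrightarrow> Mdef {y \<in> G. y \<cdot> g \<in> Y}"
  by (intro def_left def_right A_G set_M; simp)+

lemma Ndef_left: "g \<in> G \<Longrightarrow> Ndef Y \<Longrightarrow> Ndef {y \<in> G. g \<cdot> y \<in> Y}"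
  and Ndef_right: "g \<in> G \<Longrightarrow> Ndef Y \<Longrightarrow> Ndef {y \<in> G. y \<cdot> g \<in> Y}"
  by (intro def_left def_right set_N; simp add: univ_M)+

lemma inv_G: "g \<in> G \<Longrightarrow> inv\<^bsub>GN\<^esub> g \<in> G"
  using GN.inv_closed[of g] by simp

lemma inv_GM: "g \<in> GM \<Longrightarrow> inv\<^bsub>GN\<^esub> g \<in> GM"
  using inv_A A.inv_closed by simp

lemma mul_GM: "g \<in> GM \<Longrightarrow> h \<in> GM \<Longrightarrow> g \<cdot> h \<in> GM"
  using mul_A A.m_closed by simp

lemma cancel_left [simp]:
  "g \<in> G \<Longrightarrow> y \<in> G \<Longrightarrow> inv\<^bsub>GN\<^esub> g \<cdot> (g \<cdot> y) = y"
  "g \<in> G \<Longrightarrow> y \<in> G \<Longrightarrow> g \<cdot> (inv\<^bsub>GN\<^esub> g \<cdot> y) = y"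
  using GN.m_assoc[symmetric, of "inv\<^bsub>GN\<^esub> g" g y] GN.m_assoc[symmetric, of g "inv\<^bsub>GN\<^esub> g" y] inv_G
    GN.l_inv[of g] GN.r_inv[of g] one_mul by auto

lemma cancel_right [simp]:
  "g \<in> G \<Longrightarrow> y \<in> G \<Longrightarrow> y \<cdot> g \<cdot> inv\<^bsub>GN\<^esub> g = y"
  "g \<in> G \<Longrightarrow> y \<in> G \<Longrightarrow> y \<cdot> inv\<^bsub>GN\<^esub> g \<cdot> g = y"
  using GN.m_assoc[of y g "inv\<^bsub>GN\<^esub> g"] GN.m_assoc[of y "inv\<^bsub>GN\<^esub> g" g] inv_G
    GN.l_inv[of g] GN.r_inv[of g] GN.r_one[of y] by auto

lemma translate_left:
  assumes "g \<in> G" "Y \<subseteq> G" shows "(\<lambda>y. g \<cdot> y) ` Y = {y \<in> G. inv\<^bsub>GN\<^esub> g \<cdot> y \<in> Y}"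
proof
  show "(\<lambda>y. g \<cdot> y) ` Y \<subseteq> {y \<in> G. inv\<^bsub>GN\<^esub> g \<cdot> y \<in> Y}"
    using assms mul_closed by auto
  show "{y \<in> G. inv\<^bsub>GN\<^esub> g \<cdot> y \<in> Y} \<subseteq> (\<lambda>y. g \<cdot> y) ` Y"
  proof
    fix y assume "y \<in> {y \<in> G. inv\<^bsub>GN\<^esub> g \<cdot> y \<in> Y}"
    then show "y \<in> (\<lambda>y. g \<cdot> y) ` Y"
      using assms(1) by (intro image_eqI[of _ _ "inv\<^bsub>GN\<^esub> g \<cdot> y"]) auto
  qed
qed

lemma translate_right:
  assumes "g \<in> G" "Y \<subseteq> G" shows "(\<lambda>y. y \<cdot> g) ` Y = {y \<in> G. y \<cdot> inv\<^bsub>GN\<^esub> g \<in> Y}"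
proof
  show "(\<lambda>y. y \<cdot> g) ` Y \<subseteq> {y \<in> G. y \<cdot> inv\<^bsub>GN\<^esub> g \<in> Y}"
    using assms mul_closed by auto
  show "{y \<in> G. y \<cdot> inv\<^bsub>GN\<^esub> g \<in> Y} \<subseteq> (\<lambda>y. y \<cdot> g) ` Y"
  proof
    fix y assume "y \<in> {y \<in> G. y \<cdot> inv\<^bsub>GN\<^esub> g \<in> Y}"
    then show "y \<in> (\<lambda>y. y \<cdot> g) ` Y"
      using assms(1) by (intro image_eqI[of _ _ "y \<cdot> inv\<^bsub>GN\<^esub> g"]) auto
  qed
qed

lemma Ndef_translate_left: "g \<in> G \<Longrightarrow> Y \<subseteq> G \<Longrightarrow> Ndef Y \<Longrightarrow> Ndef ((\<lambda>y. g \<cdot> y) ` Y)"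
  and Ndef_translate_right: "g \<in> G \<Longrightarrow> Y \<subseteq> G \<Longrightarrow> Ndef Y \<Longrightarrow> Ndef ((\<lambda>y. y \<cdot> g) ` Y)"
  using Ndef_left[OF inv_G] Ndef_right[OF inv_G] by (simp_all add: translate_left translate_right)

lemma Mdef_translate_left: "g \<in> GM \<Longrightarrow> Y \<subseteq> G \<Longrightarrow> Mdef Y \<Longrightarrow> Mdef ((\<lambda>y. g \<cdot> y) ` Y)"
  using Mdef_left[OF inv_GM] A_G by (simp add: translate_left)

lemma rank_translate_left:
  assumes "g \<in> G" "Y \<subseteq> G" "rank_ge Y \<delta>" shows "rank_ge ((\<lambda>y. g \<cdot> y) ` Y) \<delta>"
proof (rule morley_ge_image[OF assms(3,2)])
  show "inj_on (\<lambda>y. g \<cdot> y) G"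
    by (rule inj_on_inverseI[of _ "\<lambda>y. inv\<^bsub>GN\<^esub> g \<cdot> y"]) (use assms(1) in simp)
qed (use assms(1) Ndef_translate_left in \<open>auto simp: definable_iff_dset\<close>)

lemma rank_translate_right:
  assumes "g \<in> G" "Y \<subseteq> G" "rank_ge Y \<delta>" shows "rank_ge ((\<lambda>y. y \<cdot> g) ` Y) \<delta>"
proof (rule morley_ge_image[OF assms(3,2)])
  show "inj_on (\<lambda>y. y \<cdot> g) G"
    by (rule inj_on_inverseI[of _ "\<lambda>y. y \<cdot> inv\<^bsub>GN\<^esub> g"]) (use assms(1) in simp)
qed (use assms(1) Ndef_translate_right in \<open>auto simp: definable_iff_dset\<close>)

lemma rank_untranslate_left:
  assumes "g \<in> G" "Y \<subseteq> G" "rank_ge ((\<lambda>y. g \<cdot> y) ` Y) \<delta>"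
  shows "rank_ge Y \<delta>"
proof -
  have "(\<lambda>y. g \<cdot> y) ` Y \<subseteq> G" using assms(1,2) mul_closed by auto
  then have "rank_ge ((\<lambda>y. inv\<^bsub>GN\<^esub> g \<cdot> y) ` (\<lambda>y. g \<cdot> y) ` Y) \<delta>"
    by (rule rank_translate_left[OF inv_G[OF assms(1)] _ assms(3)])
  moreover have "(\<lambda>y. inv\<^bsub>GN\<^esub> g \<cdot> y) ` (\<lambda>y. g \<cdot> y) ` Y = (\<lambda>y. y) ` Y"
    unfolding image_image using assms(1,2) by (intro image_cong) auto
  ultimately show ?thesis by simp
qed

lemma rank_mono: "rank_ge X \<delta> \<Longrightarrow> X \<subseteq> Y \<Longrightarrow> Ndef Y \<Longrightarrow> rank_ge Y \<delta>"
  by (auto intro: morley_ge_mono simp: definable_iff_dset)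

lemma rank_Ndef: "rank_ge X \<delta> \<Longrightarrow> Ndef X"
  using morley_ge_definable definable_iff_dset by blast

lemma rank_Un: "rank_ge Z \<delta> \<Longrightarrow> Z \<subseteq> X \<union> Y \<Longrightarrow> Ndef X \<Longrightarrow> Ndef Y \<Longrightarrow> rank_ge X \<delta> \<or> rank_ge Y \<delta>"
  by (rule morley_ge_Un) (auto simp: definable_iff_dset)

lemma rank_UN:
  "finite I \<Longrightarrow> (\<And>i. i \<in> I \<Longrightarrow> Ndef (F i)) \<Longrightarrow> rank_ge Z \<delta> \<Longrightarrow> Z \<subseteq> (\<Union>i\<in>I. F i) \<Longrightarrow>
    \<exists>i\<in>I. rank_ge (F i) \<delta>"
proof (induction I arbitrary: Z rule: finite_induct)
  case empty
  then show ?case using morley_ge_nonempty by auto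
next
  case (insert i I)
  have U: "Ndef (\<Union>i\<in>I. F i)" using insert.hyps(1) insert.prems(1) by (intro dset_UN) auto
  consider "rank_ge (F i) \<delta>" | "rank_ge (\<Union>i\<in>I. F i) \<delta>"
    using rank_Un[OF insert.prems(2) _ _ U, of "F i"] insert.prems by auto
  then show ?case
    using insert.IH[of "\<Union>i\<in>I. F i"] insert.prems(1) by cases auto
qed

lemma no_order_mul:
  assumes U: "Ndef U" and w: "\<And>i. w i \<in> G" "\<And>i. x i \<in> G"
  shows "\<not> (\<forall>i j. w i \<cdot> x j \<in> U \<longleftrightarrow> i \<le> (j::nat))" "\<not> (\<forall>i j. w i \<cdot> x j \<notin> U \<longleftrightarrow> i \<le> (j::nat))"
proof -
  let ?R = "{x @ y | x y. x \<in> tuples N n \<and> y \<in> tuples N n \<and> x \<in> G \<and> y \<in> G \<and> x \<cdot> y \<in> U}"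
  have R: "dset (univ N) (n + n) ?R"
    using univ_M(1) U by (rule def_mul_rel)
  have t: "w i \<in> tuples N n" "x i \<in> tuples N n" for i using w G_tuples by auto
  have mem: "w i @ x j \<in> ?R \<longleftrightarrow> w i \<cdot> x j \<in> U" for i j
    using append_mem_product[OF t(1)[of i] t(2)[of j]] w by simp
  show "\<not> (\<forall>i j. w i \<cdot> x j \<in> U \<longleftrightarrow> i \<le> (j::nat))"
    using no_order_property[OF saturated ranked R t] mem by simp
  have "w i @ x j \<in> tuples N (n + n) - ?R \<longleftrightarrow> w i \<cdot> x j \<notin> U" for i j
    using mem t[of i] t[of j] by (auto simp: tuples_def)
  then show "\<not> (\<forall>i j. w i \<cdot> x j \<notin> U \<longleftrightarrow> i \<le> (j::nat))"
    using no_order_property[OF saturated ranked dset_Diff[OF dset_tuples R] t] by simp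
qed

section \<open>Stabilizers\<close>

text \<open>The subsets \<open>Z\<close> of \<open>Y\<close> over \<open>M\<close> with \<open>Y - Z\<close> small form a complete type over \<open>M\<close>, the generic type of
  \<open>Y\<close>.\<close>

definition irreducible_over_M :: "'u list set \<Rightarrow> bool" where
  "irreducible_over_M Y \<longleftrightarrow> Mdef Y \<and> Y \<subseteq> G \<and> big Y \<and>
     (\<forall>Z. Mdef Z \<longrightarrow> \<not> (big (Y \<inter> Z) \<and> big (Y - Z)))"

text \<open>The condition says \<open>gY \<subseteq> Y\<close> up to a small set. For irreducible \<open>Y\<close> this is the stabilizer of the
  generic type of \<open>Y\<close>, and equality holds up to small sets.\<close>

definition stab :: "'u list set \<Rightarrow> 'u list set" where
  "stab Y = {g \<in> GM. \<not> big {y \<in> Y. g \<cdot> y \<notin> Y}}"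

lemma irreducible_subset_exists:
  assumes "Mdef X" "X \<subseteq> G" "big X" "\<not> rank_ge X \<gamma>"
  shows "\<exists>Y\<subseteq>X. irreducible_over_M Y"
proof (rule ccontr)
  assume no: "\<not> ?thesis"
  have "rank_ge X \<gamma>"
  proof (rule morley_ge_successor[of "\<lambda>D. Mdef D \<and> big D \<and> D \<subseteq> X"])
    fix D assume D: "Mdef D \<and> big D \<and> D \<subseteq> X"
    then have "\<not> irreducible_over_M D" using no by blast
    then obtain Z where Z: "Mdef Z" "big (D \<inter> Z)" "big (D - Z)"
      using D assms(2) unfolding irreducible_over_M_def by blast
    have "Mdef (D - Z)" using D Z(1) by (intro dset_Diff) auto
    then show "definable L N n D \<and> (\<exists>D0 D1. D0 \<subseteq> D \<and> D1 \<subseteq> D \<and> D0 \<inter> D1 = {} \<and> big D0 \<and>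
        Mdef D1 \<and> big D1 \<and> D1 \<subseteq> X)"
      using D Z by (intro conjI exI[of _ "D \<inter> Z"] exI[of _ "D - Z"]) (auto intro: morley_ge_definable)
  qed (use assms successor in auto)
  then show False using assms(4) by simp
qed

lemma left_pieces:
  assumes "Mdef Y" "Y \<subseteq> G" "g \<in> GM"
  shows "Mdef {y \<in> Y. g \<cdot> y \<in> Y}" "Mdef {y \<in> Y. g \<cdot> y \<notin> Y}"
proof -
  have "{y \<in> Y. g \<cdot> y \<in> Y} = Y \<inter> {y \<in> G. g \<cdot> y \<in> Y}" "{y \<in> Y. g \<cdot> y \<notin> Y} = Y - {y \<in> G. g \<cdot> y \<in> Y}"
    using assms(2) by auto
  then show "Mdef {y \<in> Y. g \<cdot> y \<in> Y}" "Mdef {y \<in> Y. g \<cdot> y \<notin> Y}"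
    using assms(1) Mdef_left[OF assms(3,1)] by (auto intro: dset_Int dset_Diff)
qed

lemma stab_dichotomy:
  assumes "irreducible_over_M Y" "g \<in> GM"
  shows "g \<in> stab Y \<longleftrightarrow> big {y \<in> Y. g \<cdot> y \<in> Y}"
proof -
  have Y: "Mdef Y" "Y \<subseteq> G" "big Y" using assms(1) by (auto simp: irreducible_over_M_def)
  note pieces = left_pieces[OF Y(1,2) assms(2)]
  have "big {y \<in> Y. g \<cdot> y \<in> Y} \<or> big {y \<in> Y. g \<cdot> y \<notin> Y}"
    by (rule rank_Un[OF Y(3) _ Mdef_Ndef[OF pieces(1)] Mdef_Ndef[OF pieces(2)]]) blast
  moreover have "Y \<inter> {y \<in> Y. g \<cdot> y \<in> Y} = {y \<in> Y. g \<cdot> y \<in> Y}" "Y - {y \<in> Y. g \<cdot> y \<in> Y} = {y \<in> Y. g \<cdot> y \<notin> Y}"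
    by auto
  then have "\<not> (big {y \<in> Y. g \<cdot> y \<in> Y} \<and> big {y \<in> Y. g \<cdot> y \<notin> Y})"
    using assms(1)[unfolded irreducible_over_M_def, THEN conjunct2, THEN conjunct2, THEN conjunct2,
        rule_format, OF pieces(1)] by simp
  ultimately show ?thesis using assms(2) by (auto simp: stab_def)
qed

lemma stab_subgroup:
  assumes "irreducible_over_M Y"
  shows "subgroup (stab Y) GN"
proof (rule GN.subgroupI)
  have Y: "Mdef Y" "Y \<subseteq> G" "big Y" using assms by (auto simp: irreducible_over_M_def)
  show "stab Y \<subseteq> carrier GN" using A_G by (auto simp: stab_def)
  have "{y \<in> Y. \<one>\<^bsub>A\<^esub> \<cdot> y \<notin> Y} = {}" using one_mul Y(2) by auto
  then have "\<not> big {y \<in> Y. \<one>\<^bsub>A\<^esub> \<cdot> y \<notin> Y}" by (metis morley_ge_nonempty)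
  then show "stab Y \<noteq> {}" using A.one_closed unfolding stab_def by blast
  show "inv\<^bsub>GN\<^esub> g \<in> stab Y" if "g \<in> stab Y" for g
  proof -
    have g: "g \<in> GM" "g \<in> G" using that A_G by (auto simp: stab_def)
    have "big ((\<lambda>y. g \<cdot> y) ` {y \<in> Y. g \<cdot> y \<in> Y})"
      using that stab_dichotomy[OF assms g(1)] Y(2) g(2) by (intro rank_translate_left) auto
    moreover have "(\<lambda>y. g \<cdot> y) ` {y \<in> Y. g \<cdot> y \<in> Y} \<subseteq> {y \<in> Y. inv\<^bsub>GN\<^esub> g \<cdot> y \<in> Y}"
      using g(2) Y(2) by auto
    ultimately have "big {y \<in> Y. inv\<^bsub>GN\<^esub> g \<cdot> y \<in> Y}"
      by (rule rank_mono) (rule Mdef_Ndef[OF left_pieces(1)[OF Y(1,2) inv_GM[OF g(1)]]])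
    then show ?thesis using stab_dichotomy[OF assms inv_GM[OF g(1)]] by simp
  qed
  show "g \<cdot> h \<in> stab Y" if "g \<in> stab Y" "h \<in> stab Y" for g h
  proof (rule ccontr)
    have g: "g \<in> GM" "g \<in> G" "h \<in> GM" "h \<in> G" using that A_G by (auto simp: stab_def)
    let ?E = "(\<lambda>y. inv\<^bsub>GN\<^esub> h \<cdot> y) ` {y \<in> Y. g \<cdot> y \<notin> Y}"
    assume "g \<cdot> h \<notin> stab Y"
    then have "big {y \<in> Y. g \<cdot> h \<cdot> y \<notin> Y}" using mul_GM g by (simp add: stab_def)
    moreover have "{y \<in> Y. g \<cdot> h \<cdot> y \<notin> Y} \<subseteq> {y \<in> Y. h \<cdot> y \<notin> Y} \<union> ?E"
    proof
      fix y assume y: "y \<in> {y \<in> Y. g \<cdot> h \<cdot> y \<notin> Y}"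
      then have "y \<in> G" using Y(2) by auto
      show "y \<in> {y \<in> Y. h \<cdot> y \<notin> Y} \<union> ?E"
      proof (cases "h \<cdot> y \<in> Y")
        case True
        then have "y \<in> ?E"
          using y \<open>y \<in> G\<close> g mul_assoc by (intro image_eqI[of _ _ "h \<cdot> y"]) auto
        then show ?thesis by simp
      qed (use y in simp)
    qed
    moreover have "Mdef {y \<in> Y. h \<cdot> y \<notin> Y}" "Mdef {y \<in> Y. g \<cdot> y \<notin> Y}"
      using left_pieces Y g by auto
    moreover from this(2) have "Ndef ?E"
      using Y(2) g inv_G by (intro Ndef_translate_left Mdef_Ndef) auto
    ultimately have "big {y \<in> Y. h \<cdot> y \<notin> Y} \<or> big ?E"
      using rank_Un Mdef_Ndef by blast
    then have "big ?E" using that(2) by (simp add: stab_def)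
    then have "big {y \<in> Y. g \<cdot> y \<notin> Y}"
      using rank_untranslate_left[of "inv\<^bsub>GN\<^esub> h" "{y \<in> Y. g \<cdot> y \<notin> Y}"] g(4) inv_G Y(2) by auto
    then show False using that(1) by (simp add: stab_def)
  qed
qed

text \<open>Finitely many small sets do not cover \<open>Y\<close>, and what they leave has a point in \<open>M\<close>.\<close>

lemma generic_point_exists:
  assumes "irreducible_over_M Y" and S: "finite S" "S \<subseteq> stab Y" and T: "finite T" "T \<subseteq> GM - stab Y"
  shows "\<exists>a\<in>Y \<inter> tuples M n. (\<forall>b\<in>S. b \<cdot> a \<in> Y) \<and> (\<forall>c\<in>T. c \<cdot> a \<notin> Y)"
proof -
  have Y: "Mdef Y" "Y \<subseteq> G" "big Y" using assms by (auto simp: irreducible_over_M_def)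
  define exc where "exc g = (if g \<in> S then {y \<in> Y. g \<cdot> y \<notin> Y} else {y \<in> Y. g \<cdot> y \<in> Y})" for g
  have GM: "g \<in> GM" if "g \<in> S \<union> T" for g using that S T by (auto simp: stab_def)
  have exc: "Mdef (exc g)" if "g \<in> S \<union> T" for g
    using left_pieces[OF Y(1,2) GM[OF that]] by (simp add: exc_def)
  have small: "\<not> big (exc g)" if "g \<in> S \<union> T" for g
  proof (cases "g \<in> S")
    case True
    then show ?thesis using S by (auto simp: exc_def stab_def)
  next
    case False
    then have "g \<notin> stab Y" using that T by blast
    then show ?thesis using False stab_dichotomy[OF assms(1) GM[OF that]] by (simp add: exc_def)
  qed
  have "\<not> Y \<subseteq> (\<Union>g\<in>S \<union> T. exc g)"
  proof
    assume "Y \<subseteq> (\<Union>g\<in>S \<union> T. exc g)"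
    then have "\<exists>g\<in>S \<union> T. big (exc g)"
      using S(1) T(1) Y(3) Mdef_Ndef[OF exc] by (intro rank_UN) auto
    then show False using small by blast
  qed
  then have ne: "Y - (\<Union>g\<in>S \<union> T. exc g) \<noteq> {}" by blast
  have "Mdef (Y - (\<Union>g\<in>S \<union> T. exc g))"
    using S(1) T(1) exc by (intro dset_Diff Y(1) dset_UN) auto
  from dset_M_point[OF this ne]
  obtain a where a: "a \<in> tuples M n" "a \<in> Y - (\<Union>g\<in>S \<union> T. exc g)" ..
  have "b \<cdot> a \<in> Y" if "b \<in> S" for b
    using a(2) that by (auto simp: exc_def split: if_splits)
  moreover have "c \<cdot> a \<notin> Y" if "c \<in> T" for c
  proof -
    have "c \<notin> S" using that S T by blast
    then show ?thesis using a(2) that by (auto simp: exc_def)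
  qed
  ultimately show ?thesis using a by blast
qed

text \<open>Definability of the generic type of \<open>Y\<close>, applied to the formula \<open>g \<cdot> y \<in> Y\<close>.\<close>

lemma stab_definable:
  assumes "irreducible_over_M Y"
  shows "\<exists>Q. Mdef Q \<and> Q \<subseteq> G \<and> Q \<inter> tuples M n = stab Y"
proof -
  have Y: "Mdef Y" "Y \<subseteq> G" "big Y" using assms by (auto simp: irreducible_over_M_def)
  let ?U = "Y \<inter> tuples M n"
  have UG: "?U \<subseteq> G" using Y by blast
  have sG: "stab Y \<subseteq> GM" by (auto simp: stab_def)
  have "\<exists>F. finite F \<and> F \<subseteq> ?U \<and> (\<forall>b\<in>stab Y. \<forall>c\<in>GM - stab Y. \<exists>a\<in>F. b \<cdot> a \<in> Y \<and> \<not> c \<cdot> a \<in> Y)"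
  proof (rule erdos_makkai)
    fix S T assume S: "finite S" "S \<subseteq> stab Y" and T: "finite T" "T \<subseteq> GM - stab Y"
    show "\<exists>a\<in>?U. (\<forall>b\<in>S. b \<cdot> a \<in> Y) \<and> (\<forall>c\<in>T. \<not> c \<cdot> a \<in> Y)"
      using generic_point_exists[OF assms S T] .
  next
    fix b a :: "nat \<Rightarrow> 'u list" assume "\<And>i. b i \<in> stab Y" "\<And>i. a i \<in> ?U"
    then show "\<not> (\<forall>i j. b i \<cdot> a j \<in> Y \<longleftrightarrow> i \<le> j)"
      using no_order_mul(1)[OF Mdef_Ndef[OF Y(1)], of b a] sG UG A_G by blast
  next
    fix c a :: "nat \<Rightarrow> 'u list" assume "\<And>i. c i \<in> GM - stab Y" "\<And>i. a i \<in> ?U"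
    then show "\<not> (\<forall>i j. \<not> c i \<cdot> a j \<in> Y \<longleftrightarrow> i \<le> j)"
      using no_order_mul(2)[OF Mdef_Ndef[OF Y(1)], of c a] UG A_G by blast
  qed
  then obtain F where F: "finite F" "F \<subseteq> ?U"
    "\<forall>b\<in>stab Y. \<forall>c\<in>GM - stab Y. \<exists>a\<in>F. b \<cdot> a \<in> Y \<and> c \<cdot> a \<notin> Y"
    by (elim exE conjE)
  define patterns where "patterns = (\<lambda>b. {a \<in> F. b \<cdot> a \<in> Y}) ` stab Y"
  have fin: "finite patterns"
    using F(1) by (intro finite_subset[of patterns "Pow F"]) (auto simp: patterns_def)
  have pF: "F' \<subseteq> F" if "F' \<in> patterns" for F' using that by (auto simp: patterns_def)
  define Q where "Q = (\<Union>F'\<in>patterns. {g \<in> G. \<forall>a\<in>F'. g \<cdot> a \<in> Y})"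
  have "Mdef {g \<in> G. \<forall>a\<in>F'. g \<cdot> a \<in> Y}" if "F' \<in> patterns" for F'
  proof -
    have "finite F'" "F' \<subseteq> F" using pF[OF that] F(1) finite_subset by auto
    then show ?thesis
    proof (induction F' rule: finite_induct)
      case empty
      then show ?case using dset_G by simp
    next
      case (insert a F')
      have "a \<in> GM" using insert.prems F(2) Y(2) G_M by blast
      then have "Mdef ({g \<in> G. g \<cdot> a \<in> Y} \<inter> {g \<in> G. \<forall>a\<in>F'. g \<cdot> a \<in> Y})"
        using insert Y(1) by (intro dset_Int Mdef_right) auto
      moreover have "{g \<in> G. g \<cdot> a \<in> Y} \<inter> {g \<in> G. \<forall>a\<in>F'. g \<cdot> a \<in> Y} = {g \<in> G. \<forall>a\<in>insert a F'. g \<cdot> a \<in> Y}"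
        by auto
      ultimately show ?case by simp
    qed
  qed
  then have "Mdef Q" unfolding Q_def by (intro dset_UN fin)
  moreover have "Q \<subseteq> G" by (auto simp: Q_def)
  moreover have "Q \<inter> tuples M n = stab Y"
  proof
    show "stab Y \<subseteq> Q \<inter> tuples M n"
    proof
      fix b assume b: "b \<in> stab Y"
      then have "{a \<in> F. b \<cdot> a \<in> Y} \<in> patterns" by (auto simp: patterns_def)
      moreover have "b \<in> GM" using b sG by blast
      ultimately show "b \<in> Q \<inter> tuples M n" unfolding Q_def using A_G A_tuples by blast
    qed
    show "Q \<inter> tuples M n \<subseteq> stab Y"
    proof
      fix c assume c: "c \<in> Q \<inter> tuples M n"
      then obtain b where b: "b \<in> stab Y" "\<forall>a\<in>F. b \<cdot> a \<in> Y \<longrightarrow> c \<cdot> a \<in> Y"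
        unfolding Q_def patterns_def by blast
      have "c \<in> GM" using c G_M \<open>Q \<subseteq> G\<close> by blast
      show "c \<in> stab Y"
      proof (rule ccontr)
        assume "c \<notin> stab Y"
        then obtain a where "a \<in> F" "b \<cdot> a \<in> Y" "c \<cdot> a \<notin> Y"
          using F(3)[rule_format, OF b(1), of c] \<open>c \<in> GM\<close> by blast
        then show False using b(2) by simp
      qed
    qed
  qed
  ultimately show ?thesis by blast
qed

lemma subgroup_transfer:
  assumes Q: "Mdef Q" "Q \<subseteq> G" "subgroup (Q \<inter> tuples M n) GN"
  shows "subgroup Q GN"
proof (rule GN.subgroupI)
  show "Q \<subseteq> carrier GN" using Q(2) by simp
  show "Q \<noteq> {}" using subgroup.one_closed[OF Q(3)] by blast
  have "Mdef {y \<in> G. inv\<^bsub>GN\<^esub> y \<in> Q}" by (intro def_inv Q(1)) simp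
  moreover have "Q \<inter> tuples M n \<subseteq> {y \<in> G. inv\<^bsub>GN\<^esub> y \<in> Q}"
    using subgroup.m_inv_closed[OF Q(3)] Q(2) by blast
  ultimately have "Q \<subseteq> {y \<in> G. inv\<^bsub>GN\<^esub> y \<in> Q}" by (rule dset_M_subset[OF Q(1)])
  then show "inv\<^bsub>GN\<^esub> x \<in> Q" if "x \<in> Q" for x using that by blast
  let ?R = "{x @ y | x y. x \<in> tuples N n \<and> y \<in> tuples N n \<and> x \<in> G \<and> y \<in> G \<and> x \<cdot> y \<in> Q}"
  have R: "dset (univ M) (n + n) ?R" by (intro def_mul_rel Q(1)) simp
  have Rm: "x @ y \<in> ?R \<longleftrightarrow> x \<in> G \<and> y \<in> G \<and> x \<cdot> y \<in> Q" if "x \<in> tuples N n" "y \<in> tuples N n" for x y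
    using append_mem_product[OF that] by simp
  let ?P = "\<lambda>v :: nat \<Rightarrow> 'u list. v 0 \<in> Q \<and> v 1 \<in> Q \<longrightarrow> v 0 @ v 1 \<in> ?R"
  show "x \<cdot> y \<in> Q" if xy: "x \<in> Q" "y \<in> Q" for x y
  proof -
    have t: "x \<in> tuples N n" "y \<in> tuples N n" using xy dset_subset[OF Q(1)] by auto
    have "?P ((\<lambda>_. x)(1 := y))"
    proof (rule blocks_M_all[where P = ?P and n = n])
      show "dpred (univ M) (\<lambda>e. ?P (\<lambda>i. map e [i * n..<i * n + n]))"
        by (intro dpred_imp dpred_conj dpred_mem[OF Q(1)] dpred_mem[OF R] dterm_append dterm_map)
      show "?P v" if v: "\<And>i. v i \<in> tuples M n" for v
        using Rm[of "v 0" "v 1"] v tuples_M[of n] subgroup.m_closed[OF Q(3), of "v 0" "v 1"] Q(2) by blast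
    qed (use t in auto)
    then show ?thesis using Rm[OF t] xy by simp
  qed
qed

section \<open>Finite index and rank of the stabilizer\<close>

definition finite_index :: "'u list set \<Rightarrow> 'u list set \<Rightarrow> bool" where
  "finite_index K' K \<longleftrightarrow> K' \<subseteq> K \<and> (\<exists>F. finite F \<and> F \<subseteq> K \<and> K \<subseteq> (\<Union>f\<in>F. (\<lambda>x. f \<cdot> x) ` K'))"

lemma finite_index_trans:
  assumes "finite_index K2 K1" "finite_index K1 K0" "subgroup K0 GN"
  shows "finite_index K2 K0"
proof -
  obtain F1 where F1: "finite F1" "F1 \<subseteq> K1" "K1 \<subseteq> (\<Union>f\<in>F1. (\<lambda>x. f \<cdot> x) ` K2)" "K2 \<subseteq> K1"
    using assms(1) unfolding finite_index_def by blast
  obtain F0 where F0: "finite F0" "F0 \<subseteq> K0" "K0 \<subseteq> (\<Union>f\<in>F0. (\<lambda>x. f \<cdot> x) ` K1)" "K1 \<subseteq> K0"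
    using assms(2) unfolding finite_index_def by blast
  have K0: "K0 \<subseteq> G" using subgroup.subset[OF assms(3)] by simp
  let ?F = "(\<lambda>(f, g). f \<cdot> g) ` (F0 \<times> F1)"
  have "finite ?F" using F0 F1 by simp
  moreover have "?F \<subseteq> K0"
  proof clarify
    fix f g assume "f \<in> F0" "g \<in> F1"
    then have "f \<in> K0" "g \<in> K0" using F0(2,4) F1(2) by auto
    then show "f \<cdot> g \<in> K0" by (rule subgroup.m_closed[OF assms(3)])
  qed
  moreover have "K0 \<subseteq> (\<Union>f\<in>?F. (\<lambda>x. f \<cdot> x) ` K2)"
  proof
    fix x assume "x \<in> K0"
    then obtain f y where f: "f \<in> F0" "y \<in> K1" "x = f \<cdot> y" using F0(3) by blast
    then obtain g z where g: "g \<in> F1" "z \<in> K2" "y = g \<cdot> z" using F1(3) by blast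
    have "f \<in> G" "g \<in> G" "z \<in> G" using f g F0 F1 K0 by auto
    then have "x = (f \<cdot> g) \<cdot> z" using f(3) g(3) mul_assoc by simp
    moreover have "f \<cdot> g \<in> ?F" using f g by force
    ultimately show "x \<in> (\<Union>f\<in>?F. (\<lambda>x. f \<cdot> x) ` K2)" using g(2) by blast
  qed
  ultimately show ?thesis using F0(4) F1(4) unfolding finite_index_def by blast
qed

text \<open>Translates of \<open>Y\<close> from different cosets of the stabilizer meet in small sets, and almost all of each of
  them lies in \<open>X\<close>. Infinitely many cosets would give an infinite disjoint family of big subsets
  of \<open>X\<close>.\<close>

lemma stab_finite_index:
  assumes K: "subgroup K GN" "K \<subseteq> GM" and Y: "irreducible_over_M Y" "Y \<subseteq> X"
    and X: "Mdef X" "X \<subseteq> G" "\<not> rank_ge X \<gamma>"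
    and KX: "\<And>k. k \<in> K \<Longrightarrow> \<not> big ((\<lambda>x. k \<cdot> x) ` X - X)"
  shows "finite_index (stab Y \<inter> K) K"
proof (rule ccontr)
  assume no: "\<not> ?thesis"
  have KG: "k \<in> G" if "k \<in> K" for k using that K(2) A_G by blast
  have Y': "Mdef Y" "Y \<subseteq> G" "big Y" using Y by (auto simp: irreducible_over_M_def)
  let ?Q = "\<lambda>S k. S \<subseteq> K \<longrightarrow> k \<in> K \<and> (\<forall>f\<in>S. inv\<^bsub>GN\<^esub> f \<cdot> k \<notin> stab Y)"
  have "\<exists>k. ?Q S k" if S: "finite S" for S
  proof (cases "S \<subseteq> K")
    case True
    then obtain k where k: "k \<in> K" "k \<notin> (\<Union>f\<in>S. (\<lambda>x. f \<cdot> x) ` (stab Y \<inter> K))"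
      using no S unfolding finite_index_def by blast
    have "inv\<^bsub>GN\<^esub> f \<cdot> k \<notin> stab Y" if f: "f \<in> S" for f
    proof
      assume "inv\<^bsub>GN\<^esub> f \<cdot> k \<in> stab Y"
      moreover have "inv\<^bsub>GN\<^esub> f \<cdot> k \<in> K"
        using f k(1) True subgroup.m_closed[OF K(1)] subgroup.m_inv_closed[OF K(1)] by blast
      moreover have "k = f \<cdot> (inv\<^bsub>GN\<^esub> f \<cdot> k)" using f k(1) True KG by auto
      ultimately show False using k(2) f by blast
    qed
    then show ?thesis using k(1) by blast
  qed auto
  from history_choice[of ?Q, OF this]
  obtain k :: "nat \<Rightarrow> 'u list" where k: "\<And>i. ?Q (k ` {..<i}) (k i)" by blast
  have kK: "k i \<in> K" for i
  proof (induction i rule: less_induct)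
    case (less i)
    then have "k ` {..<i} \<subseteq> K" by blast
    then show ?case using k[of i] by simp
  qed
  have sep: "inv\<^bsub>GN\<^esub> (k j) \<cdot> k i \<notin> stab Y" if "j < i" for i j
  proof -
    have "k ` {..<i} \<subseteq> K" using kK by blast
    then show ?thesis using k[of i] that by simp
  qed
  define T where "T i = (\<lambda>x. k i \<cdot> x) ` Y" for i
  \<comment> \<open>Disjointed translates, cut down to \<open>X\<close>.\<close>
  define E where "E i = (T i \<inter> X) - (\<Union>j\<in>{..<i}. T j)" for i
  have T: "Ndef (T i)" for i
    unfolding T_def using KG[OF kK] Y' by (intro Ndef_translate_left Mdef_Ndef) auto
  then have E: "Ndef (E i)" for i
    unfolding E_def using Mdef_Ndef[OF X(1)] by (intro dset_Diff dset_Int dset_UN) auto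
  have meet: "\<not> big (T i \<inter> T j)" if "j < i" for i j
  proof
    assume "big (T i \<inter> T j)"
    let ?g = "inv\<^bsub>GN\<^esub> (k j) \<cdot> k i"
    have gM: "?g \<in> GM" using kK K(2) by (auto intro!: mul_GM inv_GM)
    have W: "Ndef ((\<lambda>y. k i \<cdot> y) ` {y \<in> Y. ?g \<cdot> y \<in> Y})"
      using left_pieces(1)[OF Y'(1,2) gM] KG[OF kK] Y'(2) by (intro Ndef_translate_left Mdef_Ndef) auto
    have "T i \<inter> T j \<subseteq> (\<lambda>y. k i \<cdot> y) ` {y \<in> Y. ?g \<cdot> y \<in> Y}"
    proof
      fix x assume "x \<in> T i \<inter> T j"
      then obtain y z where y: "y \<in> Y" "x = k i \<cdot> y" and z: "z \<in> Y" "x = k j \<cdot> z"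
        by (auto simp: T_def)
      have "?g \<cdot> y = inv\<^bsub>GN\<^esub> (k j) \<cdot> (k i \<cdot> y)"
        using y(1) Y'(2) KG[OF kK] inv_G by (intro mul_assoc) auto
      also have "\<dots> = inv\<^bsub>GN\<^esub> (k j) \<cdot> (k j \<cdot> z)" using y(2) z(2) by simp
      also have "\<dots> = z" using z(1) Y'(2) KG[OF kK] by auto
      finally show "x \<in> (\<lambda>y. k i \<cdot> y) ` {y \<in> Y. ?g \<cdot> y \<in> Y}" using y z by auto
    qed
    then have "big ((\<lambda>y. k i \<cdot> y) ` {y \<in> Y. ?g \<cdot> y \<in> Y})"
      using \<open>big (T i \<inter> T j)\<close> W rank_mono by blast
    then have "big {y \<in> Y. ?g \<cdot> y \<in> Y}"
      using Y'(2) KG[OF kK] by (intro rank_untranslate_left[of "k i" "{y \<in> Y. ?g \<cdot> y \<in> Y}"]) auto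
    then show False using stab_dichotomy[OF Y(1) gM] sep[OF that] by simp
  qed
  have "big (E i)" for i
  proof -
    let ?TX = "(\<lambda>x. k i \<cdot> x) ` X - X" and ?I = "\<Union>j\<in>{..<i}. T i \<inter> T j"
    have "big (T i)" unfolding T_def using KG[OF kK] Y' by (intro rank_translate_left)
    moreover have "T i \<subseteq> ?TX \<union> (E i \<union> ?I)" using Y(2) by (auto simp: T_def E_def)
    moreover have "Ndef ?TX"
      using X(1,2) KG[OF kK] by (intro dset_Diff Ndef_translate_left Mdef_Ndef)
    moreover have I: "Ndef ?I" by (intro dset_UN dset_Int T) auto
    ultimately have "big ?TX \<or> big (E i \<union> ?I)" using rank_Un dset_Un[OF E I] by blast
    then have "big (E i \<union> ?I)" using KX[OF kK] by blast
    then have "big (E i) \<or> big ?I" using rank_Un[OF _ subset_refl E I] by blast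
    moreover have "\<not> big ?I"
    proof
      assume "big ?I"
      then have "\<exists>j\<in>{..<i}. big (T i \<inter> T j)"
        by (intro rank_UN[of _ _ ?I] dset_Int T) auto
      then show False using meet by blast
    qed
    ultimately show ?thesis by blast
  qed
  moreover have "disjoint_family E"
    unfolding disjoint_family_on_def
  proof (intro ballI impI)
    have "E i \<inter> E j = {}" if "j < i" for i j using that by (auto simp: E_def)
    then show "E i \<inter> E j = {}" if "i \<noteq> j" for i j using that by (metis Int_commute linorder_neqE_nat)
  qed
  moreover have "E i \<subseteq> X" for i by (auto simp: E_def)
  ultimately have "rank_ge X \<gamma>"
    using E successor Mdef_Ndef[OF X(1)]
    by (intro morley_ge.succ[of L N n X \<alpha> \<gamma> E]) (auto simp: definable_iff_dset)
  then show False using X(3) by simp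
qed

text \<open>For \<open>w\<close> in the stabilizer, \<open>w \<cdot> x \<in> Y\<close> holds for almost all \<open>x \<in> Y\<close>. In the absence of the order
  property, finitely many \<open>x\<close> serve all \<open>w\<close>, so the stabilizer is covered by finitely many \<open>Y \<cdot> x\<inverse>\<close>.\<close>

lemma stab_hull_rank:
  assumes Y: "irreducible_over_M Y" "\<not> rank_ge Y \<gamma>"
    and Q: "Mdef Q" "Q \<subseteq> G" "Q \<inter> tuples M n = stab Y"
  shows "\<not> rank_ge Q \<gamma>"
proof
  assume rank: "rank_ge Q \<gamma>"
  have Y': "Mdef Y" "Y \<subseteq> G" using Y by (auto simp: irreducible_over_M_def)
  have sG: "stab Y \<subseteq> GM" by (auto simp: stab_def)
  have "\<exists>F. finite F \<and> F \<subseteq> Y \<inter> tuples M n \<and> (\<forall>w\<in>stab Y. \<exists>x\<in>F. w \<cdot> x \<in> Y)"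
  proof (rule finite_cover_if_no_order)
    show "\<exists>x\<in>Y \<inter> tuples M n. \<forall>w\<in>F. w \<cdot> x \<in> Y" if "finite F" "F \<subseteq> stab Y" for F
      using generic_point_exists[OF Y(1) that, of "{}"] by auto
  next
    fix w x :: "nat \<Rightarrow> 'u list" assume "\<And>i. w i \<in> stab Y" "\<And>i. x i \<in> Y \<inter> tuples M n"
    then show "\<not> (\<forall>i j. w i \<cdot> x j \<in> Y \<longleftrightarrow> i \<le> j)"
      using no_order_mul(1)[OF Mdef_Ndef[OF Y'(1)], of w x] sG A_G Y'(2) by blast
  qed
  then obtain F where F: "finite F" "F \<subseteq> Y \<inter> tuples M n" "\<forall>w\<in>stab Y. \<exists>x\<in>F. w \<cdot> x \<in> Y"
    by (elim exE conjE)
  have FG: "x \<in> GM" if "x \<in> F" for x using that F(2) Y'(2) G_M by blast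
  let ?cover = "\<Union>x\<in>F. {w \<in> G. w \<cdot> x \<in> Y}"
  have piece: "Mdef {w \<in> G. w \<cdot> x \<in> Y}" if "x \<in> F" for x by (intro Mdef_right FG that Y'(1))
  have "Mdef ?cover" using F(1) piece by (intro dset_UN)
  moreover have "Q \<inter> tuples M n \<subseteq> ?cover"
    using F(3) Q(2,3) by (intro subsetI) (auto simp: stab_def intro: A_G)
  ultimately have "Q \<subseteq> ?cover" by (rule dset_M_subset[OF Q(1)])
  then have "\<exists>x\<in>F. rank_ge {w \<in> G. w \<cdot> x \<in> Y} \<gamma>"
    using F(1) piece Mdef_Ndef rank by (intro rank_UN) auto
  then obtain x where x: "x \<in> F" "rank_ge {w \<in> G. w \<cdot> x \<in> Y} \<gamma>" ..
  then have "rank_ge ((\<lambda>w. w \<cdot> x) ` {w \<in> G. w \<cdot> x \<in> Y}) \<gamma>"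
    using FG A_G by (intro rank_translate_right) auto
  then have "rank_ge Y \<gamma>" by (rule rank_mono[OF _ _ Mdef_Ndef[OF Y'(1)]]) auto
  then show False using Y(2) by simp
qed

section \<open>Generic sets\<close>

text \<open>Among the finite unions of left translates of \<open>Z\<close> there is a set \<open>U\<close> to which no further translate of
  \<open>U\<close> adds a big set. Each \<open>w \<in> C\<close> then maps almost all of \<open>U\<close> into \<open>U\<close>, and as for stabilizers finitely many
  right translates of \<open>U\<close> cover \<open>C\<close>.\<close>

lemma two_sided_cover:
  assumes C: "Ndef C" "C \<subseteq> G" "subgroup C GN" "\<not> rank_ge C \<gamma>"
    and Z: "Z \<subseteq> C" "big Z"
  shows "\<exists>E. finite E \<and> E \<subseteq> C \<times> C \<and> (\<forall>w\<in>C. \<exists>(g, h)\<in>E. \<exists>z\<in>Z. w = g \<cdot> z \<cdot> h)"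
proof -
  define U where "U F = (\<Union>f\<in>F. (\<lambda>z. f \<cdot> z) ` Z)" for F
  have ZN: "Ndef Z" using Z(2) by (rule rank_Ndef)
  have UC: "U F \<subseteq> C" if "F \<subseteq> C" for F
    unfolding U_def using that Z(1) subgroup.m_closed[OF C(3)] by auto
  have UN: "Ndef (U F)" if "finite F" "F \<subseteq> C" for F
    unfolding U_def using that C(2) Z(1) ZN by (intro dset_UN Ndef_translate_left) auto
  have tN: "Ndef ((\<lambda>u. g \<cdot> u) ` U F)" if "finite F" "F \<subseteq> C" "g \<in> C" for g F
    using that UN UC C(2) by (intro Ndef_translate_left) blast+
  have "\<exists>F. finite F \<and> F \<noteq> {} \<and> F \<subseteq> C \<and> (\<forall>g\<in>C. \<not> big ((\<lambda>u. g \<cdot> u) ` U F - U F))"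
  proof (rule ccontr)
    assume no: "\<not> ?thesis"
    let ?P = "\<lambda>D. \<exists>F. finite F \<and> F \<noteq> {} \<and> F \<subseteq> C \<and> D = C - U F"
    have one: "\<one>\<^bsub>A\<^esub> \<in> C" using subgroup.one_closed[OF C(3)] by simp
    have "rank_ge (C - U {\<one>\<^bsub>A\<^esub>}) \<gamma>"
    proof (rule morley_ge_successor[of ?P])
      show "?P (C - U {\<one>\<^bsub>A\<^esub>})" using one by (intro exI[of _ "{\<one>\<^bsub>A\<^esub>}"]) auto
    next
      fix D assume "?P D"
      then obtain F where F: "finite F" "F \<noteq> {}" "F \<subseteq> C" "D = C - U F" by blast
      then obtain g where g: "g \<in> C" "big ((\<lambda>u. g \<cdot> u) ` U F - U F)" using no by blast
      let ?F = "F \<union> (\<lambda>f. g \<cdot> f) ` F"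
      have gU: "(\<lambda>u. g \<cdot> u) ` U F = U ((\<lambda>f. g \<cdot> f) ` F)"
        unfolding U_def using g(1) F(3) Z(1) C(2) by (auto simp: image_UN image_image mul_assoc subset_iff)
      have gF: "(\<lambda>f. g \<cdot> f) ` F \<subseteq> C" using g(1) F(3) subgroup.m_closed[OF C(3)] by auto
      have next_step: "?P (C - U ?F)" using F gF by (intro exI[of _ ?F]) auto
      have "U ?F = U F \<union> (\<lambda>u. g \<cdot> u) ` U F" unfolding gU by (auto simp: U_def)
      then have "(\<lambda>u. g \<cdot> u) ` U F - U F \<subseteq> D" "C - U ?F \<subseteq> D"
        "((\<lambda>u. g \<cdot> u) ` U F - U F) \<inter> (C - U ?F) = {}"
        using UC[OF gF] unfolding gU F(4) by blast+
      moreover have "definable L N n D"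
        unfolding definable_iff_dset F(4) by (intro dset_Diff C(1) UN F)
      ultimately show "definable L N n D \<and> (\<exists>D0 D1. D0 \<subseteq> D \<and> D1 \<subseteq> D \<and> D0 \<inter> D1 = {} \<and> big D0 \<and> ?P D1)"
        using g(2) next_step by blast
    qed (use successor in auto)
    then have "rank_ge C \<gamma>" by (rule rank_mono[OF _ _ C(1)]) auto
    then show False using C(4) by simp
  qed
  then obtain F where F: "finite F" "F \<noteq> {}" "F \<subseteq> C"
    and inv: "\<And>g. g \<in> C \<Longrightarrow> \<not> big ((\<lambda>u. g \<cdot> u) ` U F - U F)" by blast
  obtain f where f: "f \<in> F" using F(2) by blast
  have "big ((\<lambda>z. f \<cdot> z) ` Z)" using f F(3) C(2) Z by (intro rank_translate_left) auto
  then have bigU: "big (U F)"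
    using f by (intro rank_mono[OF _ _ UN[OF F(1,3)]]) (auto simp: U_def)
  note UG = subset_trans[OF UC[OF F(3)] C(2)]
  have "\<exists>S. finite S \<and> S \<subseteq> U F \<and> (\<forall>w\<in>C. \<exists>x\<in>S. w \<cdot> x \<in> U F)"
  proof (rule finite_cover_if_no_order)
    fix S assume S: "finite S" "S \<subseteq> C"
    let ?bad = "\<lambda>w. {u \<in> U F. w \<cdot> u \<notin> U F}"
    have bad: "Ndef (?bad w)" if "w \<in> S" for w
    proof -
      have "?bad w = U F - {u \<in> G. w \<cdot> u \<in> U F}" using UG by auto
      then show ?thesis
        using UN[OF F(1,3)] Ndef_left[of w "U F"] that S(2) C(2) by (auto intro: dset_Diff)
    qed
    have small: "\<not> big (?bad w)" if "w \<in> S" for w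
    proof
      assume "big (?bad w)"
      then have "big ((\<lambda>u. w \<cdot> u) ` ?bad w)"
        using that S(2) C(2) UG by (intro rank_translate_left) auto
      moreover have "(\<lambda>u. w \<cdot> u) ` ?bad w \<subseteq> (\<lambda>u. w \<cdot> u) ` U F - U F" by auto
      moreover have "Ndef ((\<lambda>u. w \<cdot> u) ` U F - U F)"
        using that S(2) F tN UN by (intro dset_Diff) auto
      ultimately have "big ((\<lambda>u. w \<cdot> u) ` U F - U F)" by (rule rank_mono)
      then show False using inv that S(2) by blast
    qed
    have "\<not> U F \<subseteq> (\<Union>w\<in>S. ?bad w)"
    proof
      assume "U F \<subseteq> (\<Union>w\<in>S. ?bad w)"
      then have "\<exists>w\<in>S. big (?bad w)" by (intro rank_UN[OF S(1) bad bigU])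
      then show False using small by blast
    qed
    then show "\<exists>x\<in>U F. \<forall>w\<in>S. w \<cdot> x \<in> U F" by auto
  next
    fix w x :: "nat \<Rightarrow> 'u list" assume "\<And>i. w i \<in> C" "\<And>i. x i \<in> U F"
    then show "\<not> (\<forall>i j. w i \<cdot> x j \<in> U F \<longleftrightarrow> i \<le> j)"
      using no_order_mul(1)[OF UN[OF F(1,3)], of w x] C(2) UG by blast
  qed
  then obtain S where S: "finite S" "S \<subseteq> U F" "\<forall>w\<in>C. \<exists>x\<in>S. w \<cdot> x \<in> U F"
    by (elim exE conjE)
  let ?E = "F \<times> (\<lambda>x. inv\<^bsub>GN\<^esub> x) ` S"
  have "finite ?E" using F S by simp
  moreover have "?E \<subseteq> C \<times> C"
    using F(3) S(2) UC[OF F(3)] subgroup.m_inv_closed[OF C(3)] by blast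
  moreover have "\<exists>(g, h)\<in>?E. \<exists>z\<in>Z. w = g \<cdot> z \<cdot> h" if w: "w \<in> C" for w
  proof -
    obtain x where x: "x \<in> S" "w \<cdot> x \<in> U F" using S(3) w by blast
    then obtain f z where f: "f \<in> F" "z \<in> Z" "w \<cdot> x = f \<cdot> z" by (auto simp: U_def)
    have "w = w \<cdot> x \<cdot> inv\<^bsub>GN\<^esub> x"
      using w x(1) S(2) UG C(2) by (subst cancel_right(1)) auto
    then have "w = f \<cdot> z \<cdot> inv\<^bsub>GN\<^esub> x" using f(3) by simp
    then show ?thesis using f x(1) by blast
  qed
  ultimately show ?thesis by blast
qed

text \<open>\<open>C\<close> is covered by \<open>k\<close> two-sided translates of the fibre \<open>{z. z @ p \<in> F}\<close>. The lists of left and right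
  factors are concatenated to the single tuples \<open>a\<close> and \<open>b\<close>, which makes this a first-order condition
  on \<open>p\<close>.\<close>

definition covers :: "'u list set \<Rightarrow> 'u list set \<Rightarrow> nat \<Rightarrow> 'u list \<Rightarrow> bool" where
  "covers C F k p \<longleftrightarrow> (\<exists>a\<in>tuples N (k * n). \<exists>b\<in>tuples N (k * n). \<forall>w\<in>tuples N n. w \<in> C \<longrightarrow>
     (\<exists>i\<in>{..<k}. \<exists>z\<in>tuples N n. \<exists>u\<in>tuples N n. z @ p \<in> F \<and>
       take n (drop (i * n) a) @ z @ u \<in> graph \<and> u @ take n (drop (i * n) b) @ w \<in> graph))"

lemma dset_covers:
  assumes "Mdef C" "dset (univ M) (n + m) F"
  shows "dset (univ M) m {p \<in> tuples N m. covers C F k p}"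
  unfolding covers_def
  by (intro dset_Collect dpred_ex dpred_all dpred_imp dpred_conj dpred_fin_ex finite_lessThan
      dpred_mem[OF assms(1)] dpred_mem[OF assms(2)] dpred_mem[OF dset_graph]
      dterm_append dterm_take dterm_drop dterm_map)

lemma covers_if_two_sided_cover:
  assumes E: "finite E" "E \<subseteq> C \<times> C" "\<forall>w\<in>C. \<exists>(g, h)\<in>E. \<exists>z\<in>Z. w = g \<cdot> z \<cdot> h"
    and C: "C \<subseteq> G" and Z: "Z \<subseteq> G" "\<And>z. z \<in> Z \<Longrightarrow> z @ p \<in> F"
  shows "\<exists>k. covers C F k p"
proof -
  obtain es where es: "set es = E" using finite_list[OF E(1)] by blast
  let ?k = "length es" and ?a = "concat (map fst es)" and ?b = "concat (map snd es)"
  have el: "fst (es ! i) \<in> G" "snd (es ! i) \<in> G" if "i < ?k" for i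
  proof -
    have "es ! i \<in> C \<times> C" using nth_mem[OF that] es E(2) by blast
    then show "fst (es ! i) \<in> G" "snd (es ! i) \<in> G" using C by (auto simp: mem_Times_iff)
  qed
  have len: "length x = n" if "x \<in> set (map fst es) \<or> x \<in> set (map snd es)" for x
    using that es E(2) C G_tuples by (force simp: tuples_def)
  have ab: "take n (drop (i * n) ?a) = fst (es ! i)" "take n (drop (i * n) ?b) = snd (es ! i)"
    if "i < ?k" for i
    using take_drop_concat[of "map fst es" n i] take_drop_concat[of "map snd es" n i] len that by auto
  have "length ?a = ?k * n" "length ?b = ?k * n"
    using len by (auto simp: length_concat comp_def sum_list_triv cong: map_cong)
  moreover have "set ?a \<subseteq> univ N" "set ?b \<subseteq> univ N"
    using es E(2) C set_N by fastforce+
  ultimately have t: "?a \<in> tuples N (?k * n)" "?b \<in> tuples N (?k * n)" by (auto simp: tuples_def)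
  have "\<exists>i\<in>{..<?k}. \<exists>z\<in>tuples N n. \<exists>u\<in>tuples N n. z @ p \<in> F \<and>
       take n (drop (i * n) ?a) @ z @ u \<in> graph \<and> u @ take n (drop (i * n) ?b) @ w \<in> graph"
    if w: "w \<in> C" for w
  proof -
    obtain g h z where gh: "(g, h) \<in> E" "z \<in> Z" "w = g \<cdot> z \<cdot> h" using E(3) w by blast
    then obtain i where i: "i < ?k" "es ! i = (g, h)" using es by (metis in_set_conv_nth)
    have "g \<in> G" "h \<in> G" "z \<in> G" using gh E(2) C Z(1) by auto
    then show ?thesis
      using i ab[OF i(1)] gh(2,3) Z(2) mul_closed G_tuples mul_eq
      by (intro bexI[of _ i] bexI[of _ z] bexI[of _ "g \<cdot> z"]) auto
  qed
  then show ?thesis unfolding covers_def using t by blast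
qed

lemma big_if_covers:
  assumes "covers C F k p" "big C" "C \<subseteq> G" "Ndef Z" "Z \<subseteq> G" "\<And>z. z \<in> tuples N n \<Longrightarrow> z @ p \<in> F \<Longrightarrow> z \<in> Z"
  shows "big Z"
proof -
  obtain a b where ab: "a \<in> tuples N (k * n)" "b \<in> tuples N (k * n)"
    and cov: "\<And>w. w \<in> tuples N n \<Longrightarrow> w \<in> C \<Longrightarrow> \<exists>i\<in>{..<k}. \<exists>z\<in>tuples N n. \<exists>u\<in>tuples N n. z @ p \<in> F \<and>
       take n (drop (i * n) a) @ z @ u \<in> graph \<and> u @ take n (drop (i * n) b) @ w \<in> graph"
    using assms(1) unfolding covers_def by blast
  define g h where "g i = take n (drop (i * n) a)" and "h i = take n (drop (i * n) b)" for i
  have gh: "g i \<in> tuples N n" "h i \<in> tuples N n" if "i < k" for i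
  proof -
    have "i * n + n \<le> k * n" using that by (metis Suc_leI add.commute mult_Suc mult_le_mono1)
    then show "g i \<in> tuples N n" "h i \<in> tuples N n"
      using ab by (auto simp: tuples_def g_def h_def dest!: in_set_takeD in_set_dropD)
  qed
  let ?I = "{i \<in> {..<k}. g i \<in> G \<and> h i \<in> G}"
  let ?T = "\<lambda>i. (\<lambda>u. u \<cdot> h i) ` (\<lambda>z. g i \<cdot> z) ` Z"
  have sub: "(\<lambda>z. g i \<cdot> z) ` Z \<subseteq> G" if "i \<in> ?I" for i using that assms(5) mul_closed by auto
  have T: "Ndef (?T i)" if "i \<in> ?I" for i
    using that sub[OF that] assms(4,5) by (intro Ndef_translate_right Ndef_translate_left) auto
  have "C \<subseteq> (\<Union>i\<in>?I. ?T i)"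
  proof
    fix w assume w: "w \<in> C"
    then have wt: "w \<in> tuples N n" using assms(3) G_tuples by blast
    obtain i z u where i: "i < k" "z \<in> tuples N n" "u \<in> tuples N n" "z @ p \<in> F"
      "g i @ z @ u \<in> graph" "u @ h i @ w \<in> graph"
      using cov[OF wt w] unfolding g_def h_def by blast
    then have "g i \<in> G \<and> h i \<in> G \<and> u = g i \<cdot> z \<and> w = u \<cdot> h i"
      using graph_iff[of "g i" z u] graph_iff[of u "h i" w] gh[OF i(1)] wt by blast
    then show "w \<in> (\<Union>i\<in>?I. ?T i)" using i assms(6) by blast
  qed
  then have "\<exists>i\<in>?I. big (?T i)" using T assms(2) by (intro rank_UN[of ?I _ C]) auto
  then obtain i where i: "i \<in> ?I" "big (?T i)" ..
  have "h i \<in> G" using i(1) by simp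
  have "?T i \<subseteq> G" using sub[OF i(1)] \<open>h i \<in> G\<close> mul_closed by (blast elim: imageE)
  then have "big ((\<lambda>u. u \<cdot> inv\<^bsub>GN\<^esub> (h i)) ` ?T i)"
    by (rule rank_translate_right[OF inv_G[OF \<open>h i \<in> G\<close>] _ i(2)])
  moreover have "(\<lambda>u. u \<cdot> inv\<^bsub>GN\<^esub> (h i)) ` ?T i = (\<lambda>z. g i \<cdot> z) ` Z"
  proof -
    have "(\<lambda>u. u \<cdot> inv\<^bsub>GN\<^esub> (h i)) ` ?T i = (\<lambda>u. u) ` (\<lambda>z. g i \<cdot> z) ` Z"
      unfolding image_image[of _ "\<lambda>u. u \<cdot> h i"] using sub[OF i(1)] i(1) by (intro image_cong) auto
    then show ?thesis by simp
  qed
  ultimately show ?thesis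
    using i(1) assms(5) rank_untranslate_left[of "g i" Z \<alpha>] by simp
qed

text \<open>Both \<open>Z\<close> and \<open>C - Z\<close> have finitely many two-sided translates that cover \<open>C\<close>. This is a first-order
  property of the parameters of \<open>Z\<close>, so there are parameters in \<open>M\<close> that have it; they split \<open>C\<close> over
  \<open>M\<close> into two big sets.\<close>

lemma irreducible_group_over_N:
  assumes C: "irreducible_over_M C" "subgroup C GN" "\<not> rank_ge C \<gamma>"
    and Z: "Z \<subseteq> C" "big Z" "big (C - Z)"
  shows False
proof -
  have C': "Mdef C" "C \<subseteq> G" "big C" using C(1) by (auto simp: irreducible_over_M_def)
  obtain m \<phi> ps where ps: "ps \<in> tuples N m" "is_fm L (n + m) \<phi>" "Z = solutions N n \<phi> ps"
    using morley_ge_definable[OF Z(2)] unfolding definable_def by blast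
  define F where "F = solutions N (n + m) \<phi> []"
  have F: "dset (univ M) (n + m) F"
    unfolding F_def using ps(2) by (intro solutions_dset[of _ 0]) (auto simp: tuples_def)
  have F_iff: "x @ p \<in> F \<longleftrightarrow> sat N (x @ p) \<phi>" if "x \<in> tuples N n" "p \<in> tuples N m" for x p
    using that by (auto simp: F_def solutions_def tuples_def)
  define F1 where "F1 = {x @ p | x p. x \<in> tuples N n \<and> p \<in> tuples N m \<and> x \<in> C \<and> x @ p \<in> F}"
  define F2 where "F2 = {x @ p | x p. x \<in> tuples N n \<and> p \<in> tuples N m \<and> x \<in> C \<and> x @ p \<notin> F}"
  have dF: "dset (univ M) (n + m) F1" "dset (univ M) (n + m) F2"
    unfolding F1_def F2_def
    by (intro dset_Collect2 dpred_conj dpred_not dpred_mem[OF C'(1)] dpred_mem[OF F]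
        dterm_append dterm_map)+
  have mem: "x @ p \<in> F1 \<longleftrightarrow> x \<in> C \<and> x @ p \<in> F" "x @ p \<in> F2 \<longleftrightarrow> x \<in> C \<and> x @ p \<notin> F"
    if "x \<in> tuples N n" "p \<in> tuples N m" for x p
    unfolding F1_def F2_def using append_mem_product[OF that] by simp_all
  have Ct: "x \<in> tuples N n" if "x \<in> C" for x using that C'(2) G_tuples by blast
  have Z_iff: "x \<in> Z \<longleftrightarrow> x @ ps \<in> F" if "x \<in> C" for x
    using ps(3) F_iff[OF Ct[OF that] ps(1)] Ct[OF that] by (simp add: solutions_def)
  have CN: "Ndef C" using C'(1) by (rule Mdef_Ndef)
  obtain E1 where E1: "finite E1" "E1 \<subseteq> C \<times> C" "\<forall>w\<in>C. \<exists>(g, h)\<in>E1. \<exists>z\<in>Z. w = g \<cdot> z \<cdot> h"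
    using two_sided_cover[OF CN C'(2) C(2,3) Z(1,2)] by (elim exE conjE)
  have "\<exists>k. covers C F1 k ps"
    using Z(1) Z_iff mem(1) Ct ps(1) C'(2)
    by (intro covers_if_two_sided_cover[OF E1]) auto
  then obtain k1 where k1: "covers C F1 k1 ps" ..
  obtain E2 where E2: "finite E2" "E2 \<subseteq> C \<times> C" "\<forall>w\<in>C. \<exists>(g, h)\<in>E2. \<exists>z\<in>C - Z. w = g \<cdot> z \<cdot> h"
    using two_sided_cover[OF CN C'(2) C(2,3) Diff_subset Z(3)] by (elim exE conjE)
  have "\<exists>k. covers C F2 k ps"
    using Z_iff mem(2) Ct ps(1) C'(2)
    by (intro covers_if_two_sided_cover[OF E2]) auto
  then obtain k2 where k2: "covers C F2 k2 ps" ..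
  let ?W = "{p \<in> tuples N m. covers C F1 k1 p} \<inter> {p \<in> tuples N m. covers C F2 k2 p}"
  have "dset (univ M) m ?W" by (intro dset_Int dset_covers C'(1) dF)
  moreover have "?W \<noteq> {}" using ps(1) k1 k2 by blast
  ultimately have "\<exists>p\<in>tuples M m. p \<in> ?W" by (rule dset_M_point)
  then obtain p where "p \<in> tuples M m" "p \<in> ?W" ..
  then have p: "p \<in> tuples M m" "p \<in> tuples N m" "covers C F1 k1 p" "covers C F2 k2 p"
    by simp_all
  define V where "V = {x \<in> tuples N n. x @ p \<in> F}"
  have V: "Mdef V"
    unfolding V_def using p(1,2) by (intro dset_fiber[OF F]) (auto simp: tuples_def)
  have "big (C \<inter> V)"
  proof (rule big_if_covers[OF p(3) C'(3,2)])
    show "z \<in> C \<inter> V" if "z \<in> tuples N n" "z @ p \<in> F1" for z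
      using mem(1)[OF that(1) p(2)] that by (simp add: V_def)
  qed (use CN Mdef_Ndef[OF V] C'(2) in \<open>auto intro: dset_Int\<close>)
  moreover have "big (C - V)"
  proof (rule big_if_covers[OF p(4) C'(3,2)])
    show "z \<in> C - V" if "z \<in> tuples N n" "z @ p \<in> F2" for z
      using mem(2)[OF that(1) p(2)] that by (simp add: V_def)
  qed (use CN Mdef_Ndef[OF V] C'(2) in \<open>auto intro: dset_Diff\<close>)
  ultimately show False using C(1) V unfolding irreducible_over_M_def by blast
qed

section \<open>Connected components\<close>

text \<open>Suppose that almost no inverse of an element of \<open>Y'\<close> is in \<open>Y\<close>. For given \<open>w \<in> Y\<close>, almost all
  \<open>x \<in> Y'\<close> satisfy \<open>w\<inverse>x \<in> Y'\<close>, by invariance of \<open>Y'\<close>. For given \<open>x \<in> Y'\<close>, almost all \<open>w \<in> Y\<close> satisfy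
  \<open>x\<inverse>w \<in> Y\<close>, by invariance of \<open>Y\<close>, that is, \<open>w\<inverse>x\<close> is the inverse of an element of \<open>Y\<close>. Choosing \<open>w\<close> and
  \<open>x\<close> in turns gives an order.\<close>

lemma inverse_meets:
  assumes C: "C \<subseteq> G" "subgroup C GN"
    and Y: "irreducible_over_M Y" "Y \<subseteq> C" "C \<inter> tuples M n \<subseteq> stab Y"
    and Y': "irreducible_over_M Y'" "Y' \<subseteq> C" "C \<inter> tuples M n \<subseteq> stab Y'"
  shows "big {y \<in> Y'. inv\<^bsub>GN\<^esub> y \<in> Y}"
proof (rule ccontr)
  let ?bad = "{y \<in> Y'. inv\<^bsub>GN\<^esub> y \<in> Y}" and ?V = "{y \<in> Y'. inv\<^bsub>GN\<^esub> y \<notin> Y}"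
  assume small: "\<not> big ?bad"
  have MY: "Mdef Y" "Mdef Y'" "big Y'" using Y Y' by (auto simp: irreducible_over_M_def)
  have YG: "Y \<subseteq> G" "Y' \<subseteq> G" using Y(2) Y'(2) C(1) by auto
  have inv: "Mdef {y \<in> G. inv\<^bsub>GN\<^esub> y \<in> Y}" by (intro def_inv MY) simp
  have "?bad = Y' \<inter> {y \<in> G. inv\<^bsub>GN\<^esub> y \<in> Y}" "?V = Y' - {y \<in> G. inv\<^bsub>GN\<^esub> y \<in> Y}"
    using YG by auto
  then have bad: "Mdef ?bad" and V: "Mdef ?V"
    using inv MY(2) by (auto intro: dset_Int dset_Diff)
  have CM: "w \<in> GM \<and> w \<in> C \<and> inv\<^bsub>GN\<^esub> w \<in> GM \<and> inv\<^bsub>GN\<^esub> w \<in> C \<inter> tuples M n"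
    if "w \<in> Y \<inter> tuples M n \<or> w \<in> Y' \<inter> tuples M n" for w
  proof -
    have "w \<in> C" "w \<in> GM" using that Y(2) Y'(2) C(1) G_M by auto
    then show ?thesis using subgroup.m_inv_closed[OF C(2)] inv_GM A_tuples by auto
  qed
  have "\<exists>F. finite F \<and> F \<subseteq> Y' \<inter> tuples M n \<and> (\<forall>w\<in>Y \<inter> tuples M n. \<exists>x\<in>F. inv\<^bsub>GN\<^esub> w \<cdot> x \<in> ?V)"
  proof (rule finite_cover_if_no_order)
    fix F assume F: "finite F" "F \<subseteq> Y \<inter> tuples M n"
    have w: "w \<in> GM" "w \<in> G" "inv\<^bsub>GN\<^esub> w \<in> GM" "inv\<^bsub>GN\<^esub> w \<in> stab Y'" if "w \<in> F" for w
      using CM[of w] that F(2) Y'(3) A_G by auto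
    define exc where "exc w = {x \<in> Y'. inv\<^bsub>GN\<^esub> w \<cdot> x \<notin> ?V}" for w
    have exc: "Mdef (exc w)" if "w \<in> F" for w
    proof -
      have "exc w = Y' - {x \<in> G. inv\<^bsub>GN\<^esub> w \<cdot> x \<in> ?V}" using YG(2) by (auto simp: exc_def)
      then show ?thesis using MY(2) Mdef_left[OF w(3)[OF that] V] by (simp add: dset_Diff)
    qed
    have small_exc: "\<not> big (exc w)" if "w \<in> F" for w
    proof
      let ?N = "{x \<in> Y'. inv\<^bsub>GN\<^esub> w \<cdot> x \<notin> Y'}" and ?B = "(\<lambda>y. w \<cdot> y) ` ?bad"
      assume "big (exc w)"
      moreover have "exc w \<subseteq> ?N \<union> ?B"
      proof
        fix x assume x: "x \<in> exc w"
        have "x = w \<cdot> (inv\<^bsub>GN\<^esub> w \<cdot> x)" using x w(2)[OF that] YG(2) by (auto simp: exc_def)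
        moreover have "inv\<^bsub>GN\<^esub> w \<cdot> x \<in> ?bad" if "x \<notin> ?N" using x that by (auto simp: exc_def)
        ultimately show "x \<in> ?N \<union> ?B" by blast
      qed
      moreover have "Ndef ?N" by (intro Mdef_Ndef left_pieces MY YG w(3)[OF that])
      moreover have "Ndef ?B" using YG(2) by (intro Ndef_translate_left Mdef_Ndef bad w(2)[OF that]) auto
      ultimately have "big ?N \<or> big ?B" by (rule rank_Un)
      moreover have "\<not> big ?N" using w(4)[OF that] by (simp add: stab_def)
      moreover have "?bad \<subseteq> G" using YG(2) by auto
      ultimately show False using rank_untranslate_left[OF w(2)[OF that], of ?bad] small by blast
    qed
    have "\<not> Y' \<subseteq> (\<Union>w\<in>F. exc w)"
    proof
      assume "Y' \<subseteq> (\<Union>w\<in>F. exc w)"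
      then have "\<exists>w\<in>F. big (exc w)" by (intro rank_UN[OF F(1) Mdef_Ndef[OF exc] MY(3)])
      then show False using small_exc by blast
    qed
    then have ne: "Y' - (\<Union>w\<in>F. exc w) \<noteq> {}" by blast
    have "Mdef (Y' - (\<Union>w\<in>F. exc w))" by (intro dset_Diff MY dset_UN F(1) exc)
    from dset_M_point[OF this ne]
    obtain x where "x \<in> tuples M n" "x \<in> Y' - (\<Union>w\<in>F. exc w)" ..
    then show "\<exists>x\<in>Y' \<inter> tuples M n. \<forall>w\<in>F. inv\<^bsub>GN\<^esub> w \<cdot> x \<in> ?V"
      by (intro bexI[of _ x]) (auto simp: exc_def)
  next
    fix w x :: "nat \<Rightarrow> 'u list" assume wx: "\<And>i. w i \<in> Y \<inter> tuples M n" "\<And>i. x i \<in> Y' \<inter> tuples M n"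
    have "inv\<^bsub>GN\<^esub> (w i) \<in> G" "x i \<in> G" for i
      using wx[of i] YG inv_G by auto
    then show "\<not> (\<forall>i j. inv\<^bsub>GN\<^esub> (w i) \<cdot> x j \<in> ?V \<longleftrightarrow> i \<le> j)"
      by (rule no_order_mul(1)[OF Mdef_Ndef[OF V]])
  qed
  then obtain F where F: "finite F" "F \<subseteq> Y' \<inter> tuples M n"
    "\<forall>w\<in>Y \<inter> tuples M n. \<exists>x\<in>F. inv\<^bsub>GN\<^esub> w \<cdot> x \<in> ?V"
    by (elim exE conjE)
  have "(\<lambda>x. inv\<^bsub>GN\<^esub> x) ` F \<subseteq> stab Y" using CM F(2) Y(3) by blast
  then obtain w where w: "w \<in> Y \<inter> tuples M n" "\<forall>x\<in>F. inv\<^bsub>GN\<^esub> x \<cdot> w \<in> Y"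
    using generic_point_exists[OF Y(1), of "(\<lambda>x. inv\<^bsub>GN\<^esub> x) ` F" "{}"] F(1) by auto
  obtain x where x: "x \<in> F" "inv\<^bsub>GN\<^esub> w \<cdot> x \<in> ?V" using F(3) w(1) by blast
  have "w \<in> G" "x \<in> G" using w(1) x(1) F(2) YG by auto
  then have "inv\<^bsub>GN\<^esub> (inv\<^bsub>GN\<^esub> w \<cdot> x) = inv\<^bsub>GN\<^esub> x \<cdot> w"
    using GN.inv_mult_group[of "inv\<^bsub>GN\<^esub> w" x] inv_G by simp
  then show False using x w(2) by simp
qed

text \<open>If \<open>Y1\<close> and \<open>Y2\<close> are disjoint, then so are the sets of elements of \<open>Y1\<close> with inverse in \<open>Y1\<close> and in
  \<open>Y2\<close>. Both are big, contrary to irreducibility of \<open>Y1\<close>.\<close>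

lemma irreducible_if_stabilized:
  assumes C: "Mdef C" "C \<subseteq> G" "subgroup C GN" "big C" "\<not> rank_ge C \<gamma>"
    and stab: "\<And>Y. irreducible_over_M Y \<Longrightarrow> Y \<subseteq> C \<Longrightarrow> C \<inter> tuples M n \<subseteq> stab Y"
  shows "irreducible_over_M C"
proof (rule ccontr)
  assume "\<not> ?thesis"
  then obtain Z where Z: "Mdef Z" "big (C \<inter> Z)" "big (C - Z)"
    using C unfolding irreducible_over_M_def by blast
  have CN: "Ndef C" using C(1) by (rule Mdef_Ndef)
  have low: "\<not> rank_ge D \<gamma>" if "D \<subseteq> C" for D
    using C(5) rank_mono[OF _ that CN] by blast
  have "\<exists>Y\<subseteq>C \<inter> Z. irreducible_over_M Y"
    using C(1,2) Z low[of "C \<inter> Z"] by (intro irreducible_subset_exists dset_Int) auto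
  then obtain Y1 where Y1: "Y1 \<subseteq> C \<inter> Z" "irreducible_over_M Y1" by blast
  have "\<exists>Y\<subseteq>C - Z. irreducible_over_M Y"
    using C(1,2) Z low[of "C - Z"] by (intro irreducible_subset_exists dset_Diff) auto
  then obtain Y2 where Y2: "Y2 \<subseteq> C - Z" "irreducible_over_M Y2" by blast
  have sub: "Y1 \<subseteq> C" "Y2 \<subseteq> C" using Y1(1) Y2(1) by auto
  let ?V = "{y \<in> G. inv\<^bsub>GN\<^esub> y \<in> Y1}"
  have V: "Mdef ?V" using Y1(2) by (intro def_inv) (auto simp: irreducible_over_M_def)
  have b: "big {y \<in> Y1. inv\<^bsub>GN\<^esub> y \<in> Y1}" "big {y \<in> Y1. inv\<^bsub>GN\<^esub> y \<in> Y2}"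
    using inverse_meets[OF C(2,3) _ _ _ Y1(2) sub(1) stab[OF Y1(2) sub(1)]]
      Y1(2) Y2(2) sub stab by blast+
  have Y1N: "Ndef Y1" using Y1(2) by (auto simp: irreducible_over_M_def intro: Mdef_Ndef)
  have eq: "{y \<in> Y1. inv\<^bsub>GN\<^esub> y \<in> Y1} = Y1 \<inter> ?V" using sub(1) C(2) by auto
  have "big (Y1 - ?V)"
    using b(2) by (rule rank_mono) (use Y1 Y2 Y1N Mdef_Ndef[OF V] in \<open>auto intro: dset_Diff\<close>)
  then show False using b(1) V Y1(2) unfolding eq irreducible_over_M_def by blast
qed

text \<open>The subgroup is minimal among the subgroups, definable over \<open>M\<close>, of the stabilizer of a generic
  component of a smallest set around \<open>H\<close> that meet \<open>H\<close> in a subgroup of finite index.\<close>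

lemma subgroup_hull:
  assumes H: "subgroup H GN" "H \<subseteq> GM"
    and least: "\<And>Q. Mdef Q \<Longrightarrow> H \<subseteq> Q \<Longrightarrow> big Q"
    and X0: "Mdef X0" "H \<subseteq> X0" "\<not> rank_ge X0 \<gamma>"
  shows "\<exists>C. Mdef C \<and> C \<subseteq> G \<and> subgroup C GN \<and> finite_index (C \<inter> H) H \<and> big C \<and> \<not> rank_ge C \<gamma> \<and>
    irreducible_over_M C"
proof -
  have HG: "h \<in> G" if "h \<in> H" for h using that H(2) A_G by blast
  \<comment> \<open>A set around \<open>H\<close> that no definable set around \<open>H\<close> cuts down by a big set.\<close>
  have "\<exists>X. Mdef X \<and> H \<subseteq> X \<and> X \<subseteq> G \<and> \<not> rank_ge X \<gamma> \<and> (\<forall>X'. Mdef X' \<and> H \<subseteq> X' \<longrightarrow> \<not> big (X - X'))"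
  proof (rule ccontr)
    assume no: "\<not> ?thesis"
    let ?P = "\<lambda>D. Mdef D \<and> H \<subseteq> D \<and> D \<subseteq> X0 \<inter> G"
    have "rank_ge (X0 \<inter> G) \<gamma>"
    proof (rule morley_ge_successor[of ?P])
      show "?P (X0 \<inter> G)" using X0 HG dset_G by (auto intro: dset_Int)
    next
      fix D assume D: "?P D"
      have "\<not> rank_ge D \<gamma>" using D X0(3) rank_mono[OF _ _ Mdef_Ndef[OF X0(1)], of D] by blast
      then obtain X' where X': "Mdef X'" "H \<subseteq> X'" "big (D - X')" using no D by blast
      have "?P (D \<inter> X')" using D X' by (auto intro: dset_Int)
      moreover have "definable L N n D" using D Mdef_Ndef definable_iff_dset by blast
      ultimately show "definable L N n D \<and>
          (\<exists>D0 D1. D0 \<subseteq> D \<and> D1 \<subseteq> D \<and> D0 \<inter> D1 = {} \<and> big D0 \<and> ?P D1)"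
        using X'(3) by (intro conjI exI[of _ "D - X'"] exI[of _ "D \<inter> X'"]) auto
    qed (use successor in auto)
    then show False using X0(3) rank_mono[OF _ _ Mdef_Ndef[OF X0(1)]] by blast
  qed
  then obtain X where X: "Mdef X" "H \<subseteq> X" "X \<subseteq> G" "\<not> rank_ge X \<gamma>"
    and minimal: "\<And>X'. Mdef X' \<Longrightarrow> H \<subseteq> X' \<Longrightarrow> \<not> big (X - X')" by blast
  have HX: "\<not> big ((\<lambda>x. h \<cdot> x) ` X - X)" if h: "h \<in> H" for h
  proof
    assume big: "big ((\<lambda>x. h \<cdot> x) ` X - X)"
    let ?X' = "{x \<in> G. h \<cdot> x \<in> X}"
    have X': "Mdef ?X'" using h H(2) by (intro Mdef_left X) auto
    have "H \<subseteq> ?X'" using HG X(2) subgroup.m_closed[OF H(1) h] by auto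
    moreover have "big (X - ?X')"
    proof (rule rank_untranslate_left[OF HG[OF h]])
      show sub: "X - ?X' \<subseteq> G" using X(3) by blast
      have "Ndef (X - ?X')" by (intro dset_Diff Mdef_Ndef X X')
      note Ndef_translate_left[OF HG[OF h] sub this]
      moreover have "(\<lambda>x. h \<cdot> x) ` X - X \<subseteq> (\<lambda>x. h \<cdot> x) ` (X - ?X')" by blast
      ultimately show "big ((\<lambda>x. h \<cdot> x) ` (X - ?X'))" using rank_mono[OF big] by blast
    qed
    ultimately show False using minimal[OF X'] by blast
  qed
  have "\<exists>Y\<subseteq>X. irreducible_over_M Y" by (rule irreducible_subset_exists[OF X(1,3) least[OF X(1,2)] X(4)])
  then obtain Y where Y: "Y \<subseteq> X" "irreducible_over_M Y" by blast
  have YX: "\<not> rank_ge Y \<gamma>" using X(4) rank_mono[OF _ Y(1) Mdef_Ndef[OF X(1)]] by blast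
  obtain S where S: "Mdef S" "S \<subseteq> G" "S \<inter> tuples M n = stab Y"
    using stab_definable[OF Y(2)] by blast
  have Sgroup: "subgroup S GN" by (rule subgroup_transfer[OF S(1,2), unfolded S(3), OF stab_subgroup[OF Y(2)]])
  have HM: "H \<subseteq> tuples M n" using H(2) A_tuples by blast
  have "S \<inter> H = stab Y \<inter> H" using S(3) HM by blast
  then have Sfin: "finite_index (S \<inter> H) H"
    using stab_finite_index[OF H Y(2,1) X(1,3,4) HX] by simp
  have Srank: "\<not> rank_ge S \<gamma>" by (rule stab_hull_rank[OF Y(2) YX S])

  have bigC: "big C" if C: "Mdef C" "C \<subseteq> G" "finite_index (C \<inter> H) H" for C
  proof -
    obtain F where F: "finite F" "F \<subseteq> H" "H \<subseteq> (\<Union>f\<in>F. (\<lambda>x. f \<cdot> x) ` (C \<inter> H))"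
      using C(3) unfolding finite_index_def by blast
    have fC: "Mdef ((\<lambda>x. f \<cdot> x) ` C)" if "f \<in> F" for f
      using that F(2) H(2) by (intro Mdef_translate_left C) auto
    have "Mdef (\<Union>f\<in>F. (\<lambda>x. f \<cdot> x) ` C)" using F(1) fC by (intro dset_UN)
    moreover have "H \<subseteq> (\<Union>f\<in>F. (\<lambda>x. f \<cdot> x) ` C)" using F(3) by blast
    ultimately have union: "big (\<Union>f\<in>F. (\<lambda>x. f \<cdot> x) ` C)" by (rule least)
    have "\<exists>f\<in>F. big ((\<lambda>x. f \<cdot> x) ` C)"
      by (intro rank_UN[OF F(1) _ union] Mdef_Ndef fC subset_refl)
    then obtain f where "f \<in> F" "big ((\<lambda>x. f \<cdot> x) ` C)" ..
    then show ?thesis using F(2) HG C(2) rank_untranslate_left[of f C] by blast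
  qed
  \<comment> \<open>A proper inclusion between subgroups with property \<open>?P\<close> leaves a coset, hence a big set, outside.\<close>
  let ?P = "\<lambda>C. Mdef C \<and> C \<subseteq> S \<and> subgroup C GN \<and> finite_index (C \<inter> H) H"
  have "\<exists>C. ?P C \<and> (\<forall>C'. ?P C' \<and> C' \<subseteq> C \<longrightarrow> C' = C)"
  proof (rule ccontr)
    assume no: "\<not> ?thesis"
    have "rank_ge S \<gamma>"
    proof (rule morley_ge_successor[of ?P])
      show "?P S" using S Sgroup Sfin by blast
    next
      fix C assume C: "?P C"
      then obtain C' where C': "?P C'" "C' \<subseteq> C" "C' \<noteq> C" using no by blast
      then obtain g where g: "g \<in> C" "g \<notin> C'" by blast
      have CG: "C \<subseteq> G" "C' \<subseteq> G" using C C' S(2) by auto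
      have "(\<lambda>x. g \<cdot> x) ` C' \<subseteq> C - C'"
      proof clarify
        fix x assume x: "x \<in> C'"
        have "g \<cdot> x \<notin> C'"
        proof
          assume "g \<cdot> x \<in> C'"
          then have "g \<cdot> x \<cdot> inv\<^bsub>GN\<^esub> x \<in> C'"
            using x C'(1) subgroup.m_closed subgroup.m_inv_closed by metis
          moreover have "g \<cdot> x \<cdot> inv\<^bsub>GN\<^esub> x = g"
            using x g(1) CG by (intro cancel_right(1)) auto
          ultimately show False using g(2) by simp
        qed
        moreover have "g \<cdot> x \<in> C"
          using x g(1) C'(2) subgroup.m_closed[of C GN g x] C by blast
        ultimately show "g \<cdot> x \<in> C - C'" by blast
      qed
      moreover have "big ((\<lambda>x. g \<cdot> x) ` C')"
        using g(1) CG C'(1) by (intro rank_translate_left bigC) auto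
      moreover have "Ndef (C - C')" using C C'(1) by (intro Mdef_Ndef dset_Diff) auto
      ultimately have "big (C - C')" using rank_mono by blast
      moreover have "definable L N n C" using C Mdef_Ndef definable_iff_dset by blast
      ultimately show "definable L N n C \<and>
          (\<exists>D0 D1. D0 \<subseteq> C \<and> D1 \<subseteq> C \<and> D0 \<inter> D1 = {} \<and> big D0 \<and> ?P D1)"
        using C'(1,2) by (intro conjI exI[of _ "C - C'"] exI[of _ C']) auto
    qed (use successor in auto)
    then show False using Srank by simp
  qed
  then obtain C where C: "?P C" and min: "\<And>C'. ?P C' \<Longrightarrow> C' \<subseteq> C \<Longrightarrow> C' = C" by blast
  have CG: "C \<subseteq> G" using C S(2) by blast
  have Cbig: "big C" using C CG by (intro bigC) auto
  have Crank: "\<not> rank_ge C \<gamma>" using C Srank rank_mono[OF _ _ Mdef_Ndef[OF S(1)]] by blast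
  have CH: "subgroup (C \<inter> H) GN" using C H(1) by (intro GN.subgroups_Inter_pair) auto
  have CX: "\<not> big ((\<lambda>x. k \<cdot> x) ` C - C)" if "k \<in> C \<inter> H" for k
  proof -
    have "(\<lambda>x. k \<cdot> x) ` C - C = {}" using that C subgroup.m_closed[of C GN k] by auto
    then show ?thesis by (metis morley_ge_nonempty)
  qed
  have "C \<inter> tuples M n \<subseteq> stab Z" if Z: "irreducible_over_M Z" "Z \<subseteq> C" for Z
  proof -
    obtain Q where Q: "Mdef Q" "Q \<subseteq> G" "Q \<inter> tuples M n = stab Z"
      using stab_definable[OF Z(1)] by blast
    have Qgroup: "subgroup Q GN" by (rule subgroup_transfer[OF Q(1,2), unfolded Q(3), OF stab_subgroup[OF Z(1)]])
    have "finite_index (stab Z \<inter> (C \<inter> H)) (C \<inter> H)"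
      using C H(2) by (intro stab_finite_index[OF CH _ Z _ CG Crank CX]) auto
    moreover have "stab Z \<inter> (C \<inter> H) = (C \<inter> Q) \<inter> H" using Q(3) HM by blast
    ultimately have "finite_index ((C \<inter> Q) \<inter> H) H"
      using C finite_index_trans[OF _ _ H(1)] by simp
    then have "?P (C \<inter> Q)"
      using C Q(1) Qgroup dset_Int[of "univ M" n C Q] GN.subgroups_Inter_pair[of C Q] by blast
    then have "C \<inter> Q = C" by (rule min) auto
    then show ?thesis using Q(3) by blast
  qed
  then have "irreducible_over_M C"
    using C CG Cbig Crank by (intro irreducible_if_stabilized) auto
  then show ?thesis using C CG Cbig Crank by blast
qed

text \<open>Inversion turns the left cosets of \<open>finite_index\<close> into right cosets.\<close>

lemma finite_rcosets:
  assumes H: "subgroup H A" and H': "subgroup H' A" and fin: "finite_index H' H"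
  shows "finite (rcosets\<^bsub>A\<lparr>carrier := H\<rparr>\<^esub> H')"
proof -
  let ?H = "A\<lparr>carrier := H\<rparr>"
  interpret HA: group ?H using H A.group_axioms by (rule subgroup.subgroup_is_group)
  obtain F where F: "finite F" "F \<subseteq> H" "H \<subseteq> (\<Union>f\<in>F. (\<lambda>x. f \<cdot> x) ` H')" and sub: "H' \<subseteq> H"
    using fin unfolding finite_index_def by blast
  have HA: "H \<subseteq> GM" using H by (rule subgroup.subset)
  have sH': "subgroup H' ?H" using H' H sub A.subgroup_incl by blast
  have "rcosets\<^bsub>?H\<^esub> H' \<subseteq> (\<lambda>f. H' #>\<^bsub>?H\<^esub> (inv\<^bsub>A\<^esub> f)) ` F"
  proof
    fix K assume "K \<in> rcosets\<^bsub>?H\<^esub> H'"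
    then obtain a where a: "a \<in> H" "K = H' #>\<^bsub>?H\<^esub> a" by (auto simp: RCOSETS_def)
    have "inv\<^bsub>A\<^esub> a \<in> H" using H a(1) by (rule subgroup.m_inv_closed)
    then obtain f x where fx: "f \<in> F" "x \<in> H'" "inv\<^bsub>A\<^esub> a = f \<cdot> x" using F(3) by blast
    have A: "a \<in> GM" "f \<in> GM" "x \<in> GM" using a(1) fx F(2) sub HA by auto
    then have "inv\<^bsub>A\<^esub> a = f \<otimes>\<^bsub>A\<^esub> x" using fx(3) mul_A by simp
    then have eq: "a = inv\<^bsub>A\<^esub> x \<otimes>\<^bsub>A\<^esub> inv\<^bsub>A\<^esub> f"
      using A A.inv_mult_group[of f x] A.inv_inv[of a] by simp
    have x: "inv\<^bsub>A\<^esub> x \<in> H'" using H' fx(2) by (rule subgroup.m_inv_closed)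
    have f: "inv\<^bsub>A\<^esub> f \<in> H" using F(2) fx(1) by (intro subgroup.m_inv_closed[OF H]) auto
    have "a \<in> H' #>\<^bsub>?H\<^esub> (inv\<^bsub>A\<^esub> f)"
      using HA.rcosI[of "inv\<^bsub>A\<^esub> x" H' "inv\<^bsub>A\<^esub> f"] x f sub eq by simp
    with f have "H' #>\<^bsub>?H\<^esub> (inv\<^bsub>A\<^esub> f) = H' #>\<^bsub>?H\<^esub> a"
      using HA.repr_independence[of a H' "inv\<^bsub>A\<^esub> f"] sH' by simp
    then show "K \<in> (\<lambda>f. H' #>\<^bsub>?H\<^esub> (inv\<^bsub>A\<^esub> f)) ` F" using a(2) fx(1) by blast
  qed
  then show ?thesis using F(1) finite_surj by blast
qed

end

theorem lemma3p5:
  fixes L :: "('f, 'r) lang" and T :: "('f, 'r) fm set"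
    and M N :: "('f, 'r, 'u) lstruct"
    and n :: nat and A :: "'u list monoid" and H :: "'u list set"
    and \<alpha> :: "'u list set ordinal"
  assumes "is_theory L T"
    and "totally_transcendental L T TYPE('u)"
    and "quantifier_elimination L T TYPE('u)"
    and "elimination_of_imaginaries L T TYPE('u)"
    and "is_model L T M"
    and "elem_substruct L M N" and "aleph0_saturated L N"
    and "definable_group L M n A"
    and "subgroup H A"
    and "\<alpha> = (LEAST \<beta>. \<exists>X. definable L M n X \<and> H \<subseteq> X \<and>
               has_morley_rank L N n (extension L M N n X) \<beta>)"
  shows "\<exists>H' C. subgroup H' (A\<lparr>carrier := H\<rparr>) \<and> finite (rcosets\<^bsub>A\<lparr>carrier := H\<rparr>\<^esub> H') \<and>
           definable L M n C \<and> subgroup C A \<and>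
           has_morley_rank L N n (extension L M N n C) \<alpha> \<and>
           irreducible_in L N n (extension L M N n C) \<and>
           H' \<subseteq> C"
proof -
  interpret definable_group_pair L N M n A
    using assms(6,8) by unfold_locales (auto simp: elem_substruct_def)
  have "is_model L T N"
  proof -
    have "sat N [] \<phi>" if "\<phi> \<in> T" for \<phi>
      using that assms(1,5) sat_M[of 0 \<phi> "[]"] by (auto simp: is_theory_def is_model_def)
    then show ?thesis using struct by (simp add: is_model_def)
  qed
  then have ranked: "\<exists>\<delta>. \<not> morley_ge L N n X \<delta>" if "definable L N n X" for X
    using assms(2,7) that unfolding totally_transcendental_def by blast
  let ?R = "\<lambda>\<beta>. \<exists>X. definable L M n X \<and> H \<subseteq> X \<and> has_morley_rank L N n (extension L M N n X) \<beta>"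
  have HA: "H \<subseteq> carrier A" using assms(9) by (rule subgroup.subset)
  have HM: "H \<subseteq> tuples M n" using HA A_tuples by blast
  have R: "\<exists>\<beta>. has_morley_rank L N n Q \<beta> \<and> ?R \<beta>" if Q: "dset (univ M) n Q" "H \<subseteq> Q" for Q
  proof -
    have QN: "definable L N n Q"
      using dset_mono[OF Q(1) univ_M(1)] by (simp add: definable_iff_dset)
    obtain \<delta> where "\<not> morley_ge L N n Q \<delta>" using ranked[OF QN] ..
    moreover have "Q \<noteq> {}" using Q(2) subgroup.one_closed[OF assms(9)] by blast
    ultimately obtain \<beta> where "has_morley_rank L N n Q \<beta>"
      using morley_rank_exists[OF QN] by blast
    then show ?thesis
      using definable_M[OF Q(1)] Q(2) HM by (intro exI[of _ \<beta>] conjI exI[of _ "Q \<inter> tuples M n"]) auto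
  qed
  have "\<exists>\<beta>. ?R \<beta>" using R[OF dset_tuples] HM tuples_M by blast
  then have "?R \<alpha>" unfolding assms(10) by (rule LeastI_ex)
  then obtain X where X: "definable L M n X" "H \<subseteq> X"
    "has_morley_rank L N n (extension L M N n X) \<alpha>" by blast
  define X0 where "X0 = extension L M N n X"
  have X0: "dset (univ M) n X0" "H \<subseteq> X0" "has_morley_rank L N n X0 \<alpha>"
    using definable_extension[OF X(1)] X(2,3) by (auto simp: X0_def)
  have X0N: "definable L N n X0"
    using dset_mono[OF X0(1) univ_M(1)] by (simp add: definable_iff_dset)
  \<comment> \<open>The type of ordinals might end with \<open>\<alpha>\<close>, but some ordinal exceeds the rank of \<open>X0\<close>.\<close>
  have "\<exists>\<delta>. \<alpha> < \<delta>"
  proof -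
    obtain \<delta> where "\<not> morley_ge L N n X0 \<delta>" using ranked[OF X0N] ..
    then have "\<not> \<delta> \<le> \<alpha>" using X0(3) morley_ge_antimono unfolding has_morley_rank_def by blast
    then show ?thesis by (auto simp: not_le)
  qed
  define \<gamma> where "\<gamma> = (LEAST \<delta>. \<alpha> < \<delta>)"
  have \<gamma>: "\<alpha> < \<gamma>" unfolding \<gamma>_def using \<open>\<exists>\<delta>. \<alpha> < \<delta>\<close> by (rule LeastI_ex)
  have above: "\<gamma> \<le> \<delta>" if "\<alpha> < \<delta>" for \<delta> unfolding \<gamma>_def using that by (rule Least_le)
  then have below: "\<forall>\<delta><\<gamma>. \<delta> \<le> \<alpha>" by (meson not_le)
  interpret tt_group_pair L N M n A \<alpha> \<gamma>
    by unfold_locales (use assms(7) ranked \<gamma> below in auto)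
  have rank_iff: "has_morley_rank L N n Q \<alpha> \<longleftrightarrow> big Q \<and> \<not> rank_ge Q \<gamma>" for Q
    unfolding has_morley_rank_def using \<gamma> above morley_ge_antimono by blast
  have least: "big Q" if Q: "Mdef Q" "H \<subseteq> Q" for Q
  proof -
    obtain \<beta> where \<beta>: "has_morley_rank L N n Q \<beta>" "?R \<beta>" using R[OF Q] by blast
    have "\<alpha> \<le> \<beta>" unfolding assms(10) using \<beta>(2) by (rule Least_le)
    then show ?thesis using \<beta>(1) morley_ge_antimono unfolding has_morley_rank_def by blast
  qed
  have HGN: "subgroup H GN" using assms(9) subgroup_A_iff by blast
  have "\<not> rank_ge X0 \<gamma>" using X0(3) rank_iff by blast
  then have "\<exists>C. Mdef C \<and> C \<subseteq> G \<and> subgroup C GN \<and> finite_index (C \<inter> H) H \<and> big C \<and>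
      \<not> rank_ge C \<gamma> \<and> irreducible_over_M C"
    using HGN HA least X0(1,2) by (intro subgroup_hull[of H X0])
  then obtain C where C: "Mdef C" "C \<subseteq> G" "subgroup C GN" "finite_index (C \<inter> H) H" "big C"
    "\<not> rank_ge C \<gamma>" "irreducible_over_M C" by (elim exE conjE)
  let ?C = "C \<inter> tuples M n"
  have CA: "?C = C \<inter> carrier A" using C(2) G_M by blast
  have "subgroup ?C GN"
    using C(3) A.subgroup_self subgroup_A_iff[of "carrier A"] unfolding CA
    by (intro GN.subgroups_Inter_pair) auto
  then have sC: "subgroup ?C A" using subgroup_A_iff CA by blast
  have "subgroup (C \<inter> H) GN" using C(3) HGN by (rule GN.subgroups_Inter_pair)
  then have sH': "subgroup (C \<inter> H) A" using subgroup_A_iff HA by blast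
  have rank: "has_morley_rank L N n C \<alpha>" using C(5,6) rank_iff by blast
  have "k \<le> 1" if splits: "splits_into L N n C \<alpha> k" for k
  proof (rule ccontr)
    assume "\<not> k \<le> 1"
    then have k: "0 < k" "1 < k" by auto
    obtain Y where Y: "disjoint_family_on Y {..<k}"
      "\<forall>i<k. definable L N n (Y i) \<and> Y i \<subseteq> C \<and> has_morley_rank L N n (Y i) \<alpha>"
      using splits unfolding splits_into_def by blast
    have big: "big (Y 0)" "big (Y 1)" using Y(2) k rank_iff by auto
    have "Y 0 \<inter> Y 1 = {}" using disjoint_family_onD[OF Y(1), of 0 1] k by simp
    then have "Y 1 \<subseteq> C - Y 0" using Y(2) k by blast
    then have "big (C - Y 0)"
      by (rule rank_mono[OF big(2) _ dset_Diff[OF Mdef_Ndef[OF C(1)] rank_Ndef[OF big(1)]]])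
    then show False
      using irreducible_group_over_N[OF C(7,3,6) _ big(1)] Y(2) k by blast
  qed
  moreover have "splits_into L N n C \<alpha> 1"
    unfolding splits_into_def using rank C(5) morley_ge_definable
    by (intro exI[of _ "\<lambda>_. C"]) (auto simp: disjoint_family_on_def)
  ultimately have "irreducible_in L N n C"
    unfolding irreducible_in_def has_morley_degree_def using rank by blast
  moreover have "subgroup (C \<inter> H) (A\<lparr>carrier := H\<rparr>)"
    using sH' assms(9) by (rule A.subgroup_incl) simp
  ultimately show ?thesis
    using definable_M[OF C(1)] sC rank finite_rcosets[OF assms(9) sH' C(4)] HM
    by (intro exI[of _ "C \<inter> H"] exI[of _ ?C]) auto
qed

end
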